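(* Let $(M',J,g')$ be a Kähler manifold with Norden metric, $\dim M'=2n+2\ge4$, of constant totally real sectional curvatures $\nu'$ and $\widetilde{\nu'}$, and let $(M,\varphi,\xi,\eta,g)$, $\dim M=2n+1$, be a real time-like hypersurface of it, with function $t$, which is an $\mathcal F_4\oplus\mathcal F_5$-manifold. Then $$\begin{aligned}R={}&\nu'[\pi_1-\pi_2-\tan t\,\pi_5]+\widetilde{\nu'}[\pi_3-\tan t\,\pi_4]\\&-\frac{dt(\xi)}{4n\cos t}\big\{\theta(\xi)[\sin t\,\pi_5+\cos t\,\pi_4]+\theta^*(\xi)[\sin t\,\pi_4-\cos t\,\pi_5]\big\}\\&-\frac{\theta(\xi)^2+\theta^*(\xi)^2}{4n^2}\pi_2-\frac{(\theta(\xi)\cos t+\theta^*(\xi)\sin t)^2}{4n^2}[\pi_1-\pi_2-\pi_4]\\&+\frac{(\theta(\xi)\cos t+\theta^*(\xi)\sin t)(\theta(\xi)\sin t-\theta^*(\xi)\cos t)}{4n^2}[\pi_3+\pi_5],\end{aligned}$$ $$\begin{aligned}\tau={}&4n(n\nu'-\widetilde{\nu'}\tan t)-dt(\xi)\theta(\xi)-dt(\xi)\theta^*(\xi)\tan t\\&-\frac{n-1}{n}(\theta(\xi)\cos t+\theta^*(\xi)\sin t)^2-\frac{\theta(\xi)^2+\theta^*(\xi)^2}{2n},\end{aligned}$$ $$\begin{aligned}\widetilde\tau={}&2n(2n-1)\widetilde{\nu'}+2n\nu'\tan t+\frac{dt(\xi)\theta(\xi)}{2}\tan t-\frac{dt(\xi)\theta^*(\xi)}{2}\\&+\frac{n-1}{n}(\theta(\xi)\sin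 t-\theta^*(\xi)\cos t)(\theta(\xi)\cos t+\theta^*(\xi)\sin t).\end{aligned}$$ Moreover, for every nondegenerate $\varphi$-holomorphic section with basis $\{\varphi x,\varphi^2x\}$, $$k(\varphi x,\varphi^2x)=-\frac{\theta(\xi)^2+\theta^*(\xi)^2}{4n^2},$$ and for every nondegenerate totally real section orthogonal to $\xi$ with basis $\{x,y\}$, $$k(x,y)=\nu'-\frac{(\theta(\xi)\cos t+\theta^*(\xi)\sin t)^2}{4n^2}.$$
   Context: Kähler manifold with Norden metric: a $(2n+2)$-dimensional manifold $M'$ with an almost complex structure $J$ ($J^2=-\mathrm{id}$) and a pseudo-Riemannian metric $g'$ such that $g'(JX,JY)=-g'(X,Y)$ and $\nabla'J=0$, where $\nabla'$ is the Levi-Civita connection of $g'$. The signature of $g'$ is neutral. Curvature tensor: $R'(X,Y)Z=\nabla'_X\nabla'_YZ-\nabla'_Y\nabla'_XZ-\nabla'_{[X,Y]}Z$, $R'(X,Y,Z,U)=g'(R'(X,Y)Z,U)$, and $\widetilde{R'}(X,Y,Z,U)=R'(X,Y,Z,JU)$. Put $\pi_1'(x,y,z,u)=g'(y,z)g'(x,u)-g'(x,z)g'(y,u)$. A 2-plane (section) with basis $\{x,y\}$ is nondegenerate if $\pi_1'(x,y,y,x)\ne0$. $M'$ is of constant totally real sectional curvatures $\nu'$, $\widetilde{\nu'}$ (functions on $M'$) if for every $p'\in M'$ and every nondegenerate section $\alpha'\subset T_{p'}M'$ with $J\alpha'\perp\alpha'$ and basis $\{x,y\}$, $R'(x,y,y,x)/\pi_1'(x,y,y,x)=\nu'(p')$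 and $\widetilde{R'}(x,y,y,x)/\pi_1'(x,y,y,x)=\widetilde{\nu'}(p')$. Real time-like hypersurface: a hypersurface $M$ of $M'$ with unit normal field $N$, $g'(N,N)=-1$, equipped with the structure $$\varphi=J+\cos t\,g'(\cdot,JN)\{\cos t\,N-\sin t\,JN\},\quad \xi=\sin t\,N+\cos t\,JN,\quad \eta=\cos t\,g'(\cdot,JN),\quad g=g'|_M,$$ where $t=\arctan\{g'(N,JN)\}\in(-\pi/2,\pi/2)$. This is an almost contact structure with Norden metric: $\varphi^2X=-X+\eta(X)\xi$, $\eta(\xi)=1$, $g(\varphi X,\varphi Y)=-g(X,Y)+\eta(X)\eta(Y)$. $\nabla$ is the Levi-Civita connection of $g$ and $R$ its curvature tensor, with the same conventions as for $R'$: $R(x,y,z,u)=g(R(x,y)z,u)$. The Weingarten and Gauss formulas are normalized as $\nabla'_XN=-AX$, $\nabla'_XY=\nabla_XY-g(AX,Y)N$. Along $M$, $\nu'$ and $\widetilde{\nu'}$ denote their restrictions. Let $F(X,Y,Z)=g((\nabla_X\varphi)Y,Z)$. With $\{e_i,\xi\}$ ($i=1,\dots,2n$) a basis of $T_pM$, $e_i\in\ker\eta$, and $(g^{ij})$ the inverse of $(g(e_i,e_j))$, put $\theta(\cdot)=g^{ij}F(e_i,e_j,\cdot)$, $\theta^*(\cdot)=g^{ij}F(e_i,\varphi e_j,\cdot)$. $M$ is an $\mathcal F_4\oplus\mathcal F_5$-manifold if $$F(x,y,z)=-\frac{\theta(\xi)}{2n}\{g(\varphi x,\varphi y)\eta(z)+g(\varphi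 x,\varphi z)\eta(y)\}-\frac{\theta^*(\xi)}{2n}\{g(x,\varphi y)\eta(z)+g(x,\varphi z)\eta(y)\}.$$ Tensors on $M$: $\pi_1(x,y,z,u)=g(y,z)g(x,u)-g(x,z)g(y,u)$; $\pi_2(x,y,z,u)=g(y,\varphi z)g(x,\varphi u)-g(x,\varphi z)g(y,\varphi u)$; $\pi_3(x,y,z,u)=-g(y,z)g(x,\varphi u)+g(x,z)g(y,\varphi u)-g(y,\varphi z)g(x,u)+g(x,\varphi z)g(y,u)$; $\pi_4(x,y,z,u)=\eta(y)\eta(z)g(x,u)-\eta(x)\eta(z)g(y,u)+\eta(x)\eta(u)g(y,z)-\eta(y)\eta(u)g(x,z)$; $\pi_5(x,y,z,u)=\eta(y)\eta(z)g(x,\varphi u)-\eta(x)\eta(z)g(y,\varphi u)+\eta(x)\eta(u)g(y,\varphi z)-\eta(y)\eta(u)g(x,\varphi z)$. For a section $\alpha\subset T_pM$ with basis $\{x,y\}$, nondegenerate means $\pi_1(x,y,y,x)\neq0$, and $k(x,y)=R(x,y,y,x)/\pi_1(x,y,y,x)$. $\alpha$ is $\varphi$-holomorphic if $\varphi\alpha=\alpha$, totally real if $\alpha\perp\varphi\alpha$. For any basis $(f_a)$ of $T_pM$ with $(g^{ab})$ the inverse of $(g(f_a,f_b))$: $\tau=g^{ad}g^{bc}R(f_a,f_b,f_c,f_d)$ and $\widetilde\tau=g^{ad}g^{bc}R(f_a,f_b,f_c,\varphi f_d)$. *)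

theory Defs
  imports "HOL-Analysis.Analysis" "HOL-Library.Function_Algebras"
begin

section \<open>Pointwise real vector space structure on functions\<close>

text \<open>
  Tangent vectors are directional-derivative operators on real functions; this instance makes
  \<^const>\<open>span\<close> and \<^const>\<open>independent\<close> available for them.
\<close>

instantiation "fun" :: (type, real_vector) real_vector
begin

definition scaleR_fun :: "real \<Rightarrow> ('a \<Rightarrow> 'b) \<Rightarrow> 'a \<Rightarrow> 'b"
  where "scaleR_fun r f = (\<lambda>x. r *\<^sub>R f x)"

instance
  by standard (auto simp: scaleR_fun_def fun_eq_iff algebra_simps)

end

definition basis_of :: "'v::real_vector list \<Rightarrow> 'v set \<Rightarrow> bool"
  where "basis_of e V \<longleftrightarrow> distinct e \<and> independent (set e) \<and> span (set e) = V"


section \<open>Smooth manifolds\<close>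

primrec Ck_on :: "nat \<Rightarrow> 'a::real_normed_vector set \<Rightarrow> ('a \<Rightarrow> 'b::real_normed_vector) \<Rightarrow> bool"
where
  "Ck_on 0 S f \<longleftrightarrow> continuous_on S f"
| "Ck_on (Suc k) S f \<longleftrightarrow>
     (\<forall>x\<in>S. f differentiable (at x)) \<and> (\<forall>v. Ck_on k S (\<lambda>x. frechet_derivative f (at x) v))"

text \<open>Only used for open \<open>S\<close>.\<close>

definition smooth_on :: "'a::real_normed_vector set \<Rightarrow> ('a \<Rightarrow> 'b::real_normed_vector) \<Rightarrow> bool"
  where "smooth_on S f \<longleftrightarrow> (\<forall>k. Ck_on k S f)"

text \<open>
  The manifold is the whole type \<open>'m\<close>; its dimension is \<open>DIM('e)\<close>. A chart is a pair of its
  domain and the coordinate map, whose values outside the domain are irrelevant.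
\<close>

type_synonym ('m, 'e) atlas = "('m set \<times> ('m \<Rightarrow> 'e)) set"

definition smooth_atlas :: "('m::topological_space, 'e::euclidean_space) atlas \<Rightarrow> bool"
  where "smooth_atlas A \<longleftrightarrow>
    (\<Union>(U, c)\<in>A. U) = UNIV \<and>
    (\<forall>(U, c)\<in>A. open U \<and> open (c ` U) \<and> homeomorphism U (c ` U) c (inv_into U c)) \<and>
    (\<forall>(U, c)\<in>A. \<forall>(V, d)\<in>A. smooth_on (c ` (U \<inter> V)) (d \<circ> inv_into U c))"

definition smooth_near ::
    "('m::topological_space, 'e::euclidean_space) atlas \<Rightarrow> 'm \<Rightarrow> ('m \<Rightarrow> real) \<Rightarrow> bool"
  where "smooth_near A p f \<longleftrightarrow>
    (\<exists>W. open W \<and> p \<in> W \<and> (\<forall>(U, c)\<in>A. smooth_on (c ` (U \<inter> W)) (f \<circ> inv_into U c)))"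

type_synonym 'm tvec = "('m \<Rightarrow> real) \<Rightarrow> real"

text \<open>
  Tangent vectors at \<open>p\<close> are the operators \<open>f \<mapsto> \<Sum>i. a\<^sup>i \<partial>f/\<partial>x\<^sup>i (p)\<close> on functions smooth near \<open>p\<close>,
  so the differential of \<open>f\<close> is \<open>df(v) = v f\<close>. The value \<open>0\<close> on other functions only serves to make equality of operators equality of
  tangent vectors.
\<close>

definition tangent_space ::
    "('m::topological_space, 'e::euclidean_space) atlas \<Rightarrow> 'm \<Rightarrow> 'm tvec set"
  where "tangent_space A p =
    {v. \<exists>(U, c)\<in>A. p \<in> U \<and> (\<exists>a. v = (\<lambda>f.
       if smooth_near A p f then frechet_derivative (f \<circ> inv_into U c) (at (c p)) a else 0))}"

text \<open>
  Vector fields, connections and tensor fields act on total functions that are smooth fields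
  near the point under consideration.
\<close>

definition field_near ::
    "('m::topological_space, 'e::euclidean_space) atlas \<Rightarrow> 'm \<Rightarrow> ('m \<Rightarrow> 'm tvec) \<Rightarrow> bool"
  where "field_near A p X \<longleftrightarrow>
    (\<exists>W. open W \<and> p \<in> W \<and>
      (\<forall>q\<in>W. X q \<in> tangent_space A q \<and>
        (\<forall>f. smooth_near A q f \<longrightarrow> smooth_near A q (\<lambda>r. X r f))))"

definition bracket ::
    "('m::topological_space, 'e::euclidean_space) atlas \<Rightarrow> ('m \<Rightarrow> 'm tvec) \<Rightarrow> ('m \<Rightarrow> 'm tvec)
     \<Rightarrow> 'm \<Rightarrow> 'm tvec"
  where "bracket A X Y p =
    (\<lambda>f. if smooth_near A p f then X p (\<lambda>q. Y q f) - Y p (\<lambda>q. X q f) else 0)"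

definition smooth_map ::
    "('h::topological_space, 'f::euclidean_space) atlas \<Rightarrow>
     ('m::topological_space, 'e::euclidean_space) atlas \<Rightarrow> ('h \<Rightarrow> 'm) \<Rightarrow> bool"
  where "smooth_map A A' \<iota> \<longleftrightarrow> continuous_on UNIV \<iota> \<and>
    (\<forall>p f. smooth_near A' (\<iota> p) f \<longrightarrow> smooth_near A p (f \<circ> \<iota>))"

definition pushforward ::
    "('m::topological_space, 'e::euclidean_space) atlas \<Rightarrow> ('h \<Rightarrow> 'm) \<Rightarrow> 'h \<Rightarrow> 'h tvec \<Rightarrow> 'm tvec"
  where "pushforward A' \<iota> p v = (\<lambda>f. if smooth_near A' (\<iota> p) f then v (f \<circ> \<iota>) else 0)"


section \<open>Pseudo-Riemannian metrics, connections and curvature\<close>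

definition pseudo_riemannian_metric ::
    "('m::topological_space, 'e::euclidean_space) atlas \<Rightarrow> ('m \<Rightarrow> 'm tvec \<Rightarrow> 'm tvec \<Rightarrow> real) \<Rightarrow> bool"
  where "pseudo_riemannian_metric A g \<longleftrightarrow> (\<forall>p.
    (\<forall>x\<in>tangent_space A p. \<forall>y\<in>tangent_space A p. g p x y = g p y x) \<and>
    (\<forall>x\<in>tangent_space A p. \<forall>y\<in>tangent_space A p. \<forall>z\<in>tangent_space A p.
        g p (x + y) z = g p x z + g p y z) \<and>
    (\<forall>x\<in>tangent_space A p. \<forall>y\<in>tangent_space A p. \<forall>r. g p (r *\<^sub>R x) y = r * g p x y) \<and>
    (\<forall>x\<in>tangent_space A p. (\<forall>y\<in>tangent_space A p. g p x y = 0) \<longrightarrow> x = 0) \<and>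
    (\<forall>X Y. field_near A p X \<longrightarrow> field_near A p Y \<longrightarrow> smooth_near A p (\<lambda>q. g q (X q) (Y q))))"

text \<open>
  \<open>D p v Y\<close> is the derivative at \<open>p\<close> of the field \<open>Y\<close> in the direction of \<open>v\<close>. Since \<open>Y\<close> need only
  be smooth near \<open>p\<close>, the Leibniz rule forces \<open>D p v Y\<close> to depend on the germ of \<open>Y\<close> only.
\<close>

definition connection ::
    "('m::topological_space, 'e::euclidean_space) atlas \<Rightarrow>
     ('m \<Rightarrow> 'm tvec \<Rightarrow> ('m \<Rightarrow> 'm tvec) \<Rightarrow> 'm tvec) \<Rightarrow> bool"
  where "connection A D \<longleftrightarrow>
    (\<forall>p Y. field_near A p Y \<longrightarrow>
      (\<forall>v\<in>tangent_space A p. D p v Y \<in> tangent_space A p) \<and>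
      (\<forall>v\<in>tangent_space A p. \<forall>w\<in>tangent_space A p. D p (v + w) Y = D p v Y + D p w Y) \<and>
      (\<forall>v\<in>tangent_space A p. \<forall>r. D p (r *\<^sub>R v) Y = r *\<^sub>R D p v Y) \<and>
      (\<forall>v\<in>tangent_space A p. \<forall>Z. field_near A p Z \<longrightarrow>
          D p v (\<lambda>q. Y q + Z q) = D p v Y + D p v Z) \<and>
      (\<forall>v\<in>tangent_space A p. \<forall>f. smooth_near A p f \<longrightarrow>
          D p v (\<lambda>q. f q *\<^sub>R Y q) = v f *\<^sub>R Y p + f p *\<^sub>R D p v Y) \<and>
      (\<forall>X. field_near A p X \<longrightarrow> field_near A p (\<lambda>q. D q (X q) Y)))"

definition levi_civita ::
    "('m::topological_space, 'e::euclidean_space) atlas \<Rightarrow> ('m \<Rightarrow> 'm tvec \<Rightarrow> 'm tvec \<Rightarrow> real) \<Rightarrow>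
     ('m \<Rightarrow> 'm tvec \<Rightarrow> ('m \<Rightarrow> 'm tvec) \<Rightarrow> 'm tvec) \<Rightarrow> bool"
  where "levi_civita A g D \<longleftrightarrow> connection A D \<and>
    (\<forall>p X Y. field_near A p X \<longrightarrow> field_near A p Y \<longrightarrow>
      D p (X p) Y - D p (Y p) X = bracket A X Y p \<and>
      (\<forall>v\<in>tangent_space A p.
         v (\<lambda>q. g q (X q) (Y q)) = g p (D p v X) (Y p) + g p (X p) (D p v Y)))"

text \<open>The tensors below are evaluated by extending vectors at \<open>p\<close> to arbitrary smooth fields near \<open>p\<close>.\<close>

definition curvature ::
    "('m::topological_space, 'e::euclidean_space) atlas \<Rightarrow>
     ('m \<Rightarrow> 'm tvec \<Rightarrow> ('m \<Rightarrow> 'm tvec) \<Rightarrow> 'm tvec) \<Rightarrow>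
     'm \<Rightarrow> 'm tvec \<Rightarrow> 'm tvec \<Rightarrow> 'm tvec \<Rightarrow> 'm tvec"
  where "curvature A D p x y z = (THE w. \<forall>X Y Z.
    field_near A p X \<and> field_near A p Y \<and> field_near A p Z \<and> X p = x \<and> Y p = y \<and> Z p = z \<longrightarrow>
    w = D p x (\<lambda>q. D q (Y q) Z) - D p y (\<lambda>q. D q (X q) Z) - D p (bracket A X Y p) Z)"

definition curvature4 ::
    "('m::topological_space, 'e::euclidean_space) atlas \<Rightarrow> ('m \<Rightarrow> 'm tvec \<Rightarrow> 'm tvec \<Rightarrow> real) \<Rightarrow>
     ('m \<Rightarrow> 'm tvec \<Rightarrow> ('m \<Rightarrow> 'm tvec) \<Rightarrow> 'm tvec) \<Rightarrow>
     'm \<Rightarrow> 'm tvec \<Rightarrow> 'm tvec \<Rightarrow> 'm tvec \<Rightarrow> 'm tvec \<Rightarrow> real"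
  where "curvature4 A g D p x y z u = g p (curvature A D p x y z) u"

definition covariant_endo ::
    "('m::topological_space, 'e::euclidean_space) atlas \<Rightarrow>
     ('m \<Rightarrow> 'm tvec \<Rightarrow> ('m \<Rightarrow> 'm tvec) \<Rightarrow> 'm tvec) \<Rightarrow> ('m \<Rightarrow> 'm tvec \<Rightarrow> 'm tvec) \<Rightarrow>
     'm \<Rightarrow> 'm tvec \<Rightarrow> 'm tvec \<Rightarrow> 'm tvec"
  where "covariant_endo A D K p x y = (THE w. \<forall>Y. field_near A p Y \<and> Y p = y \<longrightarrow>
    w = D p x (\<lambda>q. K q (Y q)) - K p (D p x Y))"


section \<open>Algebraic tensors\<close>

definition pi1 :: "('v \<Rightarrow> 'v \<Rightarrow> real) \<Rightarrow> 'v \<Rightarrow> 'v \<Rightarrow> 'v \<Rightarrow> 'v \<Rightarrow> real"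
  where "pi1 g x y z u = g y z * g x u - g x z * g y u"

definition pi2 :: "('v \<Rightarrow> 'v \<Rightarrow> real) \<Rightarrow> ('v \<Rightarrow> 'v) \<Rightarrow> 'v \<Rightarrow> 'v \<Rightarrow> 'v \<Rightarrow> 'v \<Rightarrow> real"
  where "pi2 g \<phi> x y z u = g y (\<phi> z) * g x (\<phi> u) - g x (\<phi> z) * g y (\<phi> u)"

definition pi3 :: "('v \<Rightarrow> 'v \<Rightarrow> real) \<Rightarrow> ('v \<Rightarrow> 'v) \<Rightarrow> 'v \<Rightarrow> 'v \<Rightarrow> 'v \<Rightarrow> 'v \<Rightarrow> real"
  where "pi3 g \<phi> x y z u =
    - g y z * g x (\<phi> u) + g x z * g y (\<phi> u) - g y (\<phi> z) * g x u + g x (\<phi> z) * g y u"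

definition pi4 :: "('v \<Rightarrow> 'v \<Rightarrow> real) \<Rightarrow> ('v \<Rightarrow> real) \<Rightarrow> 'v \<Rightarrow> 'v \<Rightarrow> 'v \<Rightarrow> 'v \<Rightarrow> real"
  where "pi4 g \<eta> x y z u =
    \<eta> y * \<eta> z * g x u - \<eta> x * \<eta> z * g y u + \<eta> x * \<eta> u * g y z - \<eta> y * \<eta> u * g x z"

definition pi5 ::
    "('v \<Rightarrow> 'v \<Rightarrow> real) \<Rightarrow> ('v \<Rightarrow> 'v) \<Rightarrow> ('v \<Rightarrow> real) \<Rightarrow> 'v \<Rightarrow> 'v \<Rightarrow> 'v \<Rightarrow> 'v \<Rightarrow> real"
  where "pi5 g \<phi> \<eta> x y z u =
    \<eta> y * \<eta> z * g x (\<phi> u) - \<eta> x * \<eta> z * g y (\<phi> u)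
      + \<eta> x * \<eta> u * g y (\<phi> z) - \<eta> y * \<eta> u * g x (\<phi> z)"

definition orthogonal_sets :: "('v \<Rightarrow> 'v \<Rightarrow> real) \<Rightarrow> 'v set \<Rightarrow> 'v set \<Rightarrow> bool"
  where "orthogonal_sets g S T \<longleftrightarrow> (\<forall>a\<in>S. \<forall>b\<in>T. g a b = 0)"

text \<open>\<open>h\<close> is the matrix \<open>(g\<^sup>i\<^sup>j)\<close> inverse to \<open>(g(e\<^sub>i, e\<^sub>j))\<close>.\<close>

definition inverse_gram :: "('v \<Rightarrow> 'v \<Rightarrow> real) \<Rightarrow> 'v list \<Rightarrow> (nat \<Rightarrow> nat \<Rightarrow> real) \<Rightarrow> bool"
  where "inverse_gram g e h \<longleftrightarrow> (\<forall>i<length e. \<forall>j<length e.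
    (\<Sum>l<length e. h i l * g (e ! l) (e ! j)) = (if i = j then 1 else 0))"

text \<open>
  Contractions \<open>g\<^sup>i\<^sup>j B(e\<^sub>i, e\<^sub>j)\<close> and \<open>g\<^sup>a\<^sup>d g\<^sup>b\<^sup>c T(e\<^sub>a, e\<^sub>b, e\<^sub>c, e\<^sub>d)\<close>: the common value
  for all frames \<open>e\<close> in the class \<open>P\<close>.
\<close>

definition contraction ::
    "('v list \<Rightarrow> bool) \<Rightarrow> ('v \<Rightarrow> 'v \<Rightarrow> real) \<Rightarrow> ('v \<Rightarrow> 'v \<Rightarrow> real) \<Rightarrow> real"
  where "contraction P g B = (THE r. \<forall>e h. P e \<and> inverse_gram g e h \<longrightarrow>
    r = (\<Sum>i<length e. \<Sum>j<length e. h i j * B (e ! i) (e ! j)))"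

definition double_contraction ::
    "('v list \<Rightarrow> bool) \<Rightarrow> ('v \<Rightarrow> 'v \<Rightarrow> real) \<Rightarrow> ('v \<Rightarrow> 'v \<Rightarrow> 'v \<Rightarrow> 'v \<Rightarrow> real) \<Rightarrow> real"
  where "double_contraction P g T = (THE r. \<forall>e h. P e \<and> inverse_gram g e h \<longrightarrow>
    r = (\<Sum>a<length e. \<Sum>b<length e. \<Sum>c<length e. \<Sum>d<length e.
           h a d * h b c * T (e ! a) (e ! b) (e ! c) (e ! d)))"


section \<open>Kaehler manifolds with Norden metric\<close>

text \<open>The neutral signature of \<open>g\<close> is a consequence of \<open>g(Jx, Jy) = -g(x, y)\<close>.\<close>

definition kaehler_norden ::
    "('m::topological_space, 'e::euclidean_space) atlas \<Rightarrow> ('m \<Rightarrow> 'm tvec \<Rightarrow> 'm tvec) \<Rightarrow>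
     ('m \<Rightarrow> 'm tvec \<Rightarrow> 'm tvec \<Rightarrow> real) \<Rightarrow>
     ('m \<Rightarrow> 'm tvec \<Rightarrow> ('m \<Rightarrow> 'm tvec) \<Rightarrow> 'm tvec) \<Rightarrow> bool"
  where "kaehler_norden A J g D \<longleftrightarrow>
    smooth_atlas A \<and> pseudo_riemannian_metric A g \<and> levi_civita A g D \<and>
    (\<forall>p. \<forall>x\<in>tangent_space A p. J p x \<in> tangent_space A p \<and> J p (J p x) = - x \<and>
       (\<forall>r. J p (r *\<^sub>R x) = r *\<^sub>R J p x) \<and>
       (\<forall>y\<in>tangent_space A p. J p (x + y) = J p x + J p y \<and> g p (J p x) (J p y) = - g p x y)) \<and>
    (\<forall>p Y. field_near A p Y \<longrightarrow> field_near A p (\<lambda>q. J q (Y q)) \<and>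
       (\<forall>x\<in>tangent_space A p. D p x (\<lambda>q. J q (Y q)) - J p (D p x Y) = 0))"

definition constant_totally_real_curvatures ::
    "('m::topological_space, 'e::euclidean_space) atlas \<Rightarrow> ('m \<Rightarrow> 'm tvec \<Rightarrow> 'm tvec) \<Rightarrow>
     ('m \<Rightarrow> 'm tvec \<Rightarrow> 'm tvec \<Rightarrow> real) \<Rightarrow>
     ('m \<Rightarrow> 'm tvec \<Rightarrow> ('m \<Rightarrow> 'm tvec) \<Rightarrow> 'm tvec) \<Rightarrow> ('m \<Rightarrow> real) \<Rightarrow> ('m \<Rightarrow> real) \<Rightarrow> bool"
  where "constant_totally_real_curvatures A J g D \<nu> \<nu>t \<longleftrightarrow>
    (\<forall>p x y \<alpha>. \<alpha> \<subseteq> tangent_space A p \<and> basis_of [x, y] \<alpha> \<and> pi1 (g p) x y y x \<noteq> 0 \<and>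
       orthogonal_sets (g p) (J p ` \<alpha>) \<alpha> \<longrightarrow>
       curvature4 A g D p x y y x / pi1 (g p) x y y x = \<nu> p \<and>
       curvature4 A g D p x y y (J p x) / pi1 (g p) x y y x = \<nu>t p)"


section \<open>Real time-like hypersurfaces\<close>

text \<open>
  A hypersurface is given by an immersion \<open>\<iota>\<close> of codimension one, so \<open>x\<close> tangent to the
  hypersurface is identified with \<open>pushforward A' \<iota> p x\<close>. \<open>N\<close> is a smooth section of the pullback of
  the tangent bundle of the ambient manifold.
\<close>

definition timelike_hypersurface ::
    "('h::topological_space, 'f::euclidean_space) atlas \<Rightarrow>
     ('m::topological_space, 'e::euclidean_space) atlas \<Rightarrow>
     ('m \<Rightarrow> 'm tvec \<Rightarrow> 'm tvec \<Rightarrow> real) \<Rightarrow> ('h \<Rightarrow> 'm) \<Rightarrow> ('h \<Rightarrow> 'm tvec) \<Rightarrow> bool"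
  where "timelike_hypersurface A A' g' \<iota> N \<longleftrightarrow>
    smooth_atlas A \<and> DIM('e) = DIM('f) + 1 \<and> smooth_map A A' \<iota> \<and>
    (\<forall>p. inj_on (pushforward A' \<iota> p) (tangent_space A p) \<and>
       N p \<in> tangent_space A' (\<iota> p) \<and> g' (\<iota> p) (N p) (N p) = - 1 \<and>
       (\<forall>x\<in>tangent_space A p. g' (\<iota> p) (pushforward A' \<iota> p x) (N p) = 0) \<and>
       (\<forall>f. smooth_near A' (\<iota> p) f \<longrightarrow> smooth_near A p (\<lambda>q. N q f)))"

definition tangential_preimage ::
    "('h::topological_space, 'f::euclidean_space) atlas \<Rightarrow>
     ('m::topological_space, 'e::euclidean_space) atlas \<Rightarrow> ('h \<Rightarrow> 'm) \<Rightarrow> 'h \<Rightarrow> 'm tvec \<Rightarrow> 'h tvec"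
  where "tangential_preimage A A' \<iota> p w =
    (THE x. x \<in> tangent_space A p \<and> pushforward A' \<iota> p x = w)"

definition induced_t ::
    "('m \<Rightarrow> 'm tvec \<Rightarrow> 'm tvec) \<Rightarrow> ('m \<Rightarrow> 'm tvec \<Rightarrow> 'm tvec \<Rightarrow> real) \<Rightarrow>
     ('h \<Rightarrow> 'm) \<Rightarrow> ('h \<Rightarrow> 'm tvec) \<Rightarrow> 'h \<Rightarrow> real"
  where "induced_t J g' \<iota> N p = arctan (g' (\<iota> p) (N p) (J (\<iota> p) (N p)))"

definition induced_metric ::
    "('m::topological_space, 'e::euclidean_space) atlas \<Rightarrow> ('m \<Rightarrow> 'm tvec \<Rightarrow> 'm tvec \<Rightarrow> real) \<Rightarrow>
     ('h \<Rightarrow> 'm) \<Rightarrow> 'h \<Rightarrow> 'h tvec \<Rightarrow> 'h tvec \<Rightarrow> real"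
  where "induced_metric A' g' \<iota> p x y =
    g' (\<iota> p) (pushforward A' \<iota> p x) (pushforward A' \<iota> p y)"

definition induced_eta ::
    "('m::topological_space, 'e::euclidean_space) atlas \<Rightarrow> ('m \<Rightarrow> 'm tvec \<Rightarrow> 'm tvec) \<Rightarrow>
     ('m \<Rightarrow> 'm tvec \<Rightarrow> 'm tvec \<Rightarrow> real) \<Rightarrow> ('h \<Rightarrow> 'm) \<Rightarrow> ('h \<Rightarrow> 'm tvec) \<Rightarrow> 'h \<Rightarrow> 'h tvec \<Rightarrow> real"
  where "induced_eta A' J g' \<iota> N p x =
    cos (induced_t J g' \<iota> N p) * g' (\<iota> p) (pushforward A' \<iota> p x) (J (\<iota> p) (N p))"

definition induced_xi ::
    "('h::topological_space, 'f::euclidean_space) atlas \<Rightarrow>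
     ('m::topological_space, 'e::euclidean_space) atlas \<Rightarrow> ('m \<Rightarrow> 'm tvec \<Rightarrow> 'm tvec) \<Rightarrow>
     ('m \<Rightarrow> 'm tvec \<Rightarrow> 'm tvec \<Rightarrow> real) \<Rightarrow> ('h \<Rightarrow> 'm) \<Rightarrow> ('h \<Rightarrow> 'm tvec) \<Rightarrow> 'h \<Rightarrow> 'h tvec"
  where "induced_xi A A' J g' \<iota> N p = tangential_preimage A A' \<iota> p
    (sin (induced_t J g' \<iota> N p) *\<^sub>R N p + cos (induced_t J g' \<iota> N p) *\<^sub>R J (\<iota> p) (N p))"

definition induced_phi ::
    "('h::topological_space, 'f::euclidean_space) atlas \<Rightarrow>
     ('m::topological_space, 'e::euclidean_space) atlas \<Rightarrow> ('m \<Rightarrow> 'm tvec \<Rightarrow> 'm tvec) \<Rightarrow>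
     ('m \<Rightarrow> 'm tvec \<Rightarrow> 'm tvec \<Rightarrow> real) \<Rightarrow> ('h \<Rightarrow> 'm) \<Rightarrow> ('h \<Rightarrow> 'm tvec) \<Rightarrow>
     'h \<Rightarrow> 'h tvec \<Rightarrow> 'h tvec"
  where "induced_phi A A' J g' \<iota> N p x = tangential_preimage A A' \<iota> p
    (J (\<iota> p) (pushforward A' \<iota> p x) +
     (cos (induced_t J g' \<iota> N p) * g' (\<iota> p) (pushforward A' \<iota> p x) (J (\<iota> p) (N p))) *\<^sub>R
       (cos (induced_t J g' \<iota> N p) *\<^sub>R N p - sin (induced_t J g' \<iota> N p) *\<^sub>R J (\<iota> p) (N p)))"


section \<open>The tensor \<open>F\<close> and the class \<open>F\<^sub>4 \<oplus> F\<^sub>5\<close>\<close>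

definition F_tensor ::
    "('h::topological_space, 'f::euclidean_space) atlas \<Rightarrow> ('h \<Rightarrow> 'h tvec \<Rightarrow> 'h tvec \<Rightarrow> real) \<Rightarrow>
     ('h \<Rightarrow> 'h tvec \<Rightarrow> ('h \<Rightarrow> 'h tvec) \<Rightarrow> 'h tvec) \<Rightarrow> ('h \<Rightarrow> 'h tvec \<Rightarrow> 'h tvec) \<Rightarrow>
     'h \<Rightarrow> 'h tvec \<Rightarrow> 'h tvec \<Rightarrow> 'h tvec \<Rightarrow> real"
  where "F_tensor A g D \<phi> p x y z = g p (covariant_endo A D \<phi> p x y) z"

definition horizontal_frame ::
    "('h::topological_space, 'f::euclidean_space) atlas \<Rightarrow> ('h \<Rightarrow> 'h tvec) \<Rightarrow>
     ('h \<Rightarrow> 'h tvec \<Rightarrow> real) \<Rightarrow> 'h \<Rightarrow> 'h tvec list \<Rightarrow> bool"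
  where "horizontal_frame A \<xi> \<eta> p e \<longleftrightarrow>
    basis_of (e @ [\<xi> p]) (tangent_space A p) \<and> (\<forall>x\<in>set e. \<eta> p x = 0)"

definition theta ::
    "('h::topological_space, 'f::euclidean_space) atlas \<Rightarrow> ('h \<Rightarrow> 'h tvec \<Rightarrow> 'h tvec \<Rightarrow> real) \<Rightarrow>
     ('h \<Rightarrow> 'h tvec \<Rightarrow> ('h \<Rightarrow> 'h tvec) \<Rightarrow> 'h tvec) \<Rightarrow> ('h \<Rightarrow> 'h tvec \<Rightarrow> 'h tvec) \<Rightarrow>
     ('h \<Rightarrow> 'h tvec) \<Rightarrow> ('h \<Rightarrow> 'h tvec \<Rightarrow> real) \<Rightarrow> 'h \<Rightarrow> 'h tvec \<Rightarrow> real"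
  where "theta A g D \<phi> \<xi> \<eta> p z =
    contraction (horizontal_frame A \<xi> \<eta> p) (g p) (\<lambda>x y. F_tensor A g D \<phi> p x y z)"

definition theta_star ::
    "('h::topological_space, 'f::euclidean_space) atlas \<Rightarrow> ('h \<Rightarrow> 'h tvec \<Rightarrow> 'h tvec \<Rightarrow> real) \<Rightarrow>
     ('h \<Rightarrow> 'h tvec \<Rightarrow> ('h \<Rightarrow> 'h tvec) \<Rightarrow> 'h tvec) \<Rightarrow> ('h \<Rightarrow> 'h tvec \<Rightarrow> 'h tvec) \<Rightarrow>
     ('h \<Rightarrow> 'h tvec) \<Rightarrow> ('h \<Rightarrow> 'h tvec \<Rightarrow> real) \<Rightarrow> 'h \<Rightarrow> 'h tvec \<Rightarrow> real"
  where "theta_star A g D \<phi> \<xi> \<eta> p z =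
    contraction (horizontal_frame A \<xi> \<eta> p) (g p) (\<lambda>x y. F_tensor A g D \<phi> p x (\<phi> p y) z)"

text \<open>\<open>n\<close> is the integer with \<open>2n + 1\<close> the dimension of the manifold.\<close>

definition F4_F5_manifold ::
    "nat \<Rightarrow> ('h::topological_space, 'f::euclidean_space) atlas \<Rightarrow>
     ('h \<Rightarrow> 'h tvec \<Rightarrow> 'h tvec \<Rightarrow> real) \<Rightarrow>
     ('h \<Rightarrow> 'h tvec \<Rightarrow> ('h \<Rightarrow> 'h tvec) \<Rightarrow> 'h tvec) \<Rightarrow> ('h \<Rightarrow> 'h tvec \<Rightarrow> 'h tvec) \<Rightarrow>
     ('h \<Rightarrow> 'h tvec) \<Rightarrow> ('h \<Rightarrow> 'h tvec \<Rightarrow> real) \<Rightarrow> bool"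
  where "F4_F5_manifold n A g D \<phi> \<xi> \<eta> \<longleftrightarrow>
    (\<forall>p. \<forall>x\<in>tangent_space A p. \<forall>y\<in>tangent_space A p. \<forall>z\<in>tangent_space A p.
      F_tensor A g D \<phi> p x y z =
        - (theta A g D \<phi> \<xi> \<eta> p (\<xi> p) / (2 * real n)) *
            (g p (\<phi> p x) (\<phi> p y) * \<eta> p z + g p (\<phi> p x) (\<phi> p z) * \<eta> p y)
        - (theta_star A g D \<phi> \<xi> \<eta> p (\<xi> p) / (2 * real n)) *
            (g p x (\<phi> p y) * \<eta> p z + g p x (\<phi> p z) * \<eta> p y))"

definition scalar_curvature ::
    "('h::topological_space, 'f::euclidean_space) atlas \<Rightarrow> ('h \<Rightarrow> 'h tvec \<Rightarrow> 'h tvec \<Rightarrow> real) \<Rightarrow>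
     ('h \<Rightarrow> 'h tvec \<Rightarrow> ('h \<Rightarrow> 'h tvec) \<Rightarrow> 'h tvec) \<Rightarrow> 'h \<Rightarrow> real"
  where "scalar_curvature A g D p =
    double_contraction (\<lambda>f. basis_of f (tangent_space A p)) (g p) (curvature4 A g D p)"

definition associated_scalar_curvature ::
    "('h::topological_space, 'f::euclidean_space) atlas \<Rightarrow> ('h \<Rightarrow> 'h tvec \<Rightarrow> 'h tvec \<Rightarrow> real) \<Rightarrow>
     ('h \<Rightarrow> 'h tvec \<Rightarrow> ('h \<Rightarrow> 'h tvec) \<Rightarrow> 'h tvec) \<Rightarrow> ('h \<Rightarrow> 'h tvec \<Rightarrow> 'h tvec) \<Rightarrow> 'h \<Rightarrow> real"
  where "associated_scalar_curvature A g D \<phi> p =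
    double_contraction (\<lambda>f. basis_of f (tangent_space A p)) (g p)
      (\<lambda>x y z u. curvature4 A g D p x y z (\<phi> p u))"

definition sectional_curvature ::
    "('h::topological_space, 'f::euclidean_space) atlas \<Rightarrow> ('h \<Rightarrow> 'h tvec \<Rightarrow> 'h tvec \<Rightarrow> real) \<Rightarrow>
     ('h \<Rightarrow> 'h tvec \<Rightarrow> ('h \<Rightarrow> 'h tvec) \<Rightarrow> 'h tvec) \<Rightarrow> 'h \<Rightarrow> 'h tvec \<Rightarrow> 'h tvec \<Rightarrow> real"
  where "sectional_curvature A g D p x y = curvature4 A g D p x y y x / pi1 (g p) x y y x"

end

(*
  Sections along the immersion are differentiated with the pullback of the ambient Levi-Civita
  connection. Its curvature is the pulled-back ambient curvature and its tangential part is the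
  Levi-Civita connection of the hypersurface, which gives the Gauss equation
  R = R' - h \<and> h with h the second fundamental form. Constancy of the totally real sectional
  curvatures makes the complex curvature tensor R' - i R'(., ., ., J .) a multiple, at each point, of
  the constant curvature tensor of the complex metric g' - i g'(., J .), hence
  R' = nu' (pi1' - pi2') + nut' pi3'. Finally F(x, y, xi) = sin t h(x, phi y) + cos t h(x, phi^2 y)
  and dt(xi) = -2 cos t h(xi, xi), so the F4+F5 condition determines h completely, and the formulas
  follow by substitution and contraction.
*)
theory Submission
  imports Defs
begin

section \<open>Smooth functions on open sets\<close>

text \<open>\<open>\<iota>\<close> is an immersion and \<open>N\<close> a section along it, so
  neither \<open>N\<close> nor pushed-forward fields are given as restrictions of ambient fields on
  which \<open>D'\<close> acts. Derivatives along \<open>\<iota>\<close> are therefore built from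
  components in one ambient coordinate frame, and their rules are proved for frame fields and
  carried over by germs, multiples and sums. Curvature and the covariant derivative of
  \<open>\<phi>\<close> are definite descriptions over all extensions, so tensoriality must precede
  every formula. Tangential parts are taken pointwise; their smoothness comes from an overdetermined
  linear system with smooth coefficients. Algebraically, the F4+F5 identity at
  \<open>z = \<xi>\<close>, for \<open>y\<close> and for \<open>\<phi> y\<close>, is a linear system
  for \<open>h(x, \<phi> y)\<close> and \<open>h(x, \<phi> (\<phi> y))\<close> with an orthogonal
  matrix of entries \<open>sin t\<close>, \<open>cos t\<close>. Solving it produces the combinations
  \<open>a = (\<theta> cos t + \<theta>s sin t) / 2n\<close> and
  \<open>b = (\<theta> sin t - \<theta>s cos t) / 2n\<close>. With
  \<open>r = h(\<xi>, \<xi>)\<close>, all coefficients of the curvature are polynomials in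
  \<open>a\<close>, \<open>b\<close>, \<open>r\<close>, \<open>tan t\<close> and the two ambient
  curvatures.\<close>

lemma Ck_on_cong:
  assumes "open S" "\<And>x. x \<in> S \<Longrightarrow> f x = g x"
  shows "Ck_on k S f \<longleftrightarrow> Ck_on k S g"
  using assms(2)
proof (induction k arbitrary: f g)
  case 0
  then show ?case by (auto intro: continuous_on_cong)
next
  case (Suc k)
  have diff: "f differentiable (at x) \<longleftrightarrow> g differentiable (at x)" if "x \<in> S" for x
    unfolding differentiable_def
    using has_derivative_transform_within_open[OF _ assms(1) that] Suc.prems by metis
  have deriv: "frechet_derivative f (at x) = frechet_derivative g (at x)"
    if "x \<in> S" "f differentiable (at x)" for x
    using frechet_derivative_transform_within_open[OF that(2) assms(1) that(1)] Suc.prems by blast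
  show ?case
  proof (cases "\<forall>x\<in>S. f differentiable (at x)")
    case True
    have "Ck_on k S (\<lambda>x. frechet_derivative f (at x) v) \<longleftrightarrow> Ck_on k S (\<lambda>x. frechet_derivative g (at x) v)" for v
      by (rule Suc.IH) (use deriv True in auto)
    then show ?thesis using True diff by auto
  next
    case False
    then show ?thesis using diff by auto
  qed
qed

text \<open>The inductions below know derivatives on \<open>S\<close> through explicit formulas;
  this rule replaces the total function \<open>frechet_derivative\<close> by such a formula.\<close>

lemma Ck_on_SucI:
  assumes "open S" "\<And>x. x \<in> S \<Longrightarrow> (f has_derivative f' x) (at x)"
    and "\<And>v. Ck_on k S (\<lambda>x. f' x v)"
  shows "Ck_on (Suc k) S f"
proof -
  have "frechet_derivative f (at x) v = f' x v" if "x \<in> S" for x v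
    using frechet_derivative_at[OF assms(2)[OF that]] by simp
  then have "Ck_on k S (\<lambda>x. frechet_derivative f (at x) v)" for v
    using Ck_on_cong[OF assms(1), of "\<lambda>x. frechet_derivative f (at x) v" "\<lambda>x. f' x v"] assms(3) by auto
  then show ?thesis using assms(2) by (auto simp: differentiable_def)
qed

lemma Ck_on_SucD: "Ck_on (Suc k) S f \<Longrightarrow> Ck_on k S f"
proof (induction k arbitrary: f)
  case 0
  then show ?case
    by (auto intro!: continuous_at_imp_continuous_on differentiable_imp_continuous_within)
next
  case (Suc k)
  then show ?case by (metis Ck_on.simps(2))
qed

lemma Ck_on_imp_continuous_on: "Ck_on k S f \<Longrightarrow> continuous_on S f"
  by (induction k) (use Ck_on_SucD in auto)

lemma Ck_on_subset: "Ck_on k S f \<Longrightarrow> T \<subseteq> S \<Longrightarrow> Ck_on k T f"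
  by (induction k arbitrary: f) (auto intro: continuous_on_subset)

lemma Ck_on_Suc_has_derivative:
  "Ck_on (Suc k) S f \<Longrightarrow> x \<in> S \<Longrightarrow> (f has_derivative frechet_derivative f (at x)) (at x)"
  by (simp add: frechet_derivative_works[symmetric])

lemma Ck_on_const: "Ck_on k S (\<lambda>x. c)"
  by (induction k arbitrary: c) auto

lemma Ck_on_bounded_linear:
  assumes "open S" "bounded_linear L" "Ck_on k S f"
  shows "Ck_on k S (\<lambda>x. L (f x))"
  using assms(3)
proof (induction k arbitrary: f)
  case 0
  then show ?case using assms by (simp add: linear_continuous_on_compose bounded_linear.continuous_on)
next
  case (Suc k)
  show ?case
  proof (rule Ck_on_SucI[OF assms(1)])
    show "((\<lambda>x. L (f x)) has_derivative (\<lambda>v. L (frechet_derivative f (at x) v))) (at x)" if "x \<in> S" for x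
      using bounded_linear.has_derivative[OF assms(2) Ck_on_Suc_has_derivative[OF Suc.prems that]] .
    show "Ck_on k S (\<lambda>x. L (frechet_derivative f (at x) v))" for v
      using Suc by auto
  qed
qed

lemma Ck_on_add:
  assumes "open S" "Ck_on k S f" "Ck_on k S g"
  shows "Ck_on k S (\<lambda>x. f x + g x)"
  using assms(2,3)
proof (induction k arbitrary: f g)
  case 0
  then show ?case by (simp add: continuous_on_add)
next
  case (Suc k)
  show ?case
  proof (rule Ck_on_SucI[OF assms(1)])
    show "((\<lambda>x. f x + g x) has_derivative
        (\<lambda>v. frechet_derivative f (at x) v + frechet_derivative g (at x) v)) (at x)" if "x \<in> S" for x
      using has_derivative_add Ck_on_Suc_has_derivative Suc.prems that by blast
    show "Ck_on k S (\<lambda>x. frechet_derivative f (at x) v + frechet_derivative g (at x) v)" for v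
      using Suc by auto
  qed
qed

lemma Ck_on_bounded_bilinear:
  assumes "open S" "bounded_bilinear B" "Ck_on k S f" "Ck_on k S g"
  shows "Ck_on k S (\<lambda>x. B (f x) (g x))"
  using assms(3,4)
proof (induction k arbitrary: f g)
  case 0
  then show ?case using bounded_bilinear.continuous_on[OF assms(2)] by auto
next
  case (Suc k)
  let ?f' = "\<lambda>x. frechet_derivative f (at x)" and ?g' = "\<lambda>x. frechet_derivative g (at x)"
  show ?case
  proof (rule Ck_on_SucI[OF assms(1)])
    show "((\<lambda>x. B (f x) (g x)) has_derivative (\<lambda>v. B (f x) (?g' x v) + B (?f' x v) (g x))) (at x)"
      if "x \<in> S" for x
      by (rule bounded_bilinear.FDERIV[OF assms(2)]; rule Ck_on_Suc_has_derivative[OF _ that])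
        (use Suc.prems in blast)+
    have "Ck_on k S f" "Ck_on k S g" using Suc.prems Ck_on_SucD by blast+
    then show "Ck_on k S (\<lambda>x. B (f x) (?g' x v) + B (?f' x v) (g x))" for v
      using Suc.IH[of f "\<lambda>x. ?g' x v"] Suc.IH[of "\<lambda>x. ?f' x v" g] Suc.prems
      by (intro Ck_on_add[OF assms(1)]) auto
  qed
qed

lemma Ck_on_sum:
  assumes "open S" "\<And>i. i \<in> I \<Longrightarrow> Ck_on k S (f i)"
  shows "Ck_on k S (\<lambda>x. \<Sum>i\<in>I. f i x)"
  using assms(2)
  by (induction I rule: infinite_finite_induct) (auto intro: Ck_on_const Ck_on_add[OF assms(1)])

text \<open>In the chain rule the derivative of \<open>f\<close> is applied to a direction that
  varies with \<open>x\<close>, whereas the induction hypothesis speaks of fixed directions.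
  Expanding the direction in \<open>Basis\<close> separates the two dependences; this is why the
  middle space is Euclidean.\<close>

lemma Ck_on_compose:
  fixes g :: "'a::real_normed_vector \<Rightarrow> 'b::euclidean_space" and f :: "'b \<Rightarrow> 'c::real_normed_vector"
  assumes "open S" "open T" "g ` S \<subseteq> T" "Ck_on k S g" "Ck_on k T f"
  shows "Ck_on k S (\<lambda>x. f (g x))"
  using assms(4,5)
proof (induction k arbitrary: f)
  case 0
  then show ?case using assms(3) by (auto intro: continuous_on_compose2)
next
  case (Suc k)
  let ?f' = "\<lambda>x. frechet_derivative f (at x)" and ?g' = "\<lambda>x. frechet_derivative g (at x)"
  show ?case
  proof (rule Ck_on_SucI[OF assms(1)])
    fix x assume x: "x \<in> S"
    have "g x \<in> T" using x assms(3) by auto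
    then have "(f has_derivative ?f' (g x)) (at (g x))" "(g has_derivative ?g' x) (at x)"
      using Suc.prems x Ck_on_Suc_has_derivative by metis+
    then have 1: "((\<lambda>x. f (g x)) has_derivative (\<lambda>v. ?f' (g x) (?g' x v))) (at x)" and 2: "linear (?f' (g x))"
      using has_derivative_compose has_derivative_linear by blast+
    have "?f' (g x) (?g' x v) = (\<Sum>b\<in>Basis. (?g' x v \<bullet> b) *\<^sub>R ?f' (g x) b)" for v
    proof -
      have "?f' (g x) (?g' x v) = ?f' (g x) (\<Sum>b\<in>Basis. (?g' x v \<bullet> b) *\<^sub>R b)"
        by (simp only: euclidean_representation)
      then show ?thesis using 2 by (simp only: linear_sum linear_scale)
    qed
    with 1 show "((\<lambda>x. f (g x)) has_derivative
        (\<lambda>v. \<Sum>b\<in>Basis. (?g' x v \<bullet> b) *\<^sub>R ?f' (g x) b)) (at x)" by simp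
  next
    fix v
    have "Ck_on k S g" using Suc.prems Ck_on_SucD by blast
    then have "Ck_on k S (\<lambda>x. ?f' (g x) b)" for b
      using Suc.IH[of "\<lambda>y. ?f' y b"] Suc.prems(2) by simp
    moreover have "Ck_on k S (\<lambda>x. ?g' x v \<bullet> b)" for b
      using Ck_on_bounded_linear[OF assms(1) bounded_linear_inner_left, of k "\<lambda>x. ?g' x v"] Suc.prems by simp
    ultimately show "Ck_on k S (\<lambda>x. \<Sum>b\<in>Basis. (?g' x v \<bullet> b) *\<^sub>R ?f' (g x) b)"
      by (intro Ck_on_sum assms(1) Ck_on_bounded_bilinear[OF assms(1) bounded_bilinear_scaleR])
  qed
qed

lemma Ck_on_id: "Ck_on k S (\<lambda>x. x)"
proof (cases k)
  case (Suc j)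
  have "frechet_derivative (\<lambda>x. x) (at x) = (\<lambda>v::'a. v)" for x::'a by simp
  then show ?thesis by (simp add: Suc Ck_on_const)
qed auto

lemma Ck_on_mult: "open S \<Longrightarrow> Ck_on k S f \<Longrightarrow> Ck_on k S g \<Longrightarrow> Ck_on k S (\<lambda>x. f x * g x :: real)"
  by (rule Ck_on_bounded_bilinear[OF _ bounded_bilinear_mult])

lemma Ck_on_realI:
  fixes f :: "real \<Rightarrow> real"
  assumes "open S" "\<And>x. x \<in> S \<Longrightarrow> (f has_real_derivative f' x) (at x)" "Ck_on k S f'"
  shows "Ck_on (Suc k) S f"
  by (rule Ck_on_SucI[OF assms(1) assms(2)[unfolded has_field_derivative_def]])
    (use assms in \<open>auto intro!: Ck_on_mult Ck_on_const\<close>)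

section \<open>Smoothness of the inverse, sine, cosine and arctangent\<close>

lemma Ck_on_inverse: "Ck_on k {x::real. x \<noteq> 0} inverse"
proof (induction k)
  case 0
  then show ?case by (auto intro!: continuous_intros)
next
  case (Suc k)
  have o: "open {x::real. x \<noteq> 0}" by (simp add: Collect_neg_eq open_Compl)
  have "Ck_on k {x::real. x \<noteq> 0} (\<lambda>x. -1 * (inverse x * inverse x))"
    by (intro Ck_on_mult Ck_on_const o Suc)
  then show ?case
    by (intro Ck_on_realI[OF o, of _ "\<lambda>x. -1 * (inverse x * inverse x)"])
      (auto intro!: derivative_eq_intros)
qed

text \<open>Each derivative is the other function up to sign, so one induction has to carry
  both.\<close>

lemma Ck_on_sin_cos: "Ck_on k UNIV (sin :: real \<Rightarrow> real)" "Ck_on k UNIV (cos :: real \<Rightarrow> real)"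
proof (induction k)
  case 0
  case 1 show ?case by (auto intro!: continuous_intros)
  case 2 show ?case by (auto intro!: continuous_intros)
next
  case (Suc k)
  case 1
  show ?case
    by (rule Ck_on_realI[OF open_UNIV, of _ cos]) (auto intro!: derivative_eq_intros Suc)
  case 2
  have "Ck_on k UNIV (\<lambda>x::real. -1 * sin x)"
    by (intro Ck_on_mult Ck_on_const Suc open_UNIV)
  then show ?case
    by (intro Ck_on_realI[OF open_UNIV, of _ "\<lambda>x. - sin x"]) (auto intro!: derivative_eq_intros)
qed

text \<open>Sine and cosine of \<open>t\<close> are coefficients of \<open>\<xi>\<close> and
  \<open>\<phi>\<close>; the inverse serves to divide by a pivot in Gaussian elimination.\<close>

lemma smooth_on_sin: "smooth_on UNIV (sin :: real \<Rightarrow> real)"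
  and smooth_on_cos: "smooth_on UNIV (cos :: real \<Rightarrow> real)"
  and smooth_on_inverse: "smooth_on {x::real. x \<noteq> 0} inverse"
  by (auto simp: smooth_on_def Ck_on_sin_cos Ck_on_inverse)

lemma smooth_on_arctan: "smooth_on UNIV (arctan :: real \<Rightarrow> real)"
  unfolding smooth_on_def
proof
  fix k
  have o: "open {x::real. x \<noteq> 0}" by (simp add: Collect_neg_eq open_Compl)
  have "Ck_on k UNIV (\<lambda>x::real. 1 + x * x)"
    by (intro Ck_on_add Ck_on_mult Ck_on_const Ck_on_id open_UNIV)
  moreover have "1 + x * x \<noteq> 0" for x :: real
    by (metis add_pos_nonneg less_irrefl zero_le_square zero_less_one)
  ultimately have "Ck_on k UNIV (\<lambda>x::real. inverse (1 + x * x))"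
    by (intro Ck_on_compose[OF open_UNIV o _ _ Ck_on_inverse]) auto
  then have "Ck_on (Suc k) UNIV (arctan :: real \<Rightarrow> real)"
    by (intro Ck_on_realI[OF open_UNIV, of _ "\<lambda>x. inverse (1 + x * x)"])
      (auto intro!: derivative_eq_intros simp: power2_eq_square)
  then show "Ck_on k UNIV (arctan :: real \<Rightarrow> real)" by (rule Ck_on_SucD)
qed

lemma smooth_on_cong:
  "open S \<Longrightarrow> (\<And>x. x \<in> S \<Longrightarrow> f x = g x) \<Longrightarrow> smooth_on S f \<longleftrightarrow> smooth_on S g"
  unfolding smooth_on_def using Ck_on_cong by blast

lemma smooth_on_subset: "smooth_on S f \<Longrightarrow> T \<subseteq> S \<Longrightarrow> smooth_on T f"
  unfolding smooth_on_def using Ck_on_subset by blast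

lemma smooth_on_compose:
  fixes g :: "'a::real_normed_vector \<Rightarrow> 'b::euclidean_space"
  shows "open S \<Longrightarrow> open T \<Longrightarrow> g ` S \<subseteq> T \<Longrightarrow> smooth_on S g \<Longrightarrow> smooth_on T f \<Longrightarrow> smooth_on S (\<lambda>x. f (g x))"
  unfolding smooth_on_def using Ck_on_compose by blast

lemma smooth_on_add: "open S \<Longrightarrow> smooth_on S f \<Longrightarrow> smooth_on S g \<Longrightarrow> smooth_on S (\<lambda>x. f x + g x)"
  unfolding smooth_on_def using Ck_on_add by blast

lemma smooth_on_mult:
  "open S \<Longrightarrow> smooth_on S f \<Longrightarrow> smooth_on S g \<Longrightarrow> smooth_on S (\<lambda>x. f x * g x :: real)"
  unfolding smooth_on_def using Ck_on_mult by blast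

lemma smooth_on_const: "smooth_on S (\<lambda>x. c)"
  unfolding smooth_on_def using Ck_on_const by blast

lemma smooth_on_inner_left: "open S \<Longrightarrow> smooth_on S f \<Longrightarrow> smooth_on S (\<lambda>x. f x \<bullet> b)"
  unfolding smooth_on_def using Ck_on_bounded_linear[OF _ bounded_linear_inner_left] by blast

lemma smooth_on_has_derivative:
  "smooth_on S f \<Longrightarrow> x \<in> S \<Longrightarrow> (f has_derivative frechet_derivative f (at x)) (at x)"
  unfolding smooth_on_def using Ck_on_Suc_has_derivative by blast

lemma smooth_on_frechet_derivative:
  "smooth_on S f \<Longrightarrow> smooth_on S (\<lambda>x. frechet_derivative f (at x) v)"
  unfolding smooth_on_def using Ck_on.simps(2) by blast

section \<open>Tangent vectors as derivations\<close>

text \<open>As simp rules these would rewrite sums of tangent vectors inside eta-expanded terms.\<close>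

declare plus_fun_apply [simp del] zero_fun_apply [simp del] minus_apply [simp del] uminus_apply [simp del]

lemma scaleR_fun_apply: "(r *\<^sub>R f) x = r *\<^sub>R f x" for f :: "'a \<Rightarrow> 'b::real_vector"
  by (simp add: scaleR_fun_def)

lemmas fun_apply = plus_fun_apply zero_fun_apply minus_apply uminus_apply scaleR_fun_apply

lemma sum_fun_apply: "(\<Sum>i\<in>I. f i) x = (\<Sum>i\<in>I. f i x)" for f :: "'i \<Rightarrow> 'a \<Rightarrow> 'b::comm_monoid_add"
  by (induction I rule: infinite_finite_induct) (auto simp: fun_apply)

text \<open>Naming the operator for a fixed chart makes it a function of its coefficient vector
  \<open>a\<close>, so that tangent spaces become ranges of injective linear maps.\<close>

definition coord_vec ::
    "('m::topological_space, 'e::euclidean_space) atlas \<Rightarrow> 'm set \<Rightarrow> ('m \<Rightarrow> 'e) \<Rightarrow> 'm \<Rightarrow> 'e \<Rightarrow> 'm tvec"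
  where "coord_vec A U c p a = (\<lambda>f.
    if smooth_near A p f then frechet_derivative (f \<circ> inv_into U c) (at (c p)) a else 0)"

lemma tangent_space_coord_vec:
  "tangent_space A p = {v. \<exists>(U, c)\<in>A. p \<in> U \<and> v \<in> range (coord_vec A U c p)}"
  unfolding tangent_space_def coord_vec_def by auto

section \<open>Smoothness near a point, tested in a single chart\<close>

locale smooth_manifold =
  fixes A :: "('m::topological_space, 'e::euclidean_space) atlas"
  assumes atlas: "smooth_atlas A"
begin

lemma chart_at: obtains U c where "(U, c) \<in> A" "p \<in> U"
proof -
  have "p \<in> (\<Union>(U, c)\<in>A. U)" using atlas unfolding smooth_atlas_def by auto
  then show ?thesis using that by auto
qed

lemma open_chart: "(U, c) \<in> A \<Longrightarrow> open U"
  and open_chart_image: "(U, c) \<in> A \<Longrightarrow> open (c ` U)"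
  and chart_homeomorphism: "(U, c) \<in> A \<Longrightarrow> homeomorphism U (c ` U) c (inv_into U c)"
  and transition_smooth: "(U, c) \<in> A \<Longrightarrow> (V, d) \<in> A \<Longrightarrow> smooth_on (c ` (U \<inter> V)) (d \<circ> inv_into U c)"
  using atlas unfolding smooth_atlas_def by blast+

lemma chart_inv: "(U, c) \<in> A \<Longrightarrow> q \<in> U \<Longrightarrow> inv_into U c (c q) = q"
  using chart_homeomorphism homeomorphism_apply1 by blast

lemma open_chart_image_subset:
  assumes "(U, c) \<in> A" "open W" "W \<subseteq> U" shows "open (c ` W)"
proof -
  have "openin (top_of_set U) W" using assms by (auto simp: openin_open)
  then have "openin (top_of_set (c ` U)) (c ` W)"
    using homeomorphism_imp_open_map[OF chart_homeomorphism[OF assms(1)]] by blast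
  then show ?thesis using open_chart_image[OF assms(1)] openin_open_trans by blast
qed

text \<open>Smooth transition maps carry smoothness from one chart to all others, so the quantifier
  over the atlas can be traded for one chart at \<open>p\<close>.\<close>

lemma smooth_near_chart:
  assumes "(U, c) \<in> A" "p \<in> U"
  shows "smooth_near A p f \<longleftrightarrow>
    (\<exists>W. open W \<and> p \<in> W \<and> W \<subseteq> U \<and> smooth_on (c ` W) (f \<circ> inv_into U c))"
proof
  assume "smooth_near A p f"
  then obtain W where W: "open W" "p \<in> W" "\<forall>(U, c)\<in>A. smooth_on (c ` (U \<inter> W)) (f \<circ> inv_into U c)"
    unfolding smooth_near_def by blast
  then show "\<exists>W. open W \<and> p \<in> W \<and> W \<subseteq> U \<and> smooth_on (c ` W) (f \<circ> inv_into U c)"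
    using assms open_chart by (intro exI[of _ "U \<inter> W"]) auto
next
  assume "\<exists>W. open W \<and> p \<in> W \<and> W \<subseteq> U \<and> smooth_on (c ` W) (f \<circ> inv_into U c)"
  then obtain W where W: "open W" "p \<in> W" "W \<subseteq> U" "smooth_on (c ` W) (f \<circ> inv_into U c)" by blast
  have "smooth_on (d ` (V \<inter> W)) (f \<circ> inv_into V d)" if V: "(V, d) \<in> A" for V d
  proof -
    have op: "open (d ` (V \<inter> W))" using open_chart_image_subset[OF V, of "V \<inter> W"] W(1) open_chart[OF V] by auto
    have "smooth_on (d ` (V \<inter> W)) (c \<circ> inv_into V d)"
      using smooth_on_subset[OF transition_smooth[OF V assms(1)]] W(3) by (metis Int_mono image_mono order_refl)
    moreover have "(c \<circ> inv_into V d) ` d ` (V \<inter> W) \<subseteq> c ` W"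
      using chart_inv[OF V] by auto
    ultimately have "smooth_on (d ` (V \<inter> W)) (\<lambda>x. (f \<circ> inv_into U c) ((c \<circ> inv_into V d) x))"
      using smooth_on_compose[OF op open_chart_image_subset[OF assms(1) W(1,3)]] W(4) by blast
    then show ?thesis
      by (subst smooth_on_cong[OF op, where g = "\<lambda>x. (f \<circ> inv_into U c) ((c \<circ> inv_into V d) x)"])
        (use chart_inv[OF V] chart_inv[OF assms(1)] W(3) in auto)
  qed
  then show "smooth_near A p f" unfolding smooth_near_def using W by blast
qed

lemma smooth_near_eventually:
  assumes "smooth_near A p f" shows "\<forall>\<^sub>F q in nhds p. smooth_near A q f"
  using assms unfolding smooth_near_def eventually_nhds by blast

text \<open>The extra property \<open>P\<close> is included because most uses must shrink the
  neighbourhood to where some equation holds.\<close>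

lemma smooth_near_chartE:
  assumes "(U, c) \<in> A" "p \<in> U" "smooth_near A p f" "eventually P (nhds p)"
  obtains W where "open W" "p \<in> W" "W \<subseteq> U" "smooth_on (c ` W) (f \<circ> inv_into U c)"
    "open (c ` W)" "\<And>q. q \<in> W \<Longrightarrow> P q"
proof -
  obtain W where W: "open W" "p \<in> W" "W \<subseteq> U" "smooth_on (c ` W) (f \<circ> inv_into U c)"
    using assms(3) smooth_near_chart[OF assms(1,2)] by blast
  obtain S where S: "open S" "p \<in> S" "\<And>q. q \<in> S \<Longrightarrow> P q"
    using assms(4) unfolding eventually_nhds by blast
  show ?thesis
    by (rule that[of "W \<inter> S"])
      (use W S open_chart_image_subset[OF assms(1), of "W \<inter> S"] in \<open>auto intro: smooth_on_subset\<close>)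
qed

lemma smooth_near_cong:
  assumes "\<forall>\<^sub>F q in nhds p. f q = g q" "smooth_near A p f" shows "smooth_near A p g"
proof -
  obtain U c where U: "(U, c) \<in> A" "p \<in> U" by (rule chart_at)
  obtain W where W: "open W" "p \<in> W" "W \<subseteq> U" "smooth_on (c ` W) (f \<circ> inv_into U c)"
    "open (c ` W)" "\<And>q. q \<in> W \<Longrightarrow> f q = g q"
    by (rule smooth_near_chartE[OF U assms(2,1)]; rule that)
  have "smooth_on (c ` W) (g \<circ> inv_into U c)"
    using smooth_on_cong[OF W(5), of "f \<circ> inv_into U c" "g \<circ> inv_into U c"] W(3,4,6) chart_inv[OF U(1)]
    by (metis (no_types, lifting) comp_def image_iff subsetD)
  then show ?thesis using smooth_near_chart[OF U] W by blast
qed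

lemma smooth_near_const: "smooth_near A p (\<lambda>q. r)"
  unfolding smooth_near_def comp_def by (rule exI[of _ UNIV]) (auto intro: smooth_on_const)

lemma smooth_near_binary:
  assumes "\<And>S f g. open S \<Longrightarrow> smooth_on S f \<Longrightarrow> smooth_on S g \<Longrightarrow> smooth_on S (\<lambda>x::'e. B (f x) (g x))"
    and f: "smooth_near A p f" and g: "smooth_near A p g"
  shows "smooth_near A p (\<lambda>q. B (f q) (g q))"
proof -
  obtain U c where U: "(U, c) \<in> A" "p \<in> U" by (rule chart_at)
  obtain W where W: "open W" "p \<in> W" "W \<subseteq> U" "smooth_on (c ` W) (f \<circ> inv_into U c)" "open (c ` W)"
    by (rule smooth_near_chartE[OF U f always_eventually[of "\<lambda>_. True"]]) auto
  obtain V where V: "open V" "p \<in> V" "V \<subseteq> U" "smooth_on (c ` V) (g \<circ> inv_into U c)" "\<And>q. q \<in> V \<Longrightarrow> q \<in> W"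
    by (rule smooth_near_chartE[OF U g eventually_nhds_in_open[OF W(1,2)]]) auto
  have "smooth_on (c ` V) (f \<circ> inv_into U c)" using smooth_on_subset[OF W(4)] V(5) by blast
  with V have "smooth_on (c ` V) (\<lambda>x. B ((f \<circ> inv_into U c) x) ((g \<circ> inv_into U c) x))"
    using assms(1) open_chart_image_subset[OF U(1)] by blast
  then show ?thesis using smooth_near_chart[OF U] V by (auto simp: comp_def)
qed

lemma smooth_near_add: "smooth_near A p f \<Longrightarrow> smooth_near A p g \<Longrightarrow> smooth_near A p (\<lambda>q. f q + g q)"
  by (rule smooth_near_binary[OF smooth_on_add])

lemma smooth_near_mult: "smooth_near A p f \<Longrightarrow> smooth_near A p g \<Longrightarrow> smooth_near A p (\<lambda>q. f q * g q)"
  by (rule smooth_near_binary[OF smooth_on_mult])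

lemma smooth_near_minus: "smooth_near A p f \<Longrightarrow> smooth_near A p (\<lambda>q. - f q)"
  using smooth_near_mult[OF smooth_near_const[of p "-1"]] by simp

lemma smooth_near_diff: "smooth_near A p f \<Longrightarrow> smooth_near A p g \<Longrightarrow> smooth_near A p (\<lambda>q. f q - g q)"
  using smooth_near_add[OF _ smooth_near_minus] by simp

lemma smooth_near_sum:
  "(\<And>i. i \<in> I \<Longrightarrow> smooth_near A p (f i)) \<Longrightarrow> smooth_near A p (\<lambda>q. \<Sum>i\<in>I. f i q)"
  by (induction I rule: infinite_finite_induct) (auto intro: smooth_near_const smooth_near_add)

lemma smooth_near_eventually_in:
  assumes "smooth_near A p f" "open T" "f p \<in> T" shows "\<forall>\<^sub>F q in nhds p. f q \<in> T"
proof -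
  obtain U c where U: "(U, c) \<in> A" "p \<in> U" by (rule chart_at)
  obtain W where W: "open W" "p \<in> W" "W \<subseteq> U" "smooth_on (c ` W) (f \<circ> inv_into U c)"
    using assms(1) smooth_near_chart[OF U] by blast
  have "continuous_on (c ` W) (f \<circ> inv_into U c)"
    using W(4) Ck_on_imp_continuous_on unfolding smooth_on_def by blast
  moreover have "continuous_on W c"
    using homeomorphism_cont1[OF chart_homeomorphism[OF U(1)]] W(3) continuous_on_subset by blast
  ultimately have "continuous_on W ((f \<circ> inv_into U c) \<circ> c)" by (rule continuous_on_compose[rotated])
  then have "continuous_on W f"
    by (rule continuous_on_cong[THEN iffD1, rotated 2]) (use W chart_inv[OF U(1)] in auto)
  then have "open (f -` T \<inter> W)" using continuous_on_open_vimage[OF W(1)] assms(2) by blast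
  then show ?thesis unfolding eventually_nhds using W(2) assms(3) by (intro exI[of _ "f -` T \<inter> W"]) auto
qed

lemma smooth_near_compose:
  fixes F :: "real \<Rightarrow> real"
  assumes f: "smooth_near A p f" and "open T" "f p \<in> T" "smooth_on T F"
  shows "smooth_near A p (\<lambda>q. F (f q))"
proof -
  obtain U c where U: "(U, c) \<in> A" "p \<in> U" by (rule chart_at)
  have ev: "\<forall>\<^sub>F q in nhds p. f q \<in> T"
    by (rule smooth_near_eventually_in[OF f assms(2,3)])
  obtain W where W: "open W" "p \<in> W" "W \<subseteq> U" "smooth_on (c ` W) (f \<circ> inv_into U c)"
    "open (c ` W)" "\<And>q. q \<in> W \<Longrightarrow> f q \<in> T"
    by (rule smooth_near_chartE[OF U f ev]; rule that)
  have "(f \<circ> inv_into U c) ` c ` W \<subseteq> T" using W(3,6) chart_inv[OF U(1)] by auto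
  then have "smooth_on (c ` W) (\<lambda>x. F ((f \<circ> inv_into U c) x))"
    using smooth_on_compose[OF W(5) assms(2) _ W(4) assms(4)] by blast
  then show ?thesis using smooth_near_chart[OF U] W by (auto simp: comp_def)
qed

lemma smooth_near_inverse: "smooth_near A p f \<Longrightarrow> f p \<noteq> 0 \<Longrightarrow> smooth_near A p (\<lambda>q. inverse (f q))"
  using smooth_near_compose[of p f "{x. x \<noteq> 0}" inverse] smooth_on_inverse
  by (simp add: Collect_neg_eq open_Compl)

lemma smooth_near_coordinate:
  assumes "(U, c) \<in> A" "p \<in> U" shows "smooth_near A p (\<lambda>q. c q \<bullet> b)"
proof -
  have op: "open (c ` U)" using open_chart_image[OF assms(1)] .
  have "smooth_on (c ` U) (\<lambda>x. x \<bullet> b)"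
    by (rule smooth_on_inner_left[OF op]) (simp add: smooth_on_def Ck_on_id)
  then have "smooth_on (c ` U) ((\<lambda>q. c q \<bullet> b) \<circ> inv_into U c)"
    by (rule smooth_on_cong[OF op, THEN iffD1, rotated]) (auto simp: chart_inv[OF assms(1)])
  then show ?thesis using smooth_near_chart[OF assms] assms open_chart by blast
qed

section \<open>Tangent spaces in the components of a chart\<close>

lemma smooth_near_has_derivative:
  assumes "(U, c) \<in> A" "p \<in> U" "smooth_near A p f"
  shows "((f \<circ> inv_into U c) has_derivative frechet_derivative (f \<circ> inv_into U c) (at (c p))) (at (c p))"
proof -
  obtain W where "p \<in> W" "smooth_on (c ` W) (f \<circ> inv_into U c)"
    using assms(3) unfolding smooth_near_chart[OF assms(1,2)] by auto
  then show ?thesis using smooth_on_has_derivative[of "c ` W" "f \<circ> inv_into U c" "c p"] by simp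
qed

text \<open>The chain rule for the transition map. It shows that the operators written in one chart
  already exhaust the tangent space.\<close>

lemma coord_vec_change:
  assumes U: "(U, c) \<in> A" "p \<in> U" and V: "(V, d) \<in> A" "p \<in> V"
  shows "coord_vec A V d p a = coord_vec A U c p (frechet_derivative (c \<circ> inv_into V d) (at (d p)) a)"
proof
  fix f
  show "coord_vec A V d p a f = coord_vec A U c p (frechet_derivative (c \<circ> inv_into V d) (at (d p)) a) f"
  proof (cases "smooth_near A p f")
    case True
    have op: "open (d ` (V \<inter> U))"
      using open_chart_image_subset[OF V(1), of "V \<inter> U"] open_chart U V by auto
    have dp: "d p \<in> d ` (V \<inter> U)" using U V by auto
    have "((c \<circ> inv_into V d) has_derivative frechet_derivative (c \<circ> inv_into V d) (at (d p))) (at (d p))"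
      using smooth_on_has_derivative[OF transition_smooth[OF V(1) U(1)] dp] .
    moreover have "((f \<circ> inv_into U c) has_derivative frechet_derivative (f \<circ> inv_into U c) (at (c p)))
       (at ((c \<circ> inv_into V d) (d p)))"
      using smooth_near_has_derivative[OF U True] chart_inv[OF V] by simp
    ultimately have "((\<lambda>x. (f \<circ> inv_into U c) ((c \<circ> inv_into V d) x)) has_derivative
      (\<lambda>a. frechet_derivative (f \<circ> inv_into U c) (at (c p)) (frechet_derivative (c \<circ> inv_into V d) (at (d p)) a))) (at (d p))"
      by (rule has_derivative_compose)
    then have "((f \<circ> inv_into V d) has_derivative
      (\<lambda>a. frechet_derivative (f \<circ> inv_into U c) (at (c p)) (frechet_derivative (c \<circ> inv_into V d) (at (d p)) a))) (at (d p))"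
      by (rule has_derivative_transform_within_open[OF _ op dp])
        (use chart_inv[OF V(1)] chart_inv[OF U(1)] in auto)
    then show ?thesis unfolding coord_vec_def using True frechet_derivative_at by metis
  qed (simp add: coord_vec_def)
qed

lemma tangent_space_chart:
  assumes "(U, c) \<in> A" "p \<in> U" shows "tangent_space A p = range (coord_vec A U c p)"
proof
  have "coord_vec A V d p a \<in> range (coord_vec A U c p)" if "(V, d) \<in> A" "p \<in> V" for V d a
    using coord_vec_change[OF assms that, of a] by simp
  then show "tangent_space A p \<subseteq> range (coord_vec A U c p)"
    unfolding tangent_space_coord_vec by auto
  show "range (coord_vec A U c p) \<subseteq> tangent_space A p"
    unfolding tangent_space_coord_vec using assms by auto
qed

lemma coord_vec_apply:
  "smooth_near A p f \<Longrightarrow> coord_vec A U c p a f = frechet_derivative (f \<circ> inv_into U c) (at (c p)) a"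
  unfolding coord_vec_def by simp

lemma coord_vec_linear:
  assumes U: "(U, c) \<in> A" "p \<in> U" shows "linear (coord_vec A U c p)"
proof (rule linearI; rule ext)
  have *: "linear (frechet_derivative (f \<circ> inv_into U c) (at (c p)))" if "smooth_near A p f" for f
    using smooth_near_has_derivative[OF U that] has_derivative_linear by blast
  show "coord_vec A U c p (a + b) f = (coord_vec A U c p a + coord_vec A U c p b) f" for a b f
    by (cases "smooth_near A p f") (use linear_add[OF *] in \<open>auto simp: coord_vec_def fun_apply\<close>)
  show "coord_vec A U c p (r *\<^sub>R a) f = (r *\<^sub>R coord_vec A U c p a) f" for r a f
    by (cases "smooth_near A p f") (use linear_scale[OF *] in \<open>auto simp: coord_vec_def fun_apply\<close>)
qed

lemma coord_vec_coordinate: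
  assumes U: "(U, c) \<in> A" "p \<in> U" shows "coord_vec A U c p a (\<lambda>q. c q \<bullet> b) = a \<bullet> b"
proof -
  have "((\<lambda>x. x \<bullet> b) has_derivative (\<lambda>x. x \<bullet> b)) (at (c p))"
    by (rule bounded_linear_imp_has_derivative[OF bounded_linear_inner_left])
  then have "(((\<lambda>q. c q \<bullet> b) \<circ> inv_into U c) has_derivative (\<lambda>x. x \<bullet> b)) (at (c p))"
    by (rule has_derivative_transform_within_open[OF _ open_chart_image[OF U(1)]])
      (use U chart_inv in auto)
  then show ?thesis
    using coord_vec_apply[OF smooth_near_coordinate[OF U]] frechet_derivative_at by metis
qed

lemma coord_vec_inj:
  assumes "(U, c) \<in> A" "p \<in> U" shows "inj (coord_vec A U c p)"
  by (rule injI, rule euclidean_eqI) (metis coord_vec_coordinate[OF assms])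

text \<open>Applying \<open>coord_vec A U c p a\<close> to a coordinate function returns the
  matching component of \<open>a\<close>, so coefficients can be read off from the operator
  itself.\<close>

lemma tangent_space_expand:
  assumes U: "(U, c) \<in> A" "p \<in> U" and v: "v \<in> tangent_space A p"
  shows "v = (\<Sum>b\<in>Basis. v (\<lambda>q. c q \<bullet> b) *\<^sub>R coord_vec A U c p b)"
proof -
  obtain a where a: "v = coord_vec A U c p a" using v tangent_space_chart[OF U] by blast
  have "coord_vec A U c p a = coord_vec A U c p (\<Sum>b\<in>Basis. (a \<bullet> b) *\<^sub>R b)"
    by (simp only: euclidean_representation)
  also have "\<dots> = (\<Sum>b\<in>Basis. (a \<bullet> b) *\<^sub>R coord_vec A U c p b)"
    by (simp only: linear_sum[OF coord_vec_linear[OF U]] linear_scale[OF coord_vec_linear[OF U]])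
  finally show ?thesis unfolding a coord_vec_coordinate[OF U] .
qed

lemma coord_vec_tangent:
  "(U, c) \<in> A \<Longrightarrow> p \<in> U \<Longrightarrow> coord_vec A U c p a \<in> tangent_space A p"
  using tangent_space_chart by blast

lemma subspace_tangent_space: "subspace (tangent_space A p)"
proof -
  obtain U c where U: "(U, c) \<in> A" "p \<in> U" by (rule chart_at)
  show ?thesis
    unfolding tangent_space_chart[OF U]
    using linear_subspace_image[OF coord_vec_linear[OF U] subspace_UNIV] .
qed

lemmas tangent_add = subspace_add[OF subspace_tangent_space]
  and tangent_scale = subspace_scale[OF subspace_tangent_space]
  and tangent_sum = subspace_sum[OF subspace_tangent_space]
  and tangent_diff = subspace_diff[OF subspace_tangent_space]
  and tangent_minus = subspace_neg[OF subspace_tangent_space]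
  and tangent_zero = subspace_0[OF subspace_tangent_space]

lemma tangentE:
  assumes "v \<in> tangent_space A p"
  obtains U c a where "(U, c) \<in> A" "p \<in> U" "v = coord_vec A U c p a"
  using assms that unfolding tangent_space_coord_vec by auto

lemma tangent_not_smooth: "v \<in> tangent_space A p \<Longrightarrow> \<not> smooth_near A p f \<Longrightarrow> v f = 0"
  by (auto elim!: tangentE simp: coord_vec_def)

section \<open>Tangent vectors as derivations of germs\<close>

lemma deriv_add:
  assumes v: "v \<in> tangent_space A p" and f: "smooth_near A p f" and g: "smooth_near A p g"
  shows "v (\<lambda>q. f q + g q) = v f + v g"
proof -
  obtain U c a where U: "(U, c) \<in> A" "p \<in> U" "v = coord_vec A U c p a" using tangentE[OF v] .
  let ?f = "frechet_derivative (f \<circ> inv_into U c) (at (c p))"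
    and ?g = "frechet_derivative (g \<circ> inv_into U c) (at (c p))"
  have "frechet_derivative ((\<lambda>q. f q + g q) \<circ> inv_into U c) (at (c p)) = (\<lambda>h. ?f h + ?g h)"
    using frechet_derivative_at[OF has_derivative_add[OF
      smooth_near_has_derivative[OF U(1,2) f] smooth_near_has_derivative[OF U(1,2) g]]]
      chart_inv[OF U(1,2)]
    by (simp add: comp_def algebra_simps)
  then show ?thesis
    unfolding U(3) coord_vec_apply[OF f] coord_vec_apply[OF g] coord_vec_apply[OF smooth_near_add[OF f g]]
    by simp
qed

lemma deriv_mult:
  assumes v: "v \<in> tangent_space A p" and f: "smooth_near A p f" and g: "smooth_near A p g"
  shows "v (\<lambda>q. f q * g q) = v f * g p + f p * v g"
proof -
  obtain U c a where U: "(U, c) \<in> A" "p \<in> U" "v = coord_vec A U c p a" using tangentE[OF v] .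
  let ?f = "frechet_derivative (f \<circ> inv_into U c) (at (c p))"
    and ?g = "frechet_derivative (g \<circ> inv_into U c) (at (c p))"
  have "frechet_derivative ((\<lambda>q. f q * g q) \<circ> inv_into U c) (at (c p)) = (\<lambda>h. ?f h * g p + f p * ?g h)"
    using frechet_derivative_at[OF has_derivative_mult[OF
      smooth_near_has_derivative[OF U(1,2) f] smooth_near_has_derivative[OF U(1,2) g]]]
      chart_inv[OF U(1,2)]
    by (simp add: comp_def algebra_simps)
  then show ?thesis
    unfolding U(3) coord_vec_apply[OF f] coord_vec_apply[OF g] coord_vec_apply[OF smooth_near_mult[OF f g]]
    by simp
qed

lemma deriv_const:
  assumes v: "v \<in> tangent_space A p" shows "v (\<lambda>q. r) = 0"
proof -
  obtain U c a where U: "(U, c) \<in> A" "p \<in> U" "v = coord_vec A U c p a" using tangentE[OF v] .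
  show ?thesis unfolding U(3) coord_vec_apply[OF smooth_near_const] by (simp add: comp_def)
qed

lemma deriv_scale:
  "v \<in> tangent_space A p \<Longrightarrow> smooth_near A p f \<Longrightarrow> v (\<lambda>q. r * f q) = r * v f"
  using deriv_mult[of v p "\<lambda>q. r" f] by (simp add: smooth_near_const deriv_const)

lemma deriv_compose:
  fixes F :: "real \<Rightarrow> real"
  assumes v: "v \<in> tangent_space A p" and f: "smooth_near A p f"
    and T: "open T" "f p \<in> T" "smooth_on T F" and F: "(F has_real_derivative F') (at (f p))"
  shows "v (\<lambda>q. F (f q)) = F' * v f"
proof -
  obtain U c a where U: "(U, c) \<in> A" "p \<in> U" "v = coord_vec A U c p a" using tangentE[OF v] .
  have "(F has_derivative (\<lambda>x. F' * x)) (at ((f \<circ> inv_into U c) (c p)))"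
    using F chart_inv[OF U(1,2)] by (simp add: has_field_derivative_def)
  note frechet_derivative_at[OF has_derivative_compose[OF smooth_near_has_derivative[OF U(1,2) f] this], symmetric]
  then show ?thesis
    unfolding U(3) coord_vec_apply[OF f] coord_vec_apply[OF smooth_near_compose[OF f T]]
    by (simp add: comp_def)
qed

lemma deriv_cong:
  assumes v: "v \<in> tangent_space A p" and eq: "\<forall>\<^sub>F q in nhds p. f q = g q"
  shows "v f = v g"
proof (cases "smooth_near A p f")
  case True
  then have g: "smooth_near A p g" using smooth_near_cong[OF eq] by blast
  obtain U c a where U: "(U, c) \<in> A" "p \<in> U" "v = coord_vec A U c p a" using tangentE[OF v] .
  obtain W where W: "open W" "p \<in> W" "W \<subseteq> U" "open (c ` W)" "\<And>q. q \<in> W \<Longrightarrow> f q = g q"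
    by (rule smooth_near_chartE[OF U(1,2) True eq]; rule that)
  have "((g \<circ> inv_into U c) has_derivative frechet_derivative (f \<circ> inv_into U c) (at (c p))) (at (c p))"
    by (rule has_derivative_transform_within_open[OF smooth_near_has_derivative[OF U(1,2) True] W(4)])
      (use W chart_inv[OF U(1)] in auto)
  then show ?thesis
    unfolding U(3) coord_vec_apply[OF g] coord_vec_apply[OF True]
    using frechet_derivative_at by metis
next
  \<comment> \<open>Smoothness near \<open>p\<close> is a property of the germ, so both functions
    fail it and both derivatives take the default value 0.\<close>
  case False
  then have "\<not> smooth_near A p g"
    using smooth_near_cong[of g f p] eq by (auto simp: eq_commute)
  then show ?thesis using False tangent_not_smooth[OF v] by simp
qed

lemma smooth_near_coord_vec:
  assumes U: "(U, c) \<in> A" "p \<in> U" and f: "smooth_near A p f"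
  shows "smooth_near A p (\<lambda>q. coord_vec A U c q a f)"
proof -
  obtain W where W: "open W" "p \<in> W" "W \<subseteq> U" "smooth_on (c ` W) (f \<circ> inv_into U c)" "open (c ` W)"
    "\<And>q. q \<in> W \<Longrightarrow> smooth_near A q f"
    by (rule smooth_near_chartE[OF U f smooth_near_eventually[OF f]]; rule that)
  have "smooth_on (c ` W) (\<lambda>x. frechet_derivative (f \<circ> inv_into U c) (at x) a)"
    by (rule smooth_on_frechet_derivative[OF W(4)])
  then have "smooth_on (c ` W) ((\<lambda>q. coord_vec A U c q a f) \<circ> inv_into U c)"
    by (rule smooth_on_cong[OF W(5), THEN iffD1, rotated])
      (use W chart_inv[OF U(1)] in \<open>auto simp: coord_vec_def\<close>)
  then show ?thesis using smooth_near_chart[OF U] W by blast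
qed

end

section \<open>Connections pulled back along smooth maps\<close>

text \<open>Smooth local sections of the pullback of the tangent bundle along
  \<open>\<iota>\<close>. The \<open>eventually\<close> form lets neighbourhoods be intersected
  silently, and \<open>id\<close> recovers vector fields as a special case.\<close>

definition section_near ::
    "('h::topological_space, 'f::euclidean_space) atlas \<Rightarrow> ('m::topological_space, 'e::euclidean_space) atlas \<Rightarrow>
     ('h \<Rightarrow> 'm) \<Rightarrow> 'h \<Rightarrow> ('h \<Rightarrow> 'm tvec) \<Rightarrow> bool"
  where "section_near A A' \<iota> p V \<longleftrightarrow> (\<forall>\<^sub>F q in nhds p. V q \<in> tangent_space A' (\<iota> q) \<and>
     (\<forall>f. smooth_near A' (\<iota> q) f \<longrightarrow> smooth_near A q (\<lambda>r. V r f)))"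

lemma field_near_section: "field_near A p X \<longleftrightarrow> section_near A A id p X"
  unfolding field_near_def section_near_def eventually_nhds by auto

lemma section_near_eventually:
  "section_near A A' \<iota> p V \<Longrightarrow> \<forall>\<^sub>F q in nhds p. section_near A A' \<iota> q V"
  unfolding section_near_def by (simp add: eventually_eventually)

lemma section_near_at:
  assumes "section_near A A' \<iota> p V"
  shows "V p \<in> tangent_space A' (\<iota> p)" "smooth_near A' (\<iota> p) f \<Longrightarrow> smooth_near A p (\<lambda>r. V r f)"
  using assms eventually_nhds_x_imp_x unfolding section_near_def by fast+

lemmas field_near_eventually = section_near_eventually[of A A id for A, folded field_near_section]
  and field_near_at = section_near_at[of A A id for A, folded field_near_section, simplified]

text \<open>Pullback and tensoriality use only the connection and its vanishing torsion. Keeping the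
  metric out lets the hypersurface be such a manifold directly, with facts about its induced metric
  added later.\<close>

locale torsion_free_manifold = smooth_manifold A
  for A :: "('m::topological_space, 'e::euclidean_space) atlas" +
  fixes D :: "'m \<Rightarrow> 'm tvec \<Rightarrow> ('m \<Rightarrow> 'm tvec) \<Rightarrow> 'm tvec"
  assumes connection: "connection A D"
    and torsion_free: "field_near A p X \<Longrightarrow> field_near A p Y \<Longrightarrow> D p (X p) Y - D p (Y p) X = bracket A X Y p"
begin

lemma conn_tangent: "field_near A p Y \<Longrightarrow> v \<in> tangent_space A p \<Longrightarrow> D p v Y \<in> tangent_space A p"
  and conn_add_vec: "field_near A p Y \<Longrightarrow> v \<in> tangent_space A p \<Longrightarrow> w \<in> tangent_space A p \<Longrightarrow>
    D p (v + w) Y = D p v Y + D p w Y"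
  and conn_scale_vec: "field_near A p Y \<Longrightarrow> v \<in> tangent_space A p \<Longrightarrow> D p (r *\<^sub>R v) Y = r *\<^sub>R D p v Y"
  and conn_add: "field_near A p Y \<Longrightarrow> field_near A p Z \<Longrightarrow> v \<in> tangent_space A p \<Longrightarrow>
    D p v (\<lambda>q. Y q + Z q) = D p v Y + D p v Z"
  and conn_mult: "field_near A p Y \<Longrightarrow> smooth_near A p f \<Longrightarrow> v \<in> tangent_space A p \<Longrightarrow>
    D p v (\<lambda>q. f q *\<^sub>R Y q) = v f *\<^sub>R Y p + f p *\<^sub>R D p v Y"
  and conn_field: "field_near A p Y \<Longrightarrow> field_near A p X \<Longrightarrow> field_near A p (\<lambda>q. D q (X q) Y)"
  using connection unfolding connection_def by blast+

text \<open>Multiplying by the indicator function of a neighbourhood shows that only the germ of the field matters.\<close>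

lemma conn_cong:
  assumes Y: "field_near A p Y" and Z: "field_near A p Z" and v: "v \<in> tangent_space A p"
    and eq: "\<forall>\<^sub>F q in nhds p. Y q = Z q"
  shows "D p v Y = D p v Z"
proof -
  obtain W where W: "open W" "p \<in> W" "\<And>q. q \<in> W \<Longrightarrow> Y q = Z q"
    using eq unfolding eventually_nhds by blast
  define f :: "'m \<Rightarrow> real" where "f q = (if q \<in> W then 1 else 0)" for q
  have ev: "\<forall>\<^sub>F q in nhds p. 1 = f q"
    unfolding eventually_nhds using W by (auto simp: f_def)
  have f: "smooth_near A p f" by (rule smooth_near_cong[OF ev smooth_near_const])
  have "v f = 0" using deriv_cong[OF v ev] deriv_const[OF v] by simp
  then have *: "D p v (\<lambda>q. f q *\<^sub>R X q) = D p v X" if "field_near A p X" for X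
    using conn_mult[OF that f v] W(2) by (simp add: f_def)
  have "(\<lambda>q. f q *\<^sub>R Y q) = (\<lambda>q. f q *\<^sub>R Z q)" using W(3) by (auto simp: f_def)
  then show ?thesis using *[OF Y] *[OF Z] by simp
qed

lemma conn_sum_vec:
  assumes Y: "field_near A p Y" and "\<And>i. i \<in> I \<Longrightarrow> v i \<in> tangent_space A p"
  shows "D p (\<Sum>i\<in>I. v i) Y = (\<Sum>i\<in>I. D p (v i) Y)"
  using assms(2)
proof (induction I rule: infinite_finite_induct)
  case (insert i I)
  have "D p (v i + (\<Sum>i\<in>I. v i)) Y = D p (v i) Y + D p (\<Sum>i\<in>I. v i) Y"
    using insert.prems by (intro conn_add_vec[OF Y] tangent_sum) auto
  then show ?case using insert by (simp only: sum.insert[OF insert.hyps]) auto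
qed (use conn_scale_vec[OF Y tangent_zero, of 0] in auto)

lemma field_near_zero: "field_near A p (\<lambda>q. 0)"
  unfolding field_near_section section_near_def
  by (auto simp: tangent_zero smooth_near_const fun_apply)

lemma field_near_add:
  assumes "field_near A p X" "field_near A p Y" shows "field_near A p (\<lambda>q. X q + Y q)"
  using assms unfolding field_near_section section_near_def
  by eventually_elim (simp add: tangent_add smooth_near_add fun_apply)

lemma field_near_mult:
  assumes "field_near A p X" "smooth_near A p f" shows "field_near A p (\<lambda>q. f q *\<^sub>R X q)"
  using assms(1) smooth_near_eventually[OF assms(2)] unfolding field_near_section section_near_def
  by eventually_elim (simp add: tangent_scale smooth_near_mult fun_apply)

lemma conn_zero: "v \<in> tangent_space A p \<Longrightarrow> D p v (\<lambda>q. 0) = 0"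
  using conn_mult[OF field_near_zero smooth_near_const[of p 0], of v] deriv_const[of v p 0] by simp

text \<open>Torsion freeness replaces the usual computation with second derivatives: the bracket is
  a difference of two covariant derivatives, which are tangent.\<close>

lemma bracket_field:
  assumes X: "field_near A p X" and Y: "field_near A p Y"
  shows "bracket A X Y p \<in> tangent_space A p"
  using torsion_free[OF X Y] conn_tangent[OF Y] conn_tangent[OF X] field_near_at(1) X Y tangent_diff by metis

end

text \<open>One ambient chart is a parameter because sections are differentiated through their
  components in its coordinate frame. All later statements concern points with
  \<open>\<iota> p \<in> U\<close>, and such a chart exists at every point.\<close>

locale framed_map = dom: torsion_free_manifold A D + cod: torsion_free_manifold A' D'
  for A :: "('h::topological_space, 'f::euclidean_space) atlas"
    and D :: "'h \<Rightarrow> 'h tvec \<Rightarrow> ('h \<Rightarrow> 'h tvec) \<Rightarrow> 'h tvec"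
    and A' :: "('m::topological_space, 'e::euclidean_space) atlas"
    and D' :: "'m \<Rightarrow> 'm tvec \<Rightarrow> ('m \<Rightarrow> 'm tvec) \<Rightarrow> 'm tvec" +
  fixes \<iota> :: "'h \<Rightarrow> 'm" and U :: "'m set" and c :: "'m \<Rightarrow> 'e"
  assumes smooth_map: "smooth_map A A' \<iota>" and chart: "(U, c) \<in> A'"
begin

abbreviation "push \<equiv> pushforward A' \<iota>"
abbreviation "sect \<equiv> section_near A A' \<iota>"
abbreviation "fr b m \<equiv> coord_vec A' U c m b"
abbreviation "co b \<equiv> \<lambda>m. c m \<bullet> b"

lemma smooth_near_map: "smooth_near A' (\<iota> p) f \<Longrightarrow> smooth_near A p (\<lambda>q. f (\<iota> q))"
  using smooth_map unfolding smooth_map_def comp_def by blast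

lemma eventually_map:
  assumes "eventually P (nhds (\<iota> p))" shows "\<forall>\<^sub>F q in nhds p. P (\<iota> q)"
proof -
  obtain W where W: "open W" "\<iota> p \<in> W" "\<And>q. q \<in> W \<Longrightarrow> P q"
    using assms unfolding eventually_nhds by blast
  have "open (\<iota> -` W)" using smooth_map W(1) unfolding smooth_map_def by (simp add: open_vimage)
  then show ?thesis unfolding eventually_nhds using W by (intro exI[of _ "\<iota> -` W"]) auto
qed

lemma eventually_chart: "\<iota> p \<in> U \<Longrightarrow> \<forall>\<^sub>F q in nhds p. \<iota> q \<in> U"
  by (rule eventually_map[OF eventually_nhds_in_open[OF cod.open_chart[OF chart]]])

lemma push_apply: "smooth_near A' (\<iota> p) f \<Longrightarrow> push p v f = v (\<lambda>q. f (\<iota> q))"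
  unfolding pushforward_def comp_def by simp

lemma push_add: "push p (v + w) = push p v + push p w"
  and push_scale: "push p (r *\<^sub>R v) = r *\<^sub>R push p v"
  by (auto simp: pushforward_def fun_eq_iff fun_apply)

lemma push_minus: "push p (- v) = - push p v"
  using push_scale[of p "-1" v] by simp

lemma push_diff: "push p (v - w) = push p v - push p w"
  using push_add[of p v "- w"] by (simp add: push_minus)

lemma push_tangent:
  assumes v: "v \<in> tangent_space A p" shows "push p v \<in> tangent_space A' (\<iota> p)"
proof -
  obtain V d a where V: "(V, d) \<in> A" "p \<in> V" "v = coord_vec A V d p a" by (rule dom.tangentE[OF v])
  obtain W e where W: "(W, e) \<in> A'" "\<iota> p \<in> W" by (rule cod.chart_at)
  \<comment> \<open>\<open>smooth_map\<close> speaks of real functions only, so the differential of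
    \<open>\<iota>\<close> in coordinates is assembled from the derivatives of its
    components.\<close>
  define L where "L = (\<lambda>h. \<Sum>b\<in>Basis. frechet_derivative ((\<lambda>q. e (\<iota> q) \<bullet> b) \<circ> inv_into V d) (at (d p)) h *\<^sub>R b)"
  have "((\<lambda>x. \<Sum>b\<in>Basis. ((\<lambda>q. e (\<iota> q) \<bullet> b) \<circ> inv_into V d) x *\<^sub>R b) has_derivative L) (at (d p))"
    unfolding L_def
    by (rule has_derivative_sum, rule has_derivative_scaleR_left,
      rule dom.smooth_near_has_derivative[OF V(1,2)])
      (rule smooth_near_map[OF cod.smooth_near_coordinate[OF W]])
  then have L: "((\<lambda>x. e (\<iota> (inv_into V d x))) has_derivative L) (at (d p))"
    by (simp add: euclidean_representation comp_def)
  have "push p v = coord_vec A' W e (\<iota> p) (L a)"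
  proof
    fix f
    show "push p v f = coord_vec A' W e (\<iota> p) (L a) f"
    proof (cases "smooth_near A' (\<iota> p) f")
      case True
      have "open (\<iota> -` W)" using smooth_map cod.open_chart[OF W(1)] unfolding smooth_map_def by (simp add: open_vimage)
      then have op: "open (d ` (V \<inter> \<iota> -` W))"
        using dom.open_chart_image_subset[OF V(1), of "V \<inter> \<iota> -` W"] dom.open_chart[OF V(1)] by auto
      have "((f \<circ> inv_into W e) has_derivative frechet_derivative (f \<circ> inv_into W e) (at (e (\<iota> p))))
          (at (e (\<iota> (inv_into V d (d p)))))"
        using cod.smooth_near_has_derivative[OF W True] dom.chart_inv[OF V(1,2)] by simp
      from has_derivative_compose[OF L this]
      have "(((\<lambda>q. f (\<iota> q)) \<circ> inv_into V d) has_derivative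
          (\<lambda>h. frechet_derivative (f \<circ> inv_into W e) (at (e (\<iota> p))) (L h))) (at (d p))"
        by (rule has_derivative_transform_within_open[OF _ op])
          (use V(2) W(2) dom.chart_inv[OF V(1)] cod.chart_inv[OF W(1)] in auto)
      from frechet_derivative_at[OF this, symmetric]
      show ?thesis
        unfolding push_apply[OF True] cod.coord_vec_apply[OF True] V(3) dom.coord_vec_apply[OF smooth_near_map[OF True]]
        by (rule fun_cong)
    qed (simp add: pushforward_def coord_vec_def)
  qed
  then show ?thesis using cod.coord_vec_tangent[OF W] by simp
qed

lemma sect_cong:
  assumes "\<forall>\<^sub>F q in nhds p. V q = W q" "sect p V" shows "sect p W"
proof -
  have "\<forall>\<^sub>F q in nhds p. \<forall>\<^sub>F r in nhds q. V r = W r" using assms(1) by (simp add: eventually_eventually)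
  with assms show ?thesis
    unfolding section_near_def
  proof eventually_elim
    case (elim q)
    have "\<forall>\<^sub>F r in nhds q. V r f = W r f" for f
      using elim(3) by (rule eventually_mono) simp
    then show ?case using elim(1,2) dom.smooth_near_cong by metis
  qed
qed

lemma sect_add:
  assumes "sect p V" "sect p W" shows "sect p (\<lambda>q. V q + W q)"
  using assms unfolding section_near_def
  by eventually_elim (simp add: cod.tangent_add dom.smooth_near_add fun_apply)

lemma sect_mult:
  assumes "sect p V" "smooth_near A p f" shows "sect p (\<lambda>q. f q *\<^sub>R V q)"
  using assms(1) dom.smooth_near_eventually[OF assms(2)] unfolding section_near_def
  by eventually_elim (simp add: cod.tangent_scale dom.smooth_near_mult fun_apply)

lemma sect_scale: "sect p V \<Longrightarrow> sect p (\<lambda>q. r *\<^sub>R V q)"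
  using sect_mult dom.smooth_near_const by blast

lemma sect_minus: "sect p V \<Longrightarrow> sect p (\<lambda>q. - V q)"
  using sect_scale[of p V "-1"] by simp

lemma sect_diff: "sect p V \<Longrightarrow> sect p W \<Longrightarrow> sect p (\<lambda>q. V q - W q)"
  using sect_add[OF _ sect_minus] by simp

lemma sect_zero: "sect p (\<lambda>q. 0)"
  unfolding section_near_def by (auto simp: cod.tangent_zero dom.smooth_near_const fun_apply)

lemma sect_sum: "(\<And>i. i \<in> I \<Longrightarrow> sect p (V i)) \<Longrightarrow> sect p (\<lambda>q. \<Sum>i\<in>I. V i q)"
  by (induction I rule: infinite_finite_induct) (auto intro: sect_zero sect_add)

lemma sect_map:
  assumes "field_near A' (\<iota> p) Z" shows "sect p (\<lambda>q. Z (\<iota> q))"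
proof -
  have "\<forall>\<^sub>F m in nhds (\<iota> p). Z m \<in> tangent_space A' m \<and>
     (\<forall>f. smooth_near A' m f \<longrightarrow> smooth_near A' m (\<lambda>r. Z r f))"
    using assms unfolding field_near_section section_near_def by simp
  from eventually_map[OF this] show ?thesis
    unfolding section_near_def by (rule eventually_mono) (auto intro: smooth_near_map)
qed

lemma push_field_apply:
  assumes "smooth_near A' (\<iota> p) f" shows "\<forall>\<^sub>F r in nhds p. push r (X r) f = X r (\<lambda>q. f (\<iota> q))"
  using eventually_map[OF cod.smooth_near_eventually[OF assms]]
  by (rule eventually_mono) (rule push_apply)

lemma sect_push:
  assumes "field_near A p X" shows "sect p (\<lambda>q. push q (X q))"
  using assms unfolding field_near_section section_near_def
proof (rule eventually_mono)
  fix q assume q: "X q \<in> tangent_space A (id q) \<and> (\<forall>f. smooth_near A (id q) f \<longrightarrow> smooth_near A q (\<lambda>r. X r f))"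
  have "smooth_near A q (\<lambda>r. push r (X r) f)" if f: "smooth_near A' (\<iota> q) f" for f
  proof (rule dom.smooth_near_cong)
    show "\<forall>\<^sub>F r in nhds q. X r (\<lambda>q. f (\<iota> q)) = push r (X r) f"
      using push_field_apply[OF f] by (simp add: eq_commute)
    show "smooth_near A q (\<lambda>r. X r (\<lambda>q. f (\<iota> q)))" using q smooth_near_map[OF f] by simp
  qed
  then show "push q (X q) \<in> tangent_space A' (\<iota> q) \<and> (\<forall>f. smooth_near A' (\<iota> q) f \<longrightarrow> smooth_near A q (\<lambda>r. push r (X r) f))"
    using q push_tangent by auto
qed

lemma frame_field: assumes "m \<in> U" shows "field_near A' m (fr b)"
  unfolding field_near_section section_near_def
  using eventually_nhds_in_open[OF cod.open_chart[OF chart] assms]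
  by (rule eventually_mono) (auto intro: cod.smooth_near_coord_vec[OF chart] cod.coord_vec_tangent[OF chart])

lemma co_smooth: "m \<in> U \<Longrightarrow> smooth_near A' m (co b)"
  by (rule cod.smooth_near_coordinate[OF chart])

lemma co_map_smooth: "\<iota> p \<in> U \<Longrightarrow> smooth_near A p (\<lambda>q. co b (\<iota> q))"
  by (rule smooth_near_map[OF co_smooth])

lemma sect_frame: "\<iota> p \<in> U \<Longrightarrow> sect p (\<lambda>q. fr b (\<iota> q))"
  by (rule sect_map[OF frame_field])

lemma sect_coord_smooth: "sect p V \<Longrightarrow> \<iota> p \<in> U \<Longrightarrow> smooth_near A p (\<lambda>q. V q (co b))"
  using section_near_at(2) co_smooth by blast

lemma expand: "m \<in> U \<Longrightarrow> v \<in> tangent_space A' m \<Longrightarrow> v = (\<Sum>b\<in>Basis. v (co b) *\<^sub>R fr b m)"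
  by (rule cod.tangent_space_expand[OF chart])

lemma sect_expand:
  assumes "sect p V" "\<iota> p \<in> U"
  shows "\<forall>\<^sub>F q in nhds p. (\<Sum>b\<in>Basis. V q (co b) *\<^sub>R fr b (\<iota> q)) = V q"
  using assms(1)[unfolded section_near_def] eventually_chart[OF assms(2)]
  by eventually_elim (use expand in auto)

text \<open>Near \<open>p\<close> a section is the finite sum of its components times frame fields,
  so these three closure properties reach every section. Metric compatibility, parallelism of
  \<open>J\<close> and tensoriality of curvature are all proved this way.\<close>

lemma sect_induct [consumes 2, case_names cong frame add]:
  assumes "sect p V" "\<iota> p \<in> U"
    and cong: "\<And>V W. sect p V \<Longrightarrow> sect p W \<Longrightarrow> \<forall>\<^sub>F q in nhds p. V q = W q \<Longrightarrow> P V \<Longrightarrow> P W"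
    and frame: "\<And>f b. smooth_near A p f \<Longrightarrow> b \<in> Basis \<Longrightarrow> P (\<lambda>q. f q *\<^sub>R fr b (\<iota> q))"
    and add: "\<And>V W. sect p V \<Longrightarrow> sect p W \<Longrightarrow> P V \<Longrightarrow> P W \<Longrightarrow> P (\<lambda>q. V q + W q)"
  shows "P V"
proof -
  have summand: "sect p (\<lambda>q. V q (co b) *\<^sub>R fr b (\<iota> q))" for b
    using sect_mult[OF sect_frame sect_coord_smooth] assms(1,2) by blast
  have "P (\<lambda>q. \<Sum>b\<in>B. V q (co b) *\<^sub>R fr b (\<iota> q))" if "finite B" "B \<subseteq> Basis" for B
    using that
  proof (induction B)
    case empty
    \<comment> \<open>The empty sum is obtained as 0 times an arbitrary frame field, which spares a
      separate case for the zero section.\<close>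
    show ?case using frame[OF dom.smooth_near_const[of p 0] SOME_Basis] by simp
  next
    case (insert b B)
    then have "P (\<lambda>q. \<Sum>b\<in>B. V q (co b) *\<^sub>R fr b (\<iota> q))" "P (\<lambda>q. V q (co b) *\<^sub>R fr b (\<iota> q))"
      using frame[OF sect_coord_smooth[OF assms(1,2)]] by auto
    then show ?case
      unfolding sum.insert[OF insert.hyps] by (intro add[OF summand sect_sum[OF summand]])
  qed
  from this[OF finite_Basis order_refl]
  show ?thesis by (intro cong[OF sect_sum[OF summand] assms(1) sect_expand[OF assms(1,2)]])
qed

text \<open>The pullback of \<open>D'\<close> along \<open>\<iota>\<close>, written in the coordinate frame of the fixed chart.\<close>

definition nab :: "'h \<Rightarrow> 'h tvec \<Rightarrow> ('h \<Rightarrow> 'm tvec) \<Rightarrow> 'm tvec" where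
  "nab p v V = (\<Sum>b\<in>Basis. v (\<lambda>q. V q (co b)) *\<^sub>R fr b (\<iota> p) + V p (co b) *\<^sub>R D' (\<iota> p) (push p v) (fr b))"

text \<open>Both conjuncts go through one induction because additivity of the connection requires
  the partial sum to be a field.\<close>

lemma conn_frame_sum:
  assumes v: "v \<in> tangent_space A' m" and m: "m \<in> U" and f: "\<And>b. smooth_near A' m (f b)"
  shows "field_near A' m (\<lambda>q. \<Sum>b\<in>B. f b q *\<^sub>R fr b q) \<and>
    D' m v (\<lambda>q. \<Sum>b\<in>B. f b q *\<^sub>R fr b q) = (\<Sum>b\<in>B. v (f b) *\<^sub>R fr b m + f b m *\<^sub>R D' m v (fr b))"
proof (induction B rule: infinite_finite_induct)
  case (insert b B)
  have fd: "field_near A' m (\<lambda>q. f b q *\<^sub>R fr b q)"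
    by (rule cod.field_near_mult[OF frame_field[OF m] f])
  note fs = conjunct1[OF insert.IH]
  show ?case
    unfolding sum.insert[OF insert.hyps] cod.conn_add[OF fd fs v] cod.conn_mult[OF frame_field[OF m] f v]
    using insert.IH cod.field_near_add[OF fd fs] by auto
qed (auto simp: cod.field_near_zero cod.conn_zero[OF v])

text \<open>The characteristic property of the pullback connection: the Leibniz rule applied to the
  frame expansion of \<open>Z\<close> reproduces the definition of \<open>nab\<close>.\<close>

lemma nab_map:
  assumes v: "v \<in> tangent_space A p" and p: "\<iota> p \<in> U" and Z: "field_near A' (\<iota> p) Z"
  shows "nab p v (\<lambda>q. Z (\<iota> q)) = D' (\<iota> p) (push p v) Z"
proof -
  have sm: "smooth_near A' (\<iota> p) (\<lambda>m. Z m (co b))" for b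
    using field_near_at(2)[OF Z co_smooth[OF p]] .
  have "\<forall>\<^sub>F m in nhds (\<iota> p). Z m = (\<Sum>b\<in>Basis. Z m (co b) *\<^sub>R fr b m)"
    using eventually_conj[OF field_near_eventually[OF Z] eventually_nhds_in_open[OF cod.open_chart[OF chart] p]]
    by (rule eventually_mono) (use expand[OF _ field_near_at(1)] in blast)
  then have "D' (\<iota> p) (push p v) Z = D' (\<iota> p) (push p v) (\<lambda>m. \<Sum>b\<in>Basis. Z m (co b) *\<^sub>R fr b m)"
    by (rule cod.conn_cong[OF Z conjunct1[OF conn_frame_sum[OF push_tangent[OF v] p sm]] push_tangent[OF v]])
  also have "\<dots> = (\<Sum>b\<in>Basis. push p v (\<lambda>m. Z m (co b)) *\<^sub>R fr b (\<iota> p) + Z (\<iota> p) (co b) *\<^sub>R D' (\<iota> p) (push p v) (fr b))"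
    by (rule conjunct2[OF conn_frame_sum[OF push_tangent[OF v] p sm]])
  finally show ?thesis unfolding nab_def push_apply[OF sm] by simp
qed

lemma nab_cong:
  assumes "v \<in> tangent_space A p" "\<forall>\<^sub>F q in nhds p. V q = W q"
  shows "nab p v V = nab p v W"
proof -
  have "\<forall>\<^sub>F q in nhds p. V q f = W q f" for f
    using assms(2) by (rule eventually_mono) simp
  then have "v (\<lambda>q. V q f) = v (\<lambda>q. W q f)" for f
    by (rule dom.deriv_cong[OF assms(1)])
  moreover have "V p = W p" using assms(2) eventually_nhds_x_imp_x by blast
  ultimately show ?thesis unfolding nab_def by simp
qed

lemma nab_tangent:
  "\<iota> p \<in> U \<Longrightarrow> v \<in> tangent_space A p \<Longrightarrow> nab p v V \<in> tangent_space A' (\<iota> p)"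
  unfolding nab_def
  by (intro cod.tangent_sum cod.tangent_add cod.tangent_scale cod.coord_vec_tangent[OF chart]
      cod.conn_tangent frame_field push_tangent)

lemma nab_add:
  assumes "\<iota> p \<in> U" "v \<in> tangent_space A p" "sect p V" "sect p W"
  shows "nab p v (\<lambda>q. V q + W q) = nab p v V + nab p v W"
  using dom.deriv_add[OF assms(2) sect_coord_smooth[OF assms(3,1)] sect_coord_smooth[OF assms(4,1)]]
  by (simp add: nab_def fun_apply(1) scaleR_add_left sum.distrib add_ac)

lemma nab_mult:
  assumes p: "\<iota> p \<in> U" and v: "v \<in> tangent_space A p" and V: "sect p V" and f: "smooth_near A p f"
  shows "nab p v (\<lambda>q. f q *\<^sub>R V q) = v f *\<^sub>R V p + f p *\<^sub>R nab p v V"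
proof -
  have "v f *\<^sub>R V p = (\<Sum>b\<in>Basis. (v f * V p (co b)) *\<^sub>R fr b (\<iota> p))"
    by (subst expand[OF p section_near_at(1)[OF V]]) (simp add: scaleR_sum_right)
  moreover have "v (\<lambda>q. (f q *\<^sub>R V q) (co b)) *\<^sub>R fr b (\<iota> p) + (f p *\<^sub>R V p) (co b) *\<^sub>R D' (\<iota> p) (push p v) (fr b) =
      (v f * V p (co b)) *\<^sub>R fr b (\<iota> p) +
      f p *\<^sub>R (v (\<lambda>q. V q (co b)) *\<^sub>R fr b (\<iota> p) + V p (co b) *\<^sub>R D' (\<iota> p) (push p v) (fr b))" for b
    using dom.deriv_mult[OF v f sect_coord_smooth[OF V p]]
    by (simp add: scaleR_fun_apply scaleR_add_left scaleR_add_right)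
  ultimately show ?thesis by (simp only: nab_def scaleR_sum_right scaleR_add_right sum.distrib)
qed

lemma nab_scale:
  assumes p: "\<iota> p \<in> U" and v: "v \<in> tangent_space A p" and V: "sect p V"
  shows "nab p v (\<lambda>q. r *\<^sub>R V q) = r *\<^sub>R nab p v V"
  using nab_mult[OF p v V dom.smooth_near_const] dom.deriv_const[OF v] by simp

lemma nab_diff:
  assumes "\<iota> p \<in> U" "v \<in> tangent_space A p" "sect p V" "sect p W"
  shows "nab p v (\<lambda>q. V q - W q) = nab p v V - nab p v W"
  using nab_add[OF assms(1,2,3) sect_minus[OF assms(4)]] nab_scale[OF assms(1,2,4), of "-1"] by simp

lemma nab_sum:
  assumes p: "\<iota> p \<in> U" and v: "v \<in> tangent_space A p" and V: "\<And>i. i \<in> I \<Longrightarrow> sect p (V i)"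
  shows "nab p v (\<lambda>q. \<Sum>i\<in>I. V i q) = (\<Sum>i\<in>I. nab p v (V i))"
  using V
proof (induction I rule: infinite_finite_induct)
  case (insert i I)
  moreover have "sect p (\<lambda>q. \<Sum>i\<in>I. V i q)" using insert.prems by (intro sect_sum) auto
  ultimately show ?case using nab_add[OF p v, of "V i" "\<lambda>q. \<Sum>i\<in>I. V i q"] by simp
qed (use nab_scale[OF p v sect_zero, of 0] in auto)

lemma nab_scale_vec:
  assumes p: "\<iota> p \<in> U" and v: "v \<in> tangent_space A p"
  shows "nab p (r *\<^sub>R v) V = r *\<^sub>R nab p v V"
  using cod.conn_scale_vec[OF frame_field[OF p] push_tangent[OF v]]
  by (simp add: nab_def push_scale scaleR_fun_apply[of _ v] scaleR_add_right scaleR_sum_right mult.commute)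

lemma conn_push:
  assumes p: "\<iota> p \<in> U" and v: "v \<in> tangent_space A p" and Z: "field_near A' (\<iota> p) Z"
  shows "D' (\<iota> p) (push p v) Z = (\<Sum>j\<in>Basis. v (\<lambda>q. co j (\<iota> q)) *\<^sub>R D' (\<iota> p) (fr j (\<iota> p)) Z)"
proof -
  have t: "fr j (\<iota> p) \<in> tangent_space A' (\<iota> p)" for j by (rule cod.coord_vec_tangent[OF chart p])
  have "push p v = (\<Sum>j\<in>Basis. v (\<lambda>q. co j (\<iota> q)) *\<^sub>R fr j (\<iota> p))"
    using expand[OF p push_tangent[OF v]] unfolding push_apply[OF co_smooth[OF p]] .
  then have "D' (\<iota> p) (push p v) Z = D' (\<iota> p) (\<Sum>j\<in>Basis. v (\<lambda>q. co j (\<iota> q)) *\<^sub>R fr j (\<iota> p)) Z"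
    by simp
  then show ?thesis
    unfolding cod.conn_sum_vec[OF Z cod.tangent_scale[OF t]] cod.conn_scale_vec[OF Z t] .
qed

text \<open>The direction \<open>push q (X q)\<close> does not come from an ambient field. Expanded
  in the frame, it leaves ambient derivatives along frame fields, which are ambient fields, with
  smooth coefficients on the domain.\<close>

lemma sect_conn_push:
  assumes p: "\<iota> p \<in> U" and X: "field_near A p X" and Z: "\<And>m. m \<in> U \<Longrightarrow> field_near A' m Z"
  shows "\<forall>\<^sub>F q in nhds p. (\<Sum>j\<in>Basis. X q (\<lambda>q. co j (\<iota> q)) *\<^sub>R D' (\<iota> q) (fr j (\<iota> q)) Z) = D' (\<iota> q) (push q (X q)) Z"
    and "sect p (\<lambda>q. X q (\<lambda>q. co j (\<iota> q)) *\<^sub>R D' (\<iota> q) (fr j (\<iota> q)) Z)"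
    and "sect p (\<lambda>q. D' (\<iota> q) (push q (X q)) Z)"
proof -
  show 1: "\<forall>\<^sub>F q in nhds p. (\<Sum>j\<in>Basis. X q (\<lambda>q. co j (\<iota> q)) *\<^sub>R D' (\<iota> q) (fr j (\<iota> q)) Z) = D' (\<iota> q) (push q (X q)) Z"
    using field_near_eventually[OF X] eventually_chart[OF p]
    by eventually_elim (use conn_push[OF _ field_near_at(1) Z] in auto)
  show 2: "sect p (\<lambda>q. X q (\<lambda>q. co j (\<iota> q)) *\<^sub>R D' (\<iota> q) (fr j (\<iota> q)) Z)" for j
    using sect_mult[OF sect_map[OF cod.conn_field[OF Z frame_field]] field_near_at(2)[OF X co_map_smooth]] p by blast
  show "sect p (\<lambda>q. D' (\<iota> q) (push q (X q)) Z)"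
    using sect_cong[OF 1 sect_sum[OF 2]] .
qed

lemma sect_nab:
  assumes p: "\<iota> p \<in> U" and X: "field_near A p X" and V: "sect p V"
  shows "sect p (\<lambda>q. nab q (X q) V)"
proof -
  have "smooth_near A p (\<lambda>q. X q (\<lambda>q. V q (co b)))" for b
    using field_near_at(2)[OF X sect_coord_smooth[OF V p]] .
  then show ?thesis
    unfolding nab_def
    using sect_mult sect_frame[OF p] sect_conn_push(3)[OF p X frame_field] sect_coord_smooth[OF V p]
    by (intro sect_sum sect_add sect_mult)
qed

end

section \<open>Commuting extensions of tangent vectors\<close>

context torsion_free_manifold
begin

lemma coord_vec_field: "(U, c) \<in> A \<Longrightarrow> p \<in> U \<Longrightarrow> field_near A p (\<lambda>q. coord_vec A U c q a)"
  unfolding field_near_section section_near_def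
  using eventually_nhds_in_open[OF open_chart]
  by (rule eventually_mono) (auto intro: smooth_near_coord_vec coord_vec_tangent)

text \<open>No symmetry of second derivatives is invoked: the bracket is a tangent vector, hence
  determined by its values on coordinate functions, and the coordinate fields have constant
  derivatives on these.\<close>

lemma bracket_coord_vec:
  assumes U: "(U, c) \<in> A" "p \<in> U"
  shows "bracket A (\<lambda>q. coord_vec A U c q a) (\<lambda>q. coord_vec A U c q b) p = 0"
proof -
  let ?B = "bracket A (\<lambda>q. coord_vec A U c q a) (\<lambda>q. coord_vec A U c q b) p"
  have ev: "\<forall>\<^sub>F q in nhds p. coord_vec A U c q a' (\<lambda>m. c m \<bullet> k) = a' \<bullet> k" for a' k
    using eventually_nhds_in_open[OF open_chart[OF U(1)] U(2)]
    by (rule eventually_mono) (rule coord_vec_coordinate[OF U(1)])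
  have "coord_vec A U c p b' (\<lambda>q. coord_vec A U c q a' (\<lambda>m. c m \<bullet> k)) = 0" for a' b' k
    unfolding deriv_cong[OF coord_vec_tangent[OF U] ev] by (rule deriv_const[OF coord_vec_tangent[OF U]])
  then have "?B (\<lambda>q. c q \<bullet> k) = 0" for k
    by (simp add: bracket_def smooth_near_coordinate[OF U])
  moreover have "?B \<in> tangent_space A p"
    by (intro bracket_field coord_vec_field U)
  ultimately show ?thesis using tangent_space_expand[OF U] by fastforce
qed

text \<open>Extending vectors with constant coefficients in a chart gives commuting fields.\<close>

definition extension :: "'m \<Rightarrow> 'm tvec \<Rightarrow> 'm \<Rightarrow> 'm tvec" where
  "extension p x = (let (U, c) = (SOME Uc. Uc \<in> A \<and> p \<in> fst Uc)
     in (\<lambda>q. coord_vec A U c q (inv (coord_vec A U c p) x)))"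

lemma extension_chart:
  obtains U c where "(U, c) \<in> A" "p \<in> U"
    "extension p = (\<lambda>x q. coord_vec A U c q (inv (coord_vec A U c p) x))"
proof -
  let ?Uc = "SOME Uc. Uc \<in> A \<and> p \<in> fst Uc"
  obtain U c where "(U, c) \<in> A" "p \<in> U" by (rule chart_at)
  then have "\<exists>Uc. Uc \<in> A \<and> p \<in> fst Uc" by (intro exI[of _ "(U, c)"]) simp
  then have "?Uc \<in> A \<and> p \<in> fst ?Uc" by (rule someI_ex)
  then show ?thesis
    using that[of "fst ?Uc" "snd ?Uc"] by (simp add: extension_def case_prod_beta fun_eq_iff)
qed

lemma extension_field: "field_near A p (extension p x)"
  by (rule extension_chart[of p]) (simp add: coord_vec_field)

lemma extension_at: "x \<in> tangent_space A p \<Longrightarrow> extension p x p = x"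
  by (rule extension_chart[of p]) (simp add: tangent_space_chart f_inv_into_f)

lemma extension_bracket_near: "\<forall>\<^sub>F q in nhds p. bracket A (extension p x) (extension p y) q = 0"
proof -
  obtain U c where U: "(U, c) \<in> A" "p \<in> U"
    "extension p = (\<lambda>x q. coord_vec A U c q (inv (coord_vec A U c p) x))" by (rule extension_chart)
  show ?thesis
    unfolding U(3) using eventually_nhds_in_open[OF open_chart[OF U(1)] U(2)]
    by (rule eventually_mono) (rule bracket_coord_vec[OF U(1)])
qed

lemma extension_bracket: "bracket A (extension p x) (extension p y) p = 0"
  using eventually_nhds_x_imp_x[OF extension_bracket_near] .

end

section \<open>Torsion and curvature of the pullback connection\<close>

context framed_map
begin

lemma deriv_push_coord:
  assumes p: "\<iota> p \<in> U" and v: "v \<in> tangent_space A p"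
  shows "v (\<lambda>q. push q (X q) (co b)) = v (\<lambda>q. X q (\<lambda>r. co b (\<iota> r)))"
  by (rule dom.deriv_cong[OF v push_field_apply[OF co_smooth[OF p]]])

text \<open>The terms with derivatives of frame fields are symmetric in the two directions because
  coordinate fields commute and \<open>D'\<close> is torsion free. What remains are the components
  of the pushed bracket.\<close>

lemma nab_torsion:
  assumes p: "\<iota> p \<in> U" and X: "field_near A p X" and Y: "field_near A p Y"
  shows "nab p (X p) (\<lambda>q. push q (Y q)) - nab p (Y p) (\<lambda>q. push q (X q)) = push p (bracket A X Y p)"
proof -
  have nab: "nab p (Z p) (\<lambda>q. push q (W q)) = (\<Sum>b\<in>Basis. Z p (\<lambda>q. W q (\<lambda>r. co b (\<iota> r))) *\<^sub>R fr b (\<iota> p)) +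
      (\<Sum>b\<in>Basis. \<Sum>j\<in>Basis. (W p (\<lambda>r. co b (\<iota> r)) * Z p (\<lambda>q. co j (\<iota> q))) *\<^sub>R D' (\<iota> p) (fr j (\<iota> p)) (fr b))"
    if Z: "field_near A p Z" and W: "field_near A p W" for Z W
    using conn_push[OF p field_near_at(1)[OF Z] frame_field[OF p]]
    by (simp add: nab_def deriv_push_coord[OF p field_near_at(1)[OF Z]] push_apply[OF co_smooth[OF p]]
      sum.distrib scaleR_sum_right)
  have comm: "D' (\<iota> p) (fr j (\<iota> p)) (fr b) = D' (\<iota> p) (fr b (\<iota> p)) (fr j)" for j b
    using cod.torsion_free[OF frame_field[OF p] frame_field[OF p], of j b] cod.bracket_coord_vec[OF chart p, of j b]
    by simp
  have "(\<Sum>b\<in>Basis. \<Sum>j\<in>Basis. (Y p (\<lambda>r. co b (\<iota> r)) * X p (\<lambda>q. co j (\<iota> q))) *\<^sub>R D' (\<iota> p) (fr j (\<iota> p)) (fr b))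
      = (\<Sum>j\<in>Basis. \<Sum>b\<in>Basis. (Y p (\<lambda>r. co b (\<iota> r)) * X p (\<lambda>q. co j (\<iota> q))) *\<^sub>R D' (\<iota> p) (fr j (\<iota> p)) (fr b))"
    by (rule sum.swap)
  also have "\<dots> = (\<Sum>j\<in>Basis. \<Sum>b\<in>Basis. (X p (\<lambda>q. co j (\<iota> q)) * Y p (\<lambda>r. co b (\<iota> r))) *\<^sub>R D' (\<iota> p) (fr b (\<iota> p)) (fr j))"
    using comm by (simp add: mult.commute)
  finally have "nab p (X p) (\<lambda>q. push q (Y q)) - nab p (Y p) (\<lambda>q. push q (X q)) =
      (\<Sum>b\<in>Basis. (X p (\<lambda>q. Y q (\<lambda>r. co b (\<iota> r))) - Y p (\<lambda>q. X q (\<lambda>r. co b (\<iota> r)))) *\<^sub>R fr b (\<iota> p))"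
    unfolding nab[OF X Y] nab[OF Y X] by (simp add: sum_subtractf scaleR_diff_left)
  also have "\<dots> = (\<Sum>b\<in>Basis. push p (bracket A X Y p) (co b) *\<^sub>R fr b (\<iota> p))"
    by (simp add: push_apply[OF co_smooth[OF p]] bracket_def co_map_smooth[OF p])
  also have "\<dots> = push p (bracket A X Y p)"
    using expand[OF p push_tangent[OF dom.bracket_field[OF X Y]]] by simp
  finally show ?thesis .
qed

text \<open>The curvature operator of the pullback connection, on fields of the domain and a section
  along the map; tensoriality is not yet built in.\<close>

definition Rop :: "'h \<Rightarrow> ('h \<Rightarrow> 'h tvec) \<Rightarrow> ('h \<Rightarrow> 'h tvec) \<Rightarrow> ('h \<Rightarrow> 'm tvec) \<Rightarrow> 'm tvec" where
  "Rop p X Y V = nab p (X p) (\<lambda>q. nab q (Y q) V) - nab p (Y p) (\<lambda>q. nab q (X q) V) - nab p (bracket A X Y p) V"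

lemma Rop_add:
  assumes p: "\<iota> p \<in> U" and X: "field_near A p X" and Y: "field_near A p Y" and V: "sect p V" and W: "sect p W"
  shows "Rop p X Y (\<lambda>q. V q + W q) = Rop p X Y V + Rop p X Y W"
proof -
  have 2: "nab p v (\<lambda>q. nab q (Z q) (\<lambda>q. V q + W q)) = nab p v (\<lambda>q. nab q (Z q) V) + nab p v (\<lambda>q. nab q (Z q) W)"
    if Z: "field_near A p Z" and v: "v \<in> tangent_space A p" for Z v
  proof -
    have "\<forall>\<^sub>F q in nhds p. nab q (Z q) (\<lambda>q. V q + W q) = nab q (Z q) V + nab q (Z q) W"
      using eventually_chart[OF p] field_near_eventually[OF Z] section_near_eventually[OF V] section_near_eventually[OF W]
      by eventually_elim (rule nab_add[OF _ field_near_at(1)])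
    from nab_cong[OF v this] nab_add[OF p v sect_nab[OF p Z V] sect_nab[OF p Z W]] show ?thesis by simp
  qed
  show ?thesis
    unfolding Rop_def 2[OF Y field_near_at(1)[OF X]] 2[OF X field_near_at(1)[OF Y]]
      nab_add[OF p dom.bracket_field[OF X Y] V W] by simp
qed

text \<open>In the iterated derivative of \<open>f V\<close> the mixed first-order terms are
  symmetric in the two directions and cancel, and the second derivatives of \<open>f\<close> cancel
  against the bracket term.\<close>

lemma Rop_mult:
  assumes p: "\<iota> p \<in> U" and X: "field_near A p X" and Y: "field_near A p Y" and V: "sect p V"
    and f: "smooth_near A p f"
  shows "Rop p X Y (\<lambda>q. f q *\<^sub>R V q) = f p *\<^sub>R Rop p X Y V"
proof -
  have 2: "nab p v (\<lambda>q. nab q (Z q) (\<lambda>q. f q *\<^sub>R V q)) =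
      v (\<lambda>q. Z q f) *\<^sub>R V p + Z p f *\<^sub>R nab p v V + v f *\<^sub>R nab p (Z p) V + f p *\<^sub>R nab p v (\<lambda>q. nab q (Z q) V)"
    if Z: "field_near A p Z" and v: "v \<in> tangent_space A p" for Z v
  proof -
    have Zf: "smooth_near A p (\<lambda>q. Z q f)" by (rule field_near_at(2)[OF Z f])
    have "\<forall>\<^sub>F q in nhds p. nab q (Z q) (\<lambda>q. f q *\<^sub>R V q) = Z q f *\<^sub>R V q + f q *\<^sub>R nab q (Z q) V"
      using eventually_chart[OF p] field_near_eventually[OF Z] section_near_eventually[OF V] dom.smooth_near_eventually[OF f]
      by eventually_elim (rule nab_mult[OF _ field_near_at(1)])
    from nab_cong[OF v this] show ?thesis
      using nab_add[OF p v sect_mult[OF V Zf] sect_mult[OF sect_nab[OF p Z V] f]]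
        nab_mult[OF p v V Zf] nab_mult[OF p v sect_nab[OF p Z V] f] by simp
  qed
  have "bracket A X Y p f = X p (\<lambda>q. Y q f) - Y p (\<lambda>q. X q f)" by (simp add: bracket_def f)
  then show ?thesis
    unfolding Rop_def 2[OF Y field_near_at(1)[OF X]] 2[OF X field_near_at(1)[OF Y]]
      nab_mult[OF p dom.bracket_field[OF X Y] V f]
    by (simp add: scaleR_diff_left scaleR_diff_right)
qed

text \<open>Ambient curvature on coordinate fields; their brackets vanish, hence the two
  terms.\<close>

definition Rfr :: "'e \<Rightarrow> 'e \<Rightarrow> 'e \<Rightarrow> 'm \<Rightarrow> 'm tvec" where
  "Rfr i j k m = D' m (fr i m) (\<lambda>q. D' q (fr j q) (fr k)) - D' m (fr j m) (\<lambda>q. D' q (fr i q) (fr k))"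

text \<open>The curvature tensor written with components. Its arguments are vectors at
  \<open>m\<close>, so independence of extensions holds by construction.\<close>

definition Rten :: "'m \<Rightarrow> 'm tvec \<Rightarrow> 'm tvec \<Rightarrow> 'm tvec \<Rightarrow> 'm tvec" where
  "Rten m x y z = (\<Sum>k\<in>Basis. z (co k) *\<^sub>R (\<Sum>i\<in>Basis. \<Sum>j\<in>Basis. (x (co i) * y (co j)) *\<^sub>R Rfr i j k m))"

text \<open>Expanding each direction in the frame gives terms with derivatives of the direction
  components, which the bracket term removes, and terms bilinear in the components, which
  antisymmetrise to \<open>Rfr\<close>.\<close>

lemma Rop_frame:
  assumes p: "\<iota> p \<in> U" and X: "field_near A p X" and Y: "field_near A p Y"
  shows "Rop p X Y (\<lambda>q. fr k (\<iota> q)) =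
    (\<Sum>i\<in>Basis. \<Sum>j\<in>Basis. (push p (X p) (co i) * push p (Y p) (co j)) *\<^sub>R Rfr i j k (\<iota> p))"
proof -
  let ?x = "\<lambda>Z j q. Z q (\<lambda>r. co j (\<iota> r))"
  have fk: "field_near A' m (fr k)" if "m \<in> U" for m by (rule frame_field[OF that])
  have 2: "nab p v (\<lambda>q. nab q (Z q) (\<lambda>r. fr k (\<iota> r))) = (\<Sum>j\<in>Basis. v (?x Z j) *\<^sub>R D' (\<iota> p) (fr j (\<iota> p)) (fr k)) +
      (\<Sum>j\<in>Basis. \<Sum>i\<in>Basis. (?x Z j p * v (\<lambda>r. co i (\<iota> r))) *\<^sub>R D' (\<iota> p) (fr i (\<iota> p)) (\<lambda>q. D' q (fr j q) (fr k)))"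
    if Z: "field_near A p Z" and v: "v \<in> tangent_space A p" for Z v
  proof -
    have ev: "\<forall>\<^sub>F q in nhds p. nab q (Z q) (\<lambda>r. fr k (\<iota> r)) = (\<Sum>j\<in>Basis. ?x Z j q *\<^sub>R D' (\<iota> q) (fr j (\<iota> q)) (fr k))"
      using eventually_chart[OF p] field_near_eventually[OF Z]
      by eventually_elim (use nab_map[OF field_near_at(1) _ fk] conn_push[OF _ field_near_at(1) fk] in simp)
    have fd: "field_near A' (\<iota> p) (\<lambda>m. D' m (fr j m) (fr k))" for j
      by (rule cod.conn_field[OF fk[OF p] frame_field[OF p]])
    have Zj: "smooth_near A p (?x Z j)" for j by (rule field_near_at(2)[OF Z co_map_smooth[OF p]])
    have "nab p v (\<lambda>q. ?x Z j q *\<^sub>R D' (\<iota> q) (fr j (\<iota> q)) (fr k)) =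
       v (?x Z j) *\<^sub>R D' (\<iota> p) (fr j (\<iota> p)) (fr k) +
       ?x Z j p *\<^sub>R (\<Sum>i\<in>Basis. v (\<lambda>r. co i (\<iota> r)) *\<^sub>R D' (\<iota> p) (fr i (\<iota> p)) (\<lambda>q. D' q (fr j q) (fr k)))" for j
      using nab_mult[OF p v sect_map[OF fd] Zj] nab_map[OF v p fd] conn_push[OF p v fd] by simp
    moreover have "nab p v (\<lambda>q. \<Sum>j\<in>Basis. ?x Z j q *\<^sub>R D' (\<iota> q) (fr j (\<iota> q)) (fr k)) =
      (\<Sum>j\<in>Basis. nab p v (\<lambda>q. ?x Z j q *\<^sub>R D' (\<iota> q) (fr j (\<iota> q)) (fr k)))"
      by (rule nab_sum[OF p v sect_mult[OF sect_map[OF fd] Zj]])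
    ultimately show ?thesis
      using nab_cong[OF v ev] by (simp add: sum.distrib scaleR_sum_right)
  qed
  have "nab p (bracket A X Y p) (\<lambda>q. fr k (\<iota> q)) =
      (\<Sum>j\<in>Basis. (X p (?x Y j) - Y p (?x X j)) *\<^sub>R D' (\<iota> p) (fr j (\<iota> p)) (fr k))"
    using nab_map[OF dom.bracket_field[OF X Y] p fk[OF p]] conn_push[OF p dom.bracket_field[OF X Y] fk[OF p]]
    by (simp add: bracket_def co_map_smooth[OF p])
  moreover have "(\<Sum>j\<in>Basis. \<Sum>i\<in>Basis. (?x X j p * ?x Y i p) *\<^sub>R D' (\<iota> p) (fr i (\<iota> p)) (\<lambda>q. D' q (fr j q) (fr k))) =
     (\<Sum>i\<in>Basis. \<Sum>j\<in>Basis. (?x X i p * ?x Y j p) *\<^sub>R D' (\<iota> p) (fr j (\<iota> p)) (\<lambda>q. D' q (fr i q) (fr k)))" by simp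
  moreover have "(\<Sum>j\<in>Basis. \<Sum>i\<in>Basis. (?x Y j p * ?x X i p) *\<^sub>R D' (\<iota> p) (fr i (\<iota> p)) (\<lambda>q. D' q (fr j q) (fr k))) =
     (\<Sum>i\<in>Basis. \<Sum>j\<in>Basis. (?x X i p * ?x Y j p) *\<^sub>R D' (\<iota> p) (fr i (\<iota> p)) (\<lambda>q. D' q (fr j q) (fr k)))"
    by (subst sum.swap) (simp add: mult.commute)
  ultimately show ?thesis
    unfolding Rop_def 2[OF Y field_near_at(1)[OF X]] 2[OF X field_near_at(1)[OF Y]] push_apply[OF co_smooth[OF p]]
    by (simp add: Rfr_def sum_subtractf scaleR_diff_left scaleR_diff_right)
qed

lemma Rten_add: "Rten m x y (z + w) = Rten m x y z + Rten m x y w"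
  by (simp add: Rten_def fun_apply(1) scaleR_add_left sum.distrib)

lemma Rten_scale: "Rten m x y (r *\<^sub>R z) = r *\<^sub>R Rten m x y z"
  by (simp add: Rten_def fun_apply(5)[of r z] scaleR_sum_right mult.assoc)

lemma Rten_frame:
  assumes "m \<in> U" "k \<in> Basis"
  shows "Rten m x y (fr k m) = (\<Sum>i\<in>Basis. \<Sum>j\<in>Basis. (x (co i) * y (co j)) *\<^sub>R Rfr i j k m)"
proof -
  have "Rten m x y (fr k m) = (\<Sum>k'\<in>Basis. if k' = k then \<Sum>i\<in>Basis. \<Sum>j\<in>Basis. (x (co i) * y (co j)) *\<^sub>R Rfr i j k' m else 0)"
    unfolding Rten_def cod.coord_vec_coordinate[OF chart assms(1)]
    by (rule sum.cong) (use assms(2) in \<open>auto simp: inner_Basis\<close>)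
  then show ?thesis using assms(2) by simp
qed

text \<open>Section induction turns the frame formula into the statement that the operator sees only
  the values at \<open>p\<close>.\<close>

lemma Rop_Rten:
  assumes p: "\<iota> p \<in> U" and X: "field_near A p X" and Y: "field_near A p Y" and V: "sect p V"
  shows "Rop p X Y V = Rten (\<iota> p) (push p (X p)) (push p (Y p)) (V p)"
  using V p
proof (induction rule: sect_induct)
  case (cong V W)
  have ev: "\<forall>\<^sub>F q in nhds p. \<forall>\<^sub>F r in nhds q. V r = W r" using cong by (simp add: eventually_eventually)
  have ev': "\<forall>\<^sub>F q in nhds p. nab q (Z q) V = nab q (Z q) W" if Z: "field_near A p Z" for Z
    using ev field_near_eventually[OF Z]
    by eventually_elim (rule nab_cong[OF field_near_at(1)])
  have "Rop p X Y V = Rop p X Y W"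
    unfolding Rop_def nab_cong[OF field_near_at(1)[OF X] ev'[OF Y]] nab_cong[OF field_near_at(1)[OF Y] ev'[OF X]]
      nab_cong[OF dom.bracket_field[OF X Y] cong(3)] ..
  moreover have "V p = W p" using cong(3) eventually_nhds_x_imp_x by blast
  ultimately show ?case using cong by simp
next
  case (frame f b)
  then show ?case
    using Rop_mult[OF p X Y sect_frame[OF p] frame(1)] Rop_frame[OF p X Y] Rten_frame[OF p]
    by (simp add: Rten_scale)
next
  case (add V W)
  then show ?case using Rop_add[OF p X Y] by (simp add: Rten_add)
qed

end

section \<open>Curvature and derivatives of endomorphisms as pointwise tensors\<close>

context torsion_free_manifold
begin

lemma framed_id: "(U, c) \<in> A \<Longrightarrow> framed_map A D A D id U c"
  by unfold_locales (auto simp: smooth_map_def)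

lemma pushforward_id: "v \<in> tangent_space A p \<Longrightarrow> pushforward A id p v = v"
  using tangent_not_smooth by (fastforce simp: pushforward_def)

text \<open>The pullback theory is applied to the identity map, where \<open>nab\<close> is
  \<open>D\<close> itself. The right side depends on values at \<open>p\<close> alone, as the
  definite description in \<open>curvature\<close> requires.\<close>

lemma Rten_eq:
  assumes U: "(U, c) \<in> A" "p \<in> U" and X: "field_near A p X" and Y: "field_near A p Y" and Z: "field_near A p Z"
  shows "D p (X p) (\<lambda>q. D q (Y q) Z) - D p (Y p) (\<lambda>q. D q (X q) Z) - D p (bracket A X Y p) Z =
    framed_map.Rten A D U c p (X p) (Y p) (Z p)"
proof -
  interpret id: framed_map A D A D id U c by (rule framed_id[OF U(1)])
  have nab: "id.nab q v W = D q v W" if "q \<in> U" "v \<in> tangent_space A q" "field_near A q W" for q v W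
    using id.nab_map[of v q W] that by (simp add: pushforward_id)
  have 2: "id.nab p v (\<lambda>q. id.nab q (W q) Z) = D p v (\<lambda>q. D q (W q) Z)"
    if W: "field_near A p W" and v: "v \<in> tangent_space A p" for W v
  proof -
    have "\<forall>\<^sub>F q in nhds p. id.nab q (W q) Z = D q (W q) Z"
      using eventually_nhds_in_open[OF open_chart[OF U(1)] U(2)] field_near_eventually[OF W] field_near_eventually[OF Z]
      by eventually_elim (rule nab[OF _ field_near_at(1)])
    from id.nab_cong[OF v this] show ?thesis
      using nab[OF U(2) v conn_field[OF Z W]] by simp
  qed
  show ?thesis
    using id.Rop_Rten[of p X Y Z] U X Y Z 2[OF Y field_near_at(1)[OF X]] 2[OF X field_near_at(1)[OF Y]]
      nab[OF U(2) bracket_field[OF X Y] Z] pushforward_id[OF field_near_at(1)[OF X]] pushforward_id[OF field_near_at(1)[OF Y]]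
    by (simp add: id.Rop_def field_near_section[symmetric])
qed

text \<open>Resolves the \<open>THE\<close>: by \<open>Rten_eq\<close> all admissible triples give
  the same vector, and the given triple is admissible, which forces uniqueness.\<close>

lemma curvature_eq:
  assumes X: "field_near A p X" and Y: "field_near A p Y" and Z: "field_near A p Z"
  shows "curvature A D p (X p) (Y p) (Z p) =
    D p (X p) (\<lambda>q. D q (Y q) Z) - D p (Y p) (\<lambda>q. D q (X q) Z) - D p (bracket A X Y p) Z"
proof -
  obtain U c where U: "(U, c) \<in> A" "p \<in> U" by (rule chart_at)
  show ?thesis
    unfolding curvature_def
  proof (rule the_equality)
    show *: "\<forall>X' Y' Z'. field_near A p X' \<and> field_near A p Y' \<and> field_near A p Z' \<and> X' p = X p \<and> Y' p = Y p \<and> Z' p = Z p \<longrightarrow>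
      D p (X p) (\<lambda>q. D q (Y q) Z) - D p (Y p) (\<lambda>q. D q (X q) Z) - D p (bracket A X Y p) Z =
      D p (X p) (\<lambda>q. D q (Y' q) Z') - D p (Y p) (\<lambda>q. D q (X' q) Z') - D p (bracket A X' Y' p) Z'"
    proof (intro allI impI; elim conjE)
      fix X' Y' Z'
      assume "field_near A p X'" "field_near A p Y'" "field_near A p Z'" "X' p = X p" "Y' p = Y p" "Z' p = Z p"
      then show "D p (X p) (\<lambda>q. D q (Y q) Z) - D p (Y p) (\<lambda>q. D q (X q) Z) - D p (bracket A X Y p) Z =
        D p (X p) (\<lambda>q. D q (Y' q) Z') - D p (Y p) (\<lambda>q. D q (X' q) Z') - D p (bracket A X' Y' p) Z'"
        using Rten_eq[OF U X Y Z] Rten_eq[OF U, of X' Y' Z'] by simp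
    qed
  qed (use X Y Z in blast)
qed

lemma curvature_Rten:
  assumes U: "(U, c) \<in> A" "p \<in> U" and "x \<in> tangent_space A p" "y \<in> tangent_space A p" "z \<in> tangent_space A p"
  shows "curvature A D p x y z = framed_map.Rten A D U c p x y z"
  using curvature_eq[OF extension_field extension_field extension_field, of p x y z]
    Rten_eq[OF U extension_field extension_field extension_field, of x y z] extension_at assms(3-) by simp

text \<open>For a multiple \<open>f Y\<close> the terms with the derivative of \<open>f\<close>
  cancel between the two summands, so the expression is linear in the value of the field. Section
  induction along the identity makes this precise.\<close>

lemma covariant_endo_eq:
  assumes K: "\<And>Y. field_near A p Y \<Longrightarrow> field_near A p (\<lambda>q. K q (Y q))"
    and K_add: "\<And>q x y. x \<in> tangent_space A q \<Longrightarrow> y \<in> tangent_space A q \<Longrightarrow> K q (x + y) = K q x + K q y"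
    and K_scale: "\<And>q x r. x \<in> tangent_space A q \<Longrightarrow> K q (r *\<^sub>R x) = r *\<^sub>R K q x"
    and x: "x \<in> tangent_space A p" and Y: "field_near A p Y"
  shows "covariant_endo A D K p x (Y p) = D p x (\<lambda>q. K q (Y q)) - K p (D p x Y)"
proof -
  obtain U c where U: "(U, c) \<in> A" "p \<in> U" by (rule chart_at)
  interpret id: framed_map A D A D id U c by (rule framed_id[OF U(1)])
  have sect: "id.sect q W = field_near A q W" for q W by (simp add: field_near_section)
  \<comment> \<open>The right side contains \<open>W\<close> only through its components at
    \<open>p\<close>.\<close>
  have *: "D p x (\<lambda>q. K q (W q)) - K p (D p x W) =
      (\<Sum>b\<in>Basis. W p (id.co b) *\<^sub>R (D p x (\<lambda>q. K q (id.fr b q)) - K p (D p x (id.fr b))))"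
    if W: "field_near A p W" for W
  proof -
    have "id.sect p W" "id p \<in> U" using W sect U(2) by auto
    then show ?thesis
    proof (induction rule: id.sect_induct)
      case (cong V W)
      have "\<forall>\<^sub>F q in nhds p. K q (V q) = K q (W q)" using cong(3) by (rule eventually_mono) simp
      moreover have fd: "field_near A p V" "field_near A p W" using cong(1,2) by (simp_all only: sect)
      ultimately have "D p x (\<lambda>q. K q (V q)) = D p x (\<lambda>q. K q (W q))"
        by (intro conn_cong[OF _ _ x] K)
      moreover have "D p x V = D p x W" by (rule conn_cong[OF fd x cong(3)])
      moreover have "V p = W p" using cong(3) eventually_nhds_x_imp_x by blast
      ultimately show ?case using cong(4) by simp
    next
      case (frame f b)
      have fb: "field_near A p (id.fr b)" by (rule coord_vec_field[OF U])
      have "\<forall>\<^sub>F q in nhds p. K q (f q *\<^sub>R id.fr b q) = f q *\<^sub>R K q (id.fr b q)"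
        using eventually_nhds_in_open[OF open_chart[OF U(1)] U(2)]
        by (rule eventually_mono) (rule K_scale[OF coord_vec_tangent[OF U(1)]])
      then have "D p x (\<lambda>q. K q (f q *\<^sub>R id.fr b q)) = D p x (\<lambda>q. f q *\<^sub>R K q (id.fr b q))"
        by (intro conn_cong[OF _ _ x] K field_near_mult frame fb)
      also have "\<dots> = x f *\<^sub>R K p (id.fr b p) + f p *\<^sub>R D p x (\<lambda>q. K q (id.fr b q))"
        by (rule conn_mult[OF K[OF fb] frame(1) x])
      finally have 1: "D p x (\<lambda>q. K q (f q *\<^sub>R id.fr b q)) - K p (D p x (\<lambda>q. f q *\<^sub>R id.fr b q)) =
          f p *\<^sub>R (D p x (\<lambda>q. K q (id.fr b q)) - K p (D p x (id.fr b)))"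
        using conn_mult[OF fb frame(1) x] conn_tangent[OF fb x] coord_vec_tangent[OF U]
        by (simp add: K_add K_scale tangent_scale scaleR_diff_right)
      have "(f p *\<^sub>R id.fr b p) (id.co b') = (if b' = b then f p else 0)" if "b' \<in> Basis" for b'
        using that frame(2) by (auto simp: fun_apply coord_vec_coordinate[OF U] inner_Basis)
      then have "(\<Sum>b'\<in>Basis. (f p *\<^sub>R id.fr b p) (id.co b') *\<^sub>R (D p x (\<lambda>q. K q (id.fr b' q)) - K p (D p x (id.fr b')))) =
          (\<Sum>b'\<in>Basis. if b' = b then f p *\<^sub>R (D p x (\<lambda>q. K q (id.fr b' q)) - K p (D p x (id.fr b'))) else 0)"
        by (intro sum.cong) auto
      also have "\<dots> = f p *\<^sub>R (D p x (\<lambda>q. K q (id.fr b q)) - K p (D p x (id.fr b)))" using frame(2) by simp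
      finally show ?case using 1 by simp
    next
      case (add V W)
      have fd: "field_near A p V" "field_near A p W" using add by (auto simp: sect)
      have "\<forall>\<^sub>F q in nhds p. K q (V q + W q) = K q (V q) + K q (W q)"
        using field_near_eventually[OF fd(1)] field_near_eventually[OF fd(2)]
        by eventually_elim (rule K_add[OF field_near_at(1) field_near_at(1)])
      then have "D p x (\<lambda>q. K q (V q + W q)) = D p x (\<lambda>q. K q (V q) + K q (W q))"
        by (intro conn_cong[OF _ _ x] K field_near_add fd)
      also have "\<dots> = D p x (\<lambda>q. K q (V q)) + D p x (\<lambda>q. K q (W q))"
        by (intro conn_add K fd x)
      finally have "D p x (\<lambda>q. K q (V q + W q)) - K p (D p x (\<lambda>q. V q + W q)) =
         (D p x (\<lambda>q. K q (V q)) - K p (D p x V)) + (D p x (\<lambda>q. K q (W q)) - K p (D p x W))"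
        using conn_add[OF fd x] K_add[OF conn_tangent[OF fd(1) x] conn_tangent[OF fd(2) x]] by simp
      then show ?case unfolding add.IH by (simp add: fun_apply(1)[of "V p"] scaleR_add_left sum.distrib)
    qed
  qed
  show ?thesis
    unfolding covariant_endo_def
  proof (rule the_equality)
    show "\<forall>W. field_near A p W \<and> W p = Y p \<longrightarrow>
      D p x (\<lambda>q. K q (Y q)) - K p (D p x Y) = D p x (\<lambda>q. K q (W q)) - K p (D p x W)"
    proof (intro allI impI; elim conjE)
      fix W assume W: "field_near A p W" "W p = Y p"
      show "D p x (\<lambda>q. K q (Y q)) - K p (D p x Y) = D p x (\<lambda>q. K q (W q)) - K p (D p x W)"
        unfolding *[OF Y] *[OF W(1)] W(2) ..
    qed
  qed (use Y in blast)
qed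

end

context framed_map
begin

lemma Rop_curvature:
  assumes p: "\<iota> p \<in> U" and X: "field_near A p X" and Y: "field_near A p Y" and V: "sect p V"
  shows "Rop p X Y V = curvature A' D' (\<iota> p) (push p (X p)) (push p (Y p)) (V p)"
  using Rop_Rten[OF assms] cod.curvature_Rten[OF chart p push_tangent push_tangent section_near_at(1)[OF V]]
    field_near_at(1)[OF X] field_near_at(1)[OF Y] by simp

end

section \<open>Tensors of Kaehler-Norden curvature type\<close>

text \<open>Tangent spaces are sets of operators inside a large function type, so the algebra is
  relative to a subspace \<open>V\<close>.\<close>

locale scalar_product =
  fixes V :: "'v::real_vector set" and g :: "'v \<Rightarrow> 'v \<Rightarrow> real"
  assumes V: "subspace V"
    and g_sym: "x \<in> V \<Longrightarrow> y \<in> V \<Longrightarrow> g x y = g y x"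
    and g_add_left [simp]: "x \<in> V \<Longrightarrow> y \<in> V \<Longrightarrow> z \<in> V \<Longrightarrow> g (x + y) z = g x z + g y z"
    and g_scale_left [simp]: "x \<in> V \<Longrightarrow> y \<in> V \<Longrightarrow> g (r *\<^sub>R x) y = r * g x y"
    and g_nondeg: "x \<in> V \<Longrightarrow> (\<And>y. y \<in> V \<Longrightarrow> g x y = 0) \<Longrightarrow> x = 0"
begin

lemma V_closed [simp]: "0 \<in> V" "x \<in> V \<Longrightarrow> y \<in> V \<Longrightarrow> x + y \<in> V" "x \<in> V \<Longrightarrow> r *\<^sub>R x \<in> V"
    "x \<in> V \<Longrightarrow> - x \<in> V" "x \<in> V \<Longrightarrow> y \<in> V \<Longrightarrow> x - y \<in> V"
  using V by (auto simp: subspace_0 subspace_add subspace_scale subspace_neg subspace_diff)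

lemma g_add_right [simp]: "x \<in> V \<Longrightarrow> y \<in> V \<Longrightarrow> z \<in> V \<Longrightarrow> g x (y + z) = g x y + g x z"
  and g_scale_right [simp]: "x \<in> V \<Longrightarrow> y \<in> V \<Longrightarrow> g x (r *\<^sub>R y) = r * g x y"
  by (simp_all add: g_sym[of x])

lemma g_minus [simp]: "x \<in> V \<Longrightarrow> y \<in> V \<Longrightarrow> g (- x) y = - g x y" "x \<in> V \<Longrightarrow> y \<in> V \<Longrightarrow> g x (- y) = - g x y"
  using g_scale_left[of x y "-1"] g_scale_right[of x y "-1"] by simp_all

lemma g_diff [simp]: "x \<in> V \<Longrightarrow> y \<in> V \<Longrightarrow> z \<in> V \<Longrightarrow> g (x - y) z = g x z - g y z"
    "x \<in> V \<Longrightarrow> y \<in> V \<Longrightarrow> z \<in> V \<Longrightarrow> g x (y - z) = g x y - g x z"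
  using g_add_left[of x "- y" z] g_add_right[of x y "- z"] by simp_all

lemma g_zero [simp]: "x \<in> V \<Longrightarrow> g 0 x = 0" "x \<in> V \<Longrightarrow> g x 0 = 0"
  using g_scale_left[of x x 0] g_scale_right[of x x 0] by simp_all

lemma g_eqI: "x \<in> V \<Longrightarrow> y \<in> V \<Longrightarrow> (\<And>z. z \<in> V \<Longrightarrow> g x z = g y z) \<Longrightarrow> x = y"
  using g_nondeg[of "x - y"] by simp

end

locale norden_space = scalar_product V g for V :: "'v::real_vector set" and g +
  fixes J :: "'v \<Rightarrow> 'v"
  assumes J_V [simp]: "x \<in> V \<Longrightarrow> J x \<in> V"
    and J_J [simp]: "x \<in> V \<Longrightarrow> J (J x) = - x"
    and J_add [simp]: "x \<in> V \<Longrightarrow> y \<in> V \<Longrightarrow> J (x + y) = J x + J y"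
    and J_scale [simp]: "x \<in> V \<Longrightarrow> J (r *\<^sub>R x) = r *\<^sub>R J x"
    and g_J_J: "x \<in> V \<Longrightarrow> y \<in> V \<Longrightarrow> g (J x) (J y) = - g x y"
begin

lemma J_minus [simp]: "x \<in> V \<Longrightarrow> J (- x) = - J x"
  using J_scale[of x "-1"] by simp

lemma g_J_left [simp]: "x \<in> V \<Longrightarrow> y \<in> V \<Longrightarrow> g (J x) y = g x (J y)"
  using g_J_J[of x "J y"] by simp

lemma g_J_sym: "x \<in> V \<Longrightarrow> y \<in> V \<Longrightarrow> g x (J y) = g y (J x)"
  using g_sym[of x "J y"] by simp

definition scaleC :: "complex \<Rightarrow> 'v \<Rightarrow> 'v" where
  "scaleC w x = Re w *\<^sub>R x + Im w *\<^sub>R J x"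

text \<open>The minus sign makes the form complex bilinear when \<open>J\<close> acts as
  multiplication by the imaginary unit; this rests on \<open>g (J x) y = g x (J y)\<close>.\<close>

definition gC :: "'v \<Rightarrow> 'v \<Rightarrow> complex" where
  "gC x y = Complex (g x y) (- g x (J y))"

lemma scaleC_V [simp]: "x \<in> V \<Longrightarrow> scaleC w x \<in> V"
  by (simp add: scaleC_def)

lemma gC_sym: "x \<in> V \<Longrightarrow> y \<in> V \<Longrightarrow> gC x y = gC y x"
  by (simp add: gC_def g_sym[of x] g_J_sym[of x])

lemma gC_add_left [simp]: "x \<in> V \<Longrightarrow> y \<in> V \<Longrightarrow> z \<in> V \<Longrightarrow> gC (x + y) z = gC x z + gC y z"
  and gC_scale_left [simp]: "x \<in> V \<Longrightarrow> y \<in> V \<Longrightarrow> gC (scaleC w x) y = w * gC x y"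
  by (simp_all add: gC_def scaleC_def complex_eq_iff algebra_simps)

lemma gC_add_right [simp]: "x \<in> V \<Longrightarrow> y \<in> V \<Longrightarrow> z \<in> V \<Longrightarrow> gC x (y + z) = gC x y + gC x z"
  and gC_scale_right [simp]: "x \<in> V \<Longrightarrow> y \<in> V \<Longrightarrow> gC x (scaleC w y) = w * gC x y"
  by (simp_all add: gC_sym[of x])

lemma gC_nondeg: "x \<in> V \<Longrightarrow> (\<And>y. y \<in> V \<Longrightarrow> gC x y = 0) \<Longrightarrow> x = 0"
  using g_nondeg by (simp add: gC_def complex_eq_iff)

text \<open>In real terms: \<open>g a a = g b b = 1\<close>, \<open>g a b = 0\<close>, and
  \<open>g\<close> vanishes between the plane of \<open>a\<close>, \<open>b\<close> and its image
  under \<open>J\<close>. Such a pair spans a totally real section with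
  \<open>pi1 = 1\<close>.\<close>

definition orthonormal_pair :: "'v \<Rightarrow> 'v \<Rightarrow> bool" where
  "orthonormal_pair a b \<longleftrightarrow> a \<in> V \<and> b \<in> V \<and> gC a a = 1 \<and> gC b b = 1 \<and> gC a b = 0"

text \<open>Indefiniteness is harmless over the complex numbers, where every nonzero value has a
  square root. The two inequalities keep both normalised vectors from being null.\<close>

lemma gram_schmidt:
  assumes x: "x \<in> V" and y: "y \<in> V" and x0: "gC x x \<noteq> 0" and xy: "gC x x * gC y y \<noteq> gC x y * gC x y"
  obtains l m k where "l \<noteq> 0" "m \<noteq> 0" "orthonormal_pair (scaleC l x) (scaleC m (y + scaleC k x))"
proof -
  define k where "k = - gC x y / gC x x"
  define y' where "y' = y + scaleC k x"
  have y': "y' \<in> V" using x y by (simp add: y'_def)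
  have xy0: "gC x y' = 0" using x y x0 by (simp add: y'_def k_def)
  have "gC y' y' = gC y y + k * gC x y"
    using x y xy0 gC_sym[OF y' x] unfolding y'_def by (simp add: gC_sym[OF y x])
  then have "gC x x * gC y' y' = gC x x * gC y y - gC x y * gC x y"
    using x0 by (simp add: k_def field_simps)
  then have y0: "gC y' y' \<noteq> 0" using xy by auto
  define l m where "l = csqrt (1 / gC x x)" and "m = csqrt (1 / gC y' y')"
  have l: "l * l = 1 / gC x x" and m: "m * m = 1 / gC y' y'"
    unfolding l_def m_def by (metis power2_csqrt power2_eq_square)+
  have "orthonormal_pair (scaleC l x) (scaleC m y')"
    using x y' l m x0 y0 xy0 by (simp add: orthonormal_pair_def mult.assoc[symmetric])
  moreover have "l \<noteq> 0" "m \<noteq> 0" using l m x0 y0 by auto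
  ultimately show ?thesis using that unfolding y'_def by blast
qed

text \<open>The hypothesis says that the complex dimension exceeds one. Once a non-null
  \<open>x\<close> is found, failure of all \<open>y\<close> would make the complement of
  \<open>x\<close> totally isotropic, hence zero by nondegeneracy, and \<open>V\<close> would be the
  complex line of \<open>x\<close>.\<close>

lemma orthonormal_pair_exists:
  assumes dim: "\<not> (\<exists>x. V \<subseteq> span {x, J x})"
  obtains a b where "orthonormal_pair a b"
proof -
  \<comment> \<open>Polarisation: a form whose squares vanish vanishes on pairs.\<close>
  have iso: "gC x z = 0" if "\<And>y. y \<in> W \<Longrightarrow> gC y y = 0" "x \<in> W" "z \<in> W" "x + z \<in> W" "W \<subseteq> V" for W x z
  proof -
    have "x \<in> V" "z \<in> V" using that(2,3,5) by auto
    then have "gC (x + z) (x + z) = gC x x + 2 * gC x z + gC z z" by (simp add: gC_sym[of z x])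
    then show ?thesis unfolding that(1)[OF that(2)] that(1)[OF that(3)] that(1)[OF that(4)] by simp
  qed
  obtain x where x: "x \<in> V" "gC x x \<noteq> 0"
  proof (rule ccontr)
    assume "\<not> thesis"
    then have *: "\<And>x. x \<in> V \<Longrightarrow> gC x x = 0" using that by blast
    have "V \<subseteq> {0}" using gC_nondeg iso[of V, OF *] by auto
    then show False using dim span_zero by blast
  qed
  obtain y where y: "y \<in> V" "gC x x * gC y y \<noteq> gC x y * gC x y"
  proof (rule ccontr)
    assume "\<not> thesis"
    then have *: "\<And>y. y \<in> V \<Longrightarrow> gC x x * gC y y = gC x y * gC x y" using that by blast
    let ?W = "{y \<in> V. gC x y = 0}"
    have Wz: "gC y y = 0" if "y \<in> ?W" for y using *[of y] that x(2) by simp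
    have W0: "w = 0" if w: "w \<in> ?W" for w
    proof (rule gC_nondeg)
      fix z assume z: "z \<in> V"
      \<comment> \<open>The projection of \<open>z\<close> to the complement of \<open>x\<close>;
        since \<open>w\<close> is orthogonal to \<open>x\<close>, it pairs with \<open>z\<close> and
        \<open>z'\<close> alike.\<close>
      define z' where "z' = z + scaleC (- gC x z / gC x x) x"
      have z': "z' \<in> ?W" using x z by (simp add: z'_def)
      have "gC w z' = 0"
        by (rule iso[of ?W, OF Wz]) (use x w z' in auto)
      then show "gC w z = 0" using w z x gC_sym[of w x] by (simp add: z'_def)
    qed (use w in simp)
    have "y \<in> span {x, J x}" if y: "y \<in> V" for y
    proof -
      define w where "w = gC x y / gC x x"
      have "y + scaleC (- w) x \<in> ?W" using x y by (simp add: w_def)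
      then have "y + scaleC (- w) x = 0" by (rule W0)
      then have "y = Re w *\<^sub>R x + Im w *\<^sub>R J x"
        unfolding scaleC_def by (simp add: algebra_simps eq_neg_iff_add_eq_0 add_eq_0_iff2)
      then show ?thesis using span_add span_scale span_base by (metis insertI1 insertI2)
    qed
    then show False using dim by blast
  qed
  show ?thesis using gram_schmidt[OF x(1) y(1) x(2) y(2)] that by metis
qed

end

text \<open>Linearity is demanded in the first argument only; antisymmetry and pair symmetry supply
  the others. \<open>T_J34\<close> is the trace of a parallel \<open>J\<close>.\<close>

locale curvature_like = norden_space V g J for V :: "'v::real_vector set" and g and J +
  fixes T :: "'v \<Rightarrow> 'v \<Rightarrow> 'v \<Rightarrow> 'v \<Rightarrow> real"
  assumes T_add1 [simp]: "x \<in> V \<Longrightarrow> x' \<in> V \<Longrightarrow> y \<in> V \<Longrightarrow> z \<in> V \<Longrightarrow> u \<in> V \<Longrightarrow> T (x + x') y z u = T x y z u + T x' y z u"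
    and T_scale1 [simp]: "x \<in> V \<Longrightarrow> y \<in> V \<Longrightarrow> z \<in> V \<Longrightarrow> u \<in> V \<Longrightarrow> T (r *\<^sub>R x) y z u = r * T x y z u"
    and T_anti12: "x \<in> V \<Longrightarrow> y \<in> V \<Longrightarrow> z \<in> V \<Longrightarrow> u \<in> V \<Longrightarrow> T y x z u = - T x y z u"
    and T_anti34: "x \<in> V \<Longrightarrow> y \<in> V \<Longrightarrow> z \<in> V \<Longrightarrow> u \<in> V \<Longrightarrow> T x y u z = - T x y z u"
    and T_bianchi: "x \<in> V \<Longrightarrow> y \<in> V \<Longrightarrow> z \<in> V \<Longrightarrow> u \<in> V \<Longrightarrow> T x y z u + T y z x u + T z x y u = 0"
    and T_J34: "x \<in> V \<Longrightarrow> y \<in> V \<Longrightarrow> z \<in> V \<Longrightarrow> u \<in> V \<Longrightarrow> T x y (J z) u = T x y z (J u)"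
begin

text \<open>The classical octahedron argument: four Bianchi identities combined with the two
  antisymmetries.\<close>

lemma T_pair: "x \<in> V \<Longrightarrow> y \<in> V \<Longrightarrow> z \<in> V \<Longrightarrow> u \<in> V \<Longrightarrow> T x y z u = T z u x y"
  using T_bianchi[of x y z u] T_bianchi[of y z u x] T_bianchi[of z u x y] T_bianchi[of u x y z]
    T_anti12[of y z x u] T_anti12[of z x y u] T_anti12[of z u y x] T_anti12[of u y z x] T_anti12[of x u z y]
    T_anti12[of z u x y] T_anti12[of u x z y] T_anti12[of x y u z] T_anti12[of y z u x]
    T_anti34[of x y z u] T_anti34[of y z x u] T_anti34[of z x y u] T_anti34[of z u x y]
    T_anti34[of u x y z] T_anti34[of y u z x] T_anti34[of u y z x] T_anti34[of x z u y] T_anti34[of x u z y]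
  by (smt (verit))

lemma T_add2 [simp]: "x \<in> V \<Longrightarrow> y \<in> V \<Longrightarrow> y' \<in> V \<Longrightarrow> z \<in> V \<Longrightarrow> u \<in> V \<Longrightarrow> T x (y + y') z u = T x y z u + T x y' z u"
  and T_scale2 [simp]: "x \<in> V \<Longrightarrow> y \<in> V \<Longrightarrow> z \<in> V \<Longrightarrow> u \<in> V \<Longrightarrow> T x (r *\<^sub>R y) z u = r * T x y z u"
  by (simp_all add: T_anti12[of _ x])

lemma T_add3 [simp]: "x \<in> V \<Longrightarrow> y \<in> V \<Longrightarrow> z \<in> V \<Longrightarrow> z' \<in> V \<Longrightarrow> u \<in> V \<Longrightarrow> T x y (z + z') u = T x y z u + T x y z' u"
  and T_scale3 [simp]: "x \<in> V \<Longrightarrow> y \<in> V \<Longrightarrow> z \<in> V \<Longrightarrow> u \<in> V \<Longrightarrow> T x y (r *\<^sub>R z) u = r * T x y z u"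
  by (simp_all add: T_pair[of x y])

lemma T_add4 [simp]: "x \<in> V \<Longrightarrow> y \<in> V \<Longrightarrow> z \<in> V \<Longrightarrow> u \<in> V \<Longrightarrow> u' \<in> V \<Longrightarrow> T x y z (u + u') = T x y z u + T x y z u'"
  and T_scale4 [simp]: "x \<in> V \<Longrightarrow> y \<in> V \<Longrightarrow> z \<in> V \<Longrightarrow> u \<in> V \<Longrightarrow> T x y z (r *\<^sub>R u) = r * T x y z u"
  by (simp_all add: T_pair[of x y])

lemma T_minus4 [simp]: "x \<in> V \<Longrightarrow> y \<in> V \<Longrightarrow> z \<in> V \<Longrightarrow> u \<in> V \<Longrightarrow> T x y z (- u) = - T x y z u"
  using T_scale4[of x y z u "-1"] by simp

lemma T_diff4 [simp]: "x \<in> V \<Longrightarrow> y \<in> V \<Longrightarrow> z \<in> V \<Longrightarrow> u \<in> V \<Longrightarrow> u' \<in> V \<Longrightarrow> T x y z (u - u') = T x y z u - T x y z u'"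
  using T_add4[of x y z u "- u'"] by simp

lemma T_J12: "x \<in> V \<Longrightarrow> y \<in> V \<Longrightarrow> z \<in> V \<Longrightarrow> u \<in> V \<Longrightarrow> T (J x) y z u = T x (J y) z u"
  using T_J34[of z u x y] by (simp add: T_pair[of z u])

text \<open>By Bianchi the difference of the two sides changes sign under a cyclic shift of
  \<open>x\<close>, \<open>y\<close>, \<open>z\<close>. Three shifts return to the start with the
  opposite sign, so it vanishes.\<close>

lemma T_J14:
  assumes "x \<in> V" "y \<in> V" "z \<in> V" "u \<in> V" shows "T (J x) y z u = T x y z (J u)"
proof -
  have "T (J x) y z u - T x y z (J u) = - (T (J z) x y u - T z x y (J u))"
    if "x \<in> V" "y \<in> V" "z \<in> V" for x y z
    using T_bianchi[of "J x" y z u] T_bianchi[of x y z "J u"] T_J34[of y z x u] T_J12[of z x y u] that assms(4)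
    by simp
  from this[of x y z] this[of z x y] this[of y z x] show ?thesis using assms by simp
qed

definition TC :: "'v \<Rightarrow> 'v \<Rightarrow> 'v \<Rightarrow> 'v \<Rightarrow> complex" where
  "TC x y z u = Complex (T x y z u) (- T x y z (J u))"

lemma TC_add [simp]:
  assumes "x \<in> V" "y \<in> V" "z \<in> V" "u \<in> V" "v \<in> V"
  shows "TC (x + v) y z u = TC x y z u + TC v y z u" "TC x (y + v) z u = TC x y z u + TC x v z u"
    "TC x y (z + v) u = TC x y z u + TC x y v u" "TC x y z (u + v) = TC x y z u + TC x y z v"
  using assms by (simp_all add: TC_def complex_eq_iff)

text \<open>\<open>J\<close> can be moved from every argument to the last one, where it multiplies
  \<open>TC\<close> by the imaginary unit; so \<open>TC\<close> is complex linear in each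
  argument.\<close>

lemma TC_scale [simp]:
  assumes "x \<in> V" "y \<in> V" "z \<in> V" "u \<in> V"
  shows "TC (scaleC w x) y z u = w * TC x y z u" "TC x (scaleC w y) z u = w * TC x y z u"
    "TC x y (scaleC w z) u = w * TC x y z u" "TC x y z (scaleC w u) = w * TC x y z u"
  using assms T_J12[of x y z u, symmetric] T_J12[of x y z "J u", symmetric]
  by (simp_all add: TC_def scaleC_def complex_eq_iff T_J14 T_J34 algebra_simps)

lemma TC_anti: assumes "x \<in> V" "y \<in> V" "z \<in> V" "u \<in> V"
  shows "TC y x z u = - TC x y z u" "TC x y u z = - TC x y z u"
  using assms T_anti12[of x y z u] T_anti12[of x y z "J u"] T_anti34[of x y z u]
    T_anti34[of x y "J z" u] T_J34[of x y z u] by (simp_all add: TC_def complex_eq_iff)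

lemma TC_same: assumes "x \<in> V" "y \<in> V" "z \<in> V" shows "TC x x y z = 0" "TC y z x x = 0"
  using TC_anti(1)[of x x y z] TC_anti(2)[of y z x x] assms by simp_all

text \<open>
  The complex sectional curvatures of nondegenerate complex planes vanish by orthonormalisation;
  those of all pairs because their values along \<open>x + s a\<close>, \<open>y + s b\<close> are a polynomial in \<open>s\<close>.
\<close>

lemma TC_sectional_zero:
  assumes dim: "\<not> (\<exists>x. V \<subseteq> span {x, J x})"
    and zero: "\<And>a b. orthonormal_pair a b \<Longrightarrow> T a b b a = 0 \<and> T a b b (J a) = 0"
    and x: "x \<in> V" and y: "y \<in> V"
  shows "TC x y y x = 0"
proof -
  have gen: "TC x y y x = 0"
    if x: "x \<in> V" and y: "y \<in> V" and nd: "gC x x \<noteq> 0" "gC x x * gC y y \<noteq> gC x y * gC x y" for x y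
  proof -
    obtain l m k where lm: "l \<noteq> 0" "m \<noteq> 0" and on: "orthonormal_pair (scaleC l x) (scaleC m (y + scaleC k x))"
      using gram_schmidt[OF x y nd] by metis
    define y' where "y' = y + scaleC k x"
    have y': "y' \<in> V" using x y by (simp add: y'_def)
    have "TC (scaleC l x) (scaleC m y') (scaleC m y') (scaleC l x) = 0"
      using zero[OF on] by (simp add: TC_def complex_eq_iff y'_def)
    then have "TC x y' y' x = 0" using lm x y' by simp
    then show ?thesis using x y by (simp add: TC_same y'_def)
  qed
  obtain a b where ab: "orthonormal_pair a b" using orthonormal_pair_exists[OF dim] .
  then have a: "a \<in> V" "b \<in> V" "gC a a = 1" "gC b b = 1" "gC a b = 0" by (auto simp: orthonormal_pair_def)
  let ?x = "\<lambda>s. x + scaleC (of_real s) a" and ?y = "\<lambda>s. y + scaleC (of_real s) b"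
  \<comment> \<open>The Gram entries of the deformed pair as polynomials in \<open>s\<close>.
    Orthonormality of \<open>a\<close>, \<open>b\<close> makes the leading coefficients of
    \<open>P\<close>, \<open>Q\<close> equal to 1 and removes the quadratic term of
    \<open>S\<close>.\<close>
  define P where "P = [:gC x x, 2 * gC x a, 1:]"
  define Q where "Q = [:gC y y, 2 * gC y b, 1:]"
  define S where "S = [:gC x y, gC x b + gC a y:]"
  define t0 where "t0 = TC x y y x"
  define F where "F = [:t0,
    TC a y y x + TC x b y x + TC x y b x + TC x y y a,
    TC a b y x + TC a y b x + TC a y y a + TC x b b x + TC x b y a + TC x y b a,
    TC a b b x + TC a b y a + TC a y b a + TC x b b a, TC a b b a:]"
  have P: "gC (?x s) (?x s) = poly P (of_real s)" for s
    using x a gC_sym[of a x] by (simp add: P_def algebra_simps)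
  have Q: "gC (?y s) (?y s) = poly Q (of_real s)" for s
    using y a gC_sym[of b y] by (simp add: Q_def algebra_simps)
  have S: "gC (?x s) (?y s) = poly S (of_real s)" for s
    using x y a by (simp add: S_def algebra_simps)
  have F: "TC (?x s) (?y s) (?y s) (?x s) = poly F (of_real s)" for s
    using x y a by (simp add: F_def t0_def algebra_simps)
  \<comment> \<open>The extra factors vanish exactly at the parameters excluded from
    \<open>gen\<close>, so the product is zero for all real \<open>s\<close>. Infinitely many roots
    and the absence of zero divisors then leave \<open>F = 0\<close>, whose constant term is the
    claim.\<close>
  have "poly (F * P * (P * Q - S * S)) (of_real s) = 0" for s :: real
  proof (cases "poly P (of_real s) = 0 \<or> poly (P * Q - S * S) (of_real s) = 0")
    case False
    then have "TC (?x s) (?y s) (?y s) (?x s) = 0"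
      using x y a by (intro gen) (simp_all only: P Q S V_closed scaleC_V, auto)
    then show ?thesis using F by simp
  qed auto
  then have "range (of_real :: real \<Rightarrow> complex) \<subseteq> {z. poly (F * P * (P * Q - S * S)) z = 0}" by auto
  moreover have "infinite (range (of_real :: real \<Rightarrow> complex))"
    by (simp add: finite_image_iff inj_of_real infinite_UNIV_char_0)
  ultimately have "F * P * (P * Q - S * S) = 0" using poly_roots_finite finite_subset by blast
  moreover have "P \<noteq> 0" by (simp add: P_def)
  \<comment> \<open>Only \<open>P * Q\<close> reaches degree 4, because \<open>S\<close> has degree
    at most 1.\<close>
  moreover have "coeff (P * Q - S * S) 4 = 1"
    by (simp add: P_def Q_def S_def numeral_eq_Suc)
  then have "P * Q - S * S \<noteq> 0" by auto
  ultimately have "F = 0" by simp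
  then show ?thesis by (simp add: F_def t0_def)
qed

text \<open>Polarising the vanishing sectional values twice makes \<open>T\<close> antisymmetric in
  the middle arguments. All three Bianchi summands then agree, so three times \<open>T\<close> is
  zero.\<close>

lemma T_zero:
  assumes dim: "\<not> (\<exists>x. V \<subseteq> span {x, J x})"
    and zero: "\<And>a b. orthonormal_pair a b \<Longrightarrow> T a b b a = 0 \<and> T a b b (J a) = 0"
    and "x \<in> V" "y \<in> V" "z \<in> V" "u \<in> V"
  shows "T x y z u = 0"
proof -
  have 1: "T x y y x = 0" if "x \<in> V" "y \<in> V" for x y
    using TC_sectional_zero[OF dim zero that] by (simp add: TC_def complex_eq_iff)
  have 2: "T x y y u = 0" if "x \<in> V" "y \<in> V" "u \<in> V" for x y u
  proof -
    have "T u y y x = T x y y u"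
      using T_pair[of u y y x] T_anti12[of x y u y] T_anti34[of x y y u] that by linarith
    then show ?thesis using 1[of "x + u" y] 1[of x y] 1[of u y] that by simp
  qed
  have 3: "T x z y u = - T x y z u" if "x \<in> V" "y \<in> V" "z \<in> V" "u \<in> V" for x y z u
    using 2[of x "y + z" u] 2[of x y u] 2[of x z u] that by simp
  have "T y z x u = T x y z u"
    using 3[of y x z u] T_anti12[of x y z u] assms(3-) by linarith
  moreover have "T z x y u = T x y z u"
    using 3[of x y z u] T_anti12[of x z y u] assms(3-) by linarith
  ultimately show ?thesis using T_bianchi[of x y z u] assms(3-) by linarith
qed

end

section \<open>Curvature of Kaehler-Norden manifolds\<close>

context smooth_manifold
begin

lemma coord_vec_basis:
  assumes U: "(U, c) \<in> A" "p \<in> U"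
  shows "independent (coord_vec A U c p ` Basis)" "card (coord_vec A U c p ` Basis) = DIM('e)"
    "span (coord_vec A U c p ` Basis) = tangent_space A p"
proof -
  note lin = coord_vec_linear[OF U] and inj = coord_vec_inj[OF U]
  show "independent (coord_vec A U c p ` Basis)"
    by (rule linear_independent_injective_image[OF lin independent_Basis]) (simp add: inj_on_subset[OF inj])
  show "card (coord_vec A U c p ` Basis) = DIM('e)"
    by (rule card_image) (rule inj_on_subset[OF inj subset_UNIV])
  show "span (coord_vec A U c p ` Basis) = tangent_space A p"
    unfolding linear_span_image[OF lin] span_Basis tangent_space_chart[OF U] ..
qed

text \<open>The surrounding function space is not finite-dimensional in general, so dimension is
  expressed by comparing cardinalities with the coordinate basis.\<close>

lemma independent_tangent_card:
  assumes "independent S" "S \<subseteq> tangent_space A p" shows "finite S \<and> card S \<le> DIM('e)"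
proof -
  obtain U c where U: "(U, c) \<in> A" "p \<in> U" by (rule chart_at)
  show ?thesis
    using independent_span_bound[of "coord_vec A U c p ` Basis" S] assms coord_vec_basis[OF U] by simp
qed

lemma spanning_tangent_card:
  assumes "finite S" "tangent_space A p \<subseteq> span S" shows "DIM('e) \<le> card S"
proof -
  obtain U c where U: "(U, c) \<in> A" "p \<in> U" by (rule chart_at)
  have "coord_vec A U c p ` Basis \<subseteq> span S"
    using assms(2) coord_vec_tangent[OF U] by auto
  then show ?thesis
    using independent_span_bound[OF assms(1) coord_vec_basis(1)[OF U]] coord_vec_basis(2)[OF U] by simp
qed

lemma basis_of_length:
  assumes "basis_of e (tangent_space A p)" shows "length e = DIM('e)"
proof -
  have e: "distinct e" "independent (set e)" "span (set e) = tangent_space A p"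
    using assms by (auto simp: basis_of_def)
  then have "set e \<subseteq> tangent_space A p" using span_base by blast
  then have "card (set e) \<le> DIM('e)" using independent_tangent_card e(2) by blast
  moreover have "DIM('e) \<le> card (set e)" using spanning_tangent_card[of "set e" p] e(3) by simp
  ultimately show ?thesis using distinct_card[OF e(1)] by simp
qed

end

section \<open>Symmetries of the Levi-Civita curvature\<close>

locale levi_civita_manifold = smooth_manifold A
  for A :: "('m::topological_space, 'e::euclidean_space) atlas" +
  fixes g :: "'m \<Rightarrow> 'm tvec \<Rightarrow> 'm tvec \<Rightarrow> real" and D :: "'m \<Rightarrow> 'm tvec \<Rightarrow> ('m \<Rightarrow> 'm tvec) \<Rightarrow> 'm tvec"
  assumes metric: "pseudo_riemannian_metric A g" and lc: "levi_civita A g D"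
begin

sublocale torsion_free_manifold A D
  by unfold_locales (use lc in \<open>auto simp: levi_civita_def\<close>)

lemma scalar_product: "scalar_product (tangent_space A p) (g p)"
  by unfold_locales
    (use metric subspace_tangent_space in \<open>auto simp: pseudo_riemannian_metric_def\<close>)

lemma metric_smooth: "field_near A p X \<Longrightarrow> field_near A p Y \<Longrightarrow> smooth_near A p (\<lambda>q. g q (X q) (Y q))"
  using metric unfolding pseudo_riemannian_metric_def by blast

lemma metric_compatible:
  "field_near A p X \<Longrightarrow> field_near A p Y \<Longrightarrow> v \<in> tangent_space A p \<Longrightarrow>
    v (\<lambda>q. g q (X q) (Y q)) = g p (D p v X) (Y p) + g p (X p) (D p v Y)"
  using lc unfolding levi_civita_def by blast

lemmas g_sym = scalar_product.g_sym[OF scalar_product]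
  and g_add_left = scalar_product.g_add_left[OF scalar_product]
  and g_scale_left = scalar_product.g_scale_left[OF scalar_product]
  and g_add_right = scalar_product.g_add_right[OF scalar_product]
  and g_scale_right = scalar_product.g_scale_right[OF scalar_product]
  and g_diff = scalar_product.g_diff[OF scalar_product]
  and g_eqI = scalar_product.g_eqI[OF scalar_product]

lemma conn_zero_vec: "field_near A p Y \<Longrightarrow> D p 0 Y = 0"
  using conn_scale_vec[OF _ tangent_zero, of p Y 0] by simp

lemma curvature_commuting:
  assumes X: "field_near A p X" and Y: "field_near A p Y" and Z: "field_near A p Z" and "bracket A X Y p = 0"
  shows "curvature A D p (X p) (Y p) (Z p) = D p (X p) (\<lambda>q. D q (Y q) Z) - D p (Y p) (\<lambda>q. D q (X q) Z)"
  using curvature_eq[OF X Y Z] assms(4) conn_zero_vec[OF Z] by simp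

lemma curvature_tangent:
  assumes "x \<in> tangent_space A p" "y \<in> tangent_space A p" "z \<in> tangent_space A p"
  shows "curvature A D p x y z \<in> tangent_space A p"
proof -
  let ?E = "extension p"
  note E = extension_field[of p] extension_at[of _ p] extension_bracket_near[of p]
  from curvature_commuting[OF E(1) E(1) E(1) extension_bracket, of x y z] show ?thesis
    using E(1,2) assms by (simp add: tangent_diff conn_tangent conn_field)
qed

lemma curvature_add1:
  assumes "x \<in> tangent_space A p" "x' \<in> tangent_space A p" "y \<in> tangent_space A p" "z \<in> tangent_space A p"
  shows "curvature A D p (x + x') y z = curvature A D p x y z + curvature A D p x' y z"
proof -
  obtain U c where U: "(U, c) \<in> A" "p \<in> U" by (rule chart_at)
  interpret id: framed_map A D A D id U c by (rule framed_id[OF U(1)])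
  show ?thesis
    using assms by (simp add: curvature_Rten[OF U] tangent_add id.Rten_def fun_apply(1)[of x x'] distrib_right
      scaleR_add_left scaleR_add_right sum.distrib)
qed

lemma curvature_scale1:
  assumes "x \<in> tangent_space A p" "y \<in> tangent_space A p" "z \<in> tangent_space A p"
  shows "curvature A D p (r *\<^sub>R x) y z = r *\<^sub>R curvature A D p x y z"
proof -
  obtain U c where U: "(U, c) \<in> A" "p \<in> U" by (rule chart_at)
  interpret id: framed_map A D A D id U c by (rule framed_id[OF U(1)])
  show ?thesis
    using assms by (simp add: curvature_Rten[OF U] tangent_scale id.Rten_def fun_apply(5)[of r x]
      scaleR_sum_right mult.left_commute[of r] mult.assoc)
qed

lemma curvature_add3:
  assumes "x \<in> tangent_space A p" "y \<in> tangent_space A p" "z \<in> tangent_space A p" "z' \<in> tangent_space A p"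
  shows "curvature A D p x y (z + z') = curvature A D p x y z + curvature A D p x y z'"
proof -
  obtain U c where U: "(U, c) \<in> A" "p \<in> U" by (rule chart_at)
  interpret id: framed_map A D A D id U c by (rule framed_id[OF U(1)])
  show ?thesis
    using assms by (simp add: curvature_Rten[OF U] tangent_add id.Rten_add)
qed

lemma curvature_anti12:
  assumes "x \<in> tangent_space A p" "y \<in> tangent_space A p" "z \<in> tangent_space A p"
  shows "curvature A D p y x z = - curvature A D p x y z"
proof -
  let ?E = "extension p"
  note E = extension_field[of p] extension_at[of _ p] extension_bracket_near[of p]
  note B = extension_bracket[of p]
  show ?thesis
    using curvature_commuting[OF E(1) E(1) E(1) B, of x y z] curvature_commuting[OF E(1) E(1) E(1) B, of y x z] E(2) assms
    by simp
qed

text \<open>For commuting extensions \<open>D_Y Z\<close> and \<open>D_Z Y\<close> agree as fields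
  near \<open>p\<close>, so the six second derivatives cancel in pairs. Agreement at
  \<open>p\<close> alone would not allow a further differentiation, hence the use of
  \<open>extension_bracket_near\<close>.\<close>

lemma curvature_bianchi:
  assumes "x \<in> tangent_space A p" "y \<in> tangent_space A p" "z \<in> tangent_space A p"
  shows "curvature A D p x y z + curvature A D p y z x + curvature A D p z x y = 0"
proof -
  let ?E = "extension p"
  note E = extension_field[of p] extension_at[of _ p] extension_bracket_near[of p]
  note B = extension_bracket[of p]
  have c: "curvature A D p x y z = D p x (\<lambda>q. D q (?E y q) (?E z)) - D p y (\<lambda>q. D q (?E x q) (?E z))"
    if "x \<in> tangent_space A p" "y \<in> tangent_space A p" "z \<in> tangent_space A p" for x y z
    using curvature_commuting[OF E(1) E(1) E(1) B, of x y z] E(2) that by simp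
  have s: "D p x (\<lambda>q. D q (?E y q) (?E z)) = D p x (\<lambda>q. D q (?E z q) (?E y))"
    if "x \<in> tangent_space A p" "y \<in> tangent_space A p" "z \<in> tangent_space A p" for x y z
  proof (rule conn_cong[OF conn_field conn_field])
    show "\<forall>\<^sub>F q in nhds p. D q (?E y q) (?E z) = D q (?E z q) (?E y)"
      using E(3)[of y z] field_near_eventually[OF E(1)[of y]] field_near_eventually[OF E(1)[of z]]
    proof eventually_elim
      case (elim q)
      then show ?case using torsion_free[OF elim(2,3)] by simp
    qed
  qed (use E(1) that in auto)
  show ?thesis
    using c[OF assms] c[of y z x] c[of z x y] s[of x y z] s[of y z x] s[of z x y] assms by simp
qed

text \<open>Commuting fields have commuting second derivatives on the function
  \<open>g(Z, Z)\<close>. Expanded by metric compatibility, the products of first derivatives are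
  symmetric and drop out.\<close>

lemma curvature_metric:
  assumes x: "x \<in> tangent_space A p" and y: "y \<in> tangent_space A p" and z: "z \<in> tangent_space A p"
  shows "g p (curvature A D p x y z) z = 0"
proof -
  let ?E = "extension p"
  note E = extension_field[of p] extension_at[of _ p] extension_bracket_near[of p]
  note B = extension_bracket[of p]
  let ?f = "\<lambda>q. g q (?E z q) (?E z q)"
  note Z = E(1)[of z]
  have 2: "x (\<lambda>q. ?E y q ?f) = 2 * (g p (D p x (\<lambda>q. D q (?E y q) (?E z))) z + g p (D p y (?E z)) (D p x (?E z)))"
    if x: "x \<in> tangent_space A p" and y: "y \<in> tangent_space A p" for x y
  proof -
    have DZ: "field_near A p (\<lambda>q. D q (?E y q) (?E z))" by (rule conn_field[OF Z E(1)[of y]])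
    have "\<forall>\<^sub>F q in nhds p. ?E y q ?f = 2 * g q (D q (?E y q) (?E z)) (?E z q)"
      using field_near_eventually[OF Z] field_near_eventually[OF E(1)[of y]]
    proof eventually_elim
      case (elim q)
      have "D q (?E y q) (?E z) \<in> tangent_space A q" by (rule conn_tangent[OF elim(1) field_near_at(1)[OF elim(2)]])
      then show ?case
        using metric_compatible[OF elim(1,1) field_near_at(1)[OF elim(2)]]
          g_sym[of "?E z q" q "D q (?E y q) (?E z)"] field_near_at(1)[OF elim(1)] by simp
    qed
    then have "x (\<lambda>q. ?E y q ?f) = x (\<lambda>q. 2 * g q (D q (?E y q) (?E z)) (?E z q))"
      by (rule deriv_cong[OF x])
    also have "\<dots> = 2 * (g p (D p x (\<lambda>q. D q (?E y q) (?E z))) (?E z p) + g p (D p (?E y p) (?E z)) (D p x (?E z)))"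
      using deriv_scale[OF x metric_smooth[OF DZ Z], of 2] metric_compatible[OF DZ Z x] by simp
    finally show ?thesis using E(2)[OF y] E(2)[OF z] by simp
  qed
  have "x (\<lambda>q. ?E y q ?f) - y (\<lambda>q. ?E x q ?f) = 0"
    using fun_cong[OF B[of x y], of ?f] metric_smooth[OF Z Z] E(2)[OF x] E(2)[OF y]
    by (simp add: bracket_def fun_apply)
  moreover have "g p (D p y (?E z)) (D p x (?E z)) = g p (D p x (?E z)) (D p y (?E z))"
    by (rule g_sym[OF conn_tangent[OF Z y] conn_tangent[OF Z x]])
  ultimately have "g p (D p x (\<lambda>q. D q (?E y q) (?E z))) z - g p (D p y (\<lambda>q. D q (?E x q) (?E z))) z = 0"
    unfolding 2[OF x y] 2[OF y x] by simp
  then show ?thesis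
    using curvature_commuting[OF E(1)[of x] E(1)[of y] Z B] E(2) x y z
      g_diff(1)[OF conn_tangent[OF conn_field[OF Z E(1)[of y]] x] conn_tangent[OF conn_field[OF Z E(1)[of x]] y] z]
    by simp
qed

lemma curvature4_anti34:
  assumes x: "x \<in> tangent_space A p" and y: "y \<in> tangent_space A p" and z: "z \<in> tangent_space A p" and u: "u \<in> tangent_space A p"
  shows "curvature4 A g D p x y u z = - curvature4 A g D p x y z u"
  using curvature_metric[OF x y tangent_add[OF z u]] curvature_metric[OF x y z] curvature_metric[OF x y u]
    curvature_add3[OF x y z u] curvature_tangent[OF x y z] curvature_tangent[OF x y u] z u
  by (simp add: curvature4_def g_add_left g_add_right tangent_add)

end

section \<open>The curvature tensor of the ambient manifold\<close>

locale kaehler_norden_manifold =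
  fixes A :: "('m::topological_space, 'e::euclidean_space) atlas" and J g D
  assumes kaehler: "kaehler_norden A J g D"
begin

sublocale levi_civita_manifold A g D
  by unfold_locales (use kaehler in \<open>auto simp: kaehler_norden_def\<close>)

lemma norden_space: "norden_space (tangent_space A p) (g p) (J p)"
  by (intro norden_space.intro scalar_product norden_space_axioms.intro)
    (use kaehler in \<open>auto simp: kaehler_norden_def\<close>)

lemma J_field: "field_near A p Y \<Longrightarrow> field_near A p (\<lambda>q. J q (Y q))"
  and J_parallel: "field_near A p Y \<Longrightarrow> x \<in> tangent_space A p \<Longrightarrow> D p x (\<lambda>q. J q (Y q)) = J p (D p x Y)"
  using kaehler unfolding kaehler_norden_def by auto

lemmas J_tangent = norden_space.J_V[OF norden_space]
  and J_J = norden_space.J_J[OF norden_space]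
  and J_add = norden_space.J_add[OF norden_space]
  and J_scale = norden_space.J_scale[OF norden_space]
  and J_minus = norden_space.J_minus[OF norden_space]
  and g_J_left = norden_space.g_J_left[OF norden_space]
  and g_J_J = norden_space.g_J_J[OF norden_space]
  and g_J_sym = norden_space.g_J_sym[OF norden_space]

lemma J_diff: "x \<in> tangent_space A p \<Longrightarrow> y \<in> tangent_space A p \<Longrightarrow> J p (x - y) = J p x - J p y"
  using J_add[of x p "- y"] by (simp add: J_minus tangent_minus)

lemma curvature_J:
  assumes x: "x \<in> tangent_space A p" and y: "y \<in> tangent_space A p" and z: "z \<in> tangent_space A p"
  shows "curvature A D p x y (J p z) = J p (curvature A D p x y z)"
proof -
  let ?E = "extension p"
  note E = extension_field[of p] extension_at[of _ p] extension_bracket_near[of p]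
  note B = extension_bracket[of p]
  note Z = E(1)[of z]
  have 2: "D p x (\<lambda>q. D q (?E y q) (\<lambda>q. J q (?E z q))) = J p (D p x (\<lambda>q. D q (?E y q) (?E z)))"
    if x: "x \<in> tangent_space A p" and y: "y \<in> tangent_space A p" for x y
  proof -
    note DZ = conn_field[OF Z E(1)[of y]]
    have "\<forall>\<^sub>F q in nhds p. D q (?E y q) (\<lambda>q. J q (?E z q)) = J q (D q (?E y q) (?E z))"
      using field_near_eventually[OF Z] field_near_eventually[OF E(1)[of y]]
      by eventually_elim (rule J_parallel[OF _ field_near_at(1)])
    then have "D p x (\<lambda>q. D q (?E y q) (\<lambda>q. J q (?E z q))) = D p x (\<lambda>q. J q (D q (?E y q) (?E z)))"
      by (rule conn_cong[OF conn_field[OF J_field[OF Z] E(1)[of y]] J_field[OF DZ] x])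
    then show ?thesis using J_parallel[OF DZ x] by simp
  qed
  show ?thesis
    using curvature_commuting[OF E(1)[of x] E(1)[of y] Z B] curvature_commuting[OF E(1)[of x] E(1)[of y] J_field[OF Z] B]
      2[OF x y] 2[OF y x] E(2)[OF x] E(2)[OF y] E(2)[OF z]
      J_diff[OF conn_tangent[OF conn_field[OF Z E(1)[of y]] x] conn_tangent[OF conn_field[OF Z E(1)[of x]] y]]
    by simp
qed

text \<open>The difference \<open>T\<close> from the expected tensor is
  \<open>curvature_like\<close>. On an orthonormal pair the expected tensor takes the values
  \<open>\<nu> p\<close> and \<open>\<nu>t p\<close>, exactly those prescribed for the totally real
  section it spans, so \<open>T_zero\<close> applies.\<close>

lemma constant_curvature_tensor:
  assumes const: "constant_totally_real_curvatures A J g D \<nu> \<nu>t" and dim: "DIM('e) \<ge> 3"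
    and "x \<in> tangent_space A p" "y \<in> tangent_space A p" "z \<in> tangent_space A p" "u \<in> tangent_space A p"
  shows "curvature4 A g D p x y z u =
    \<nu> p * (pi1 (g p) x y z u - pi2 (g p) (J p) x y z u) + \<nu>t p * pi3 (g p) (J p) x y z u"
proof -
  let ?V = "tangent_space A p"
  interpret ns: norden_space ?V "g p" "J p" by (rule norden_space)
  define K where "K x y z u =
    \<nu> p * (pi1 (g p) x y z u - pi2 (g p) (J p) x y z u) + \<nu>t p * pi3 (g p) (J p) x y z u" for x y z u
  note K_defs = K_def pi1_def pi2_def pi3_def
  define T where "T x y z u = curvature4 A g D p x y z u - K x y z u" for x y z u
  interpret curvature_like ?V "g p" "J p" T
  proof
    fix x x' y z u r
    assume mem: "x \<in> ?V" "y \<in> ?V" "z \<in> ?V" "u \<in> ?V"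
    show "T (x + x') y z u = T x y z u + T x' y z u" if "x' \<in> ?V"
      using mem that by (simp add: T_def K_defs curvature4_def curvature_add1 curvature_tangent algebra_simps)
    show "T (r *\<^sub>R x) y z u = r * T x y z u"
      using mem by (simp add: T_def K_defs curvature4_def curvature_scale1 curvature_tangent algebra_simps)
    show "T y x z u = - T x y z u"
      using mem by (simp add: T_def K_defs curvature4_def curvature_anti12[of x p y z] curvature_tangent algebra_simps)
    show "T x y u z = - T x y z u"
      using mem curvature4_anti34[of x p y z u]
      by (simp add: T_def K_defs algebra_simps)
    have "curvature4 A g D p x y z u + curvature4 A g D p y z x u + curvature4 A g D p z x y u = g p 0 u"
      using mem curvature_bianchi[of x p y z]
      by (simp only: curvature4_def g_add_left[symmetric] curvature_tangent tangent_add)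
    then show "T x y z u + T y z x u + T z x y u = 0"
      using mem ns.g_sym[of y x] ns.g_sym[of z x] ns.g_sym[of z y] ns.g_J_sym[of y x] ns.g_J_sym[of z x] ns.g_J_sym[of z y]
      by (simp add: T_def K_defs algebra_simps)
    show "T x y (J p z) u = T x y z (J p u)"
      using mem by (simp add: T_def K_defs curvature4_def curvature_J curvature_tangent algebra_simps)
  qed
  have "T a b b a = 0 \<and> T a b b (J p a) = 0" if "ns.orthonormal_pair a b" for a b
  proof -
    have ab: "a \<in> ?V" "b \<in> ?V" "g p a a = 1" "g p b b = 1" "g p a b = 0"
        "g p a (J p a) = 0" "g p b (J p b) = 0" "g p a (J p b) = 0"
      using that by (auto simp: ns.orthonormal_pair_def ns.gC_def complex_eq_iff)
    then have ba: "g p b a = 0" "g p b (J p a) = 0" using ns.g_sym[of a b] ns.g_J_sym[of a b] by auto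
    have "a \<noteq> b" using ab by auto
    moreover have "a \<notin> span {b}"
      using ab by (auto simp: span_singleton)
    moreover have "b \<noteq> 0" using ab by auto
    ultimately have "basis_of [a, b] (span {a, b})"
      by (simp add: basis_of_def independent_insert)
    moreover have "span {a, b} \<subseteq> ?V" by (rule span_minimal) (use ab ns.V in auto)
    moreover have "orthogonal_sets (g p) (J p ` span {a, b}) (span {a, b})"
      unfolding orthogonal_sets_def
    proof (clarify)
      fix v w assume "v \<in> span {a, b}" "w \<in> span {a, b}"
      then obtain r s k l where "v = r *\<^sub>R a + s *\<^sub>R b" "w = k *\<^sub>R a + l *\<^sub>R b"
        by (auto simp: span_insert span_singleton algebra_simps)
      then show "g p (J p v) w = 0" using ab ba by simp
    qed
    moreover have pi1: "pi1 (g p) a b b a = 1" using ab ba by (simp add: pi1_def)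
    ultimately have "curvature4 A g D p a b b a = \<nu> p" "curvature4 A g D p a b b (J p a) = \<nu>t p"
      using const unfolding constant_totally_real_curvatures_def by (metis div_by_1 zero_neq_one)+
    then show ?thesis using ab ba by (simp add: T_def K_defs)
  qed
  \<comment> \<open>A complex line has real dimension at most 2; this is where the bound on the
    dimension enters.\<close>
  moreover have "\<not> (\<exists>x. ?V \<subseteq> span {x, J p x})"
  proof
    assume "\<exists>x. ?V \<subseteq> span {x, J p x}"
    then obtain x where "?V \<subseteq> span {x, J p x}" by blast
    then have "DIM('e) \<le> card {x, J p x}" by (intro spanning_tangent_card[of _ p]) auto
    moreover have "card {x, J p x} \<le> 2" by (simp add: card_insert_if)
    ultimately show False using dim by simp
  qed
  ultimately have "T x y z u = 0" using assms(3-) by (intro T_zero)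
  then show ?thesis by (simp add: T_def K_def)
qed

end

section \<open>Real time-like hypersurfaces\<close>

context smooth_manifold
begin

text \<open>By Gaussian elimination.\<close>

lemma smooth_solution:
  assumes "finite I" and "\<And>j i. j \<in> K \<Longrightarrow> i \<in> I \<Longrightarrow> smooth_near A p (a j i)"
    and "\<And>j. j \<in> K \<Longrightarrow> smooth_near A p (\<lambda>q. \<Sum>i\<in>I. a j i q * x i q)"
    and "\<And>y. (\<And>j. j \<in> K \<Longrightarrow> (\<Sum>i\<in>I. a j i p * y i) = 0) \<Longrightarrow> \<forall>i\<in>I. y i = 0"
  shows "\<forall>i\<in>I. smooth_near A p (x i)"
  using assms
proof (induction I arbitrary: a rule: finite_induct)
  case (insert k I)
  \<comment> \<open>A pivot exists, since otherwise the unit vector at \<open>k\<close> would lie in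
    the kernel at \<open>p\<close>.\<close>
  obtain l where l: "l \<in> K" "a l k p \<noteq> 0"
  proof (rule ccontr)
    assume "\<not> thesis"
    then have "\<And>j. j \<in> K \<Longrightarrow> a j k p = 0" using that by blast
    then have "(\<Sum>i\<in>insert k I. a j i p * (if i = k then 1 else 0)) = 0" if "j \<in> K" for j
      using that by (intro sum.neutral) auto
    from insert.prems(3)[OF this] show False by force
  qed
  have sm: "smooth_near A p (a j i)" if "j \<in> K" "i \<in> insert k I" for j i
    using insert.prems(1) that by blast
  define c where "c = (\<lambda>q. inverse (a l k q))"
  have c: "smooth_near A p c" unfolding c_def by (rule smooth_near_inverse[OF sm l(2)]) (use l in auto)
  have nz: "\<forall>\<^sub>F q in nhds p. a l k q \<noteq> 0"
    using smooth_near_eventually_in[of p "a l k" "- {0}"] sm l by (simp add: open_Compl)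
  \<comment> \<open>Subtracting a multiple of the pivot row removes the unknown \<open>k\<close>
    from every equation.\<close>
  define a' where "a' j i = (\<lambda>q. a j i q - a j k q * c q * a l i q)" for j i
  have "\<forall>i\<in>I. smooth_near A p (x i)"
  proof (rule insert.IH)
    show "smooth_near A p (a' j i)" if "j \<in> K" "i \<in> I" for j i
      unfolding a'_def using that l(1) by (intro smooth_near_diff smooth_near_mult sm c) auto
    show "smooth_near A p (\<lambda>q. \<Sum>i\<in>I. a' j i q * x i q)" if j: "j \<in> K" for j
    proof (rule smooth_near_cong)
      show "smooth_near A p (\<lambda>q. (\<Sum>i\<in>insert k I. a j i q * x i q)
          - a j k q * c q * (\<Sum>i\<in>insert k I. a l i q * x i q))"
        using j l(1) by (intro smooth_near_diff smooth_near_mult insert.prems(2) sm c) auto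
      show "\<forall>\<^sub>F q in nhds p. (\<Sum>i\<in>insert k I. a j i q * x i q)
          - a j k q * c q * (\<Sum>i\<in>insert k I. a l i q * x i q) = (\<Sum>i\<in>I. a' j i q * x i q)"
        using nz
      proof eventually_elim
        case (elim q)
        have "(\<Sum>i\<in>I. a' j i q * x i q) = (\<Sum>i\<in>I. a j i q * x i q) - a j k q * c q * (\<Sum>i\<in>I. a l i q * x i q)"
          by (simp add: a'_def left_diff_distrib sum_subtractf sum_distrib_left mult.assoc)
        then show ?case using insert.hyps elim by (simp add: c_def field_simps)
      qed
    qed
    show "\<forall>i\<in>I. y i = 0" if y: "\<And>j. j \<in> K \<Longrightarrow> (\<Sum>i\<in>I. a' j i p * y i) = 0" for y
    proof -
      \<comment> \<open>A kernel vector of the reduced matrix lifts by solving the pivot equation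
        for its entry at \<open>k\<close>; so injectivity is inherited.\<close>
      define y' where "y' = y(k := - c p * (\<Sum>i\<in>I. a l i p * y i))"
      have eq: "(\<Sum>i\<in>I. b i * y' i) = (\<Sum>i\<in>I. b i * y i)" for b :: "_ \<Rightarrow> real"
        using insert.hyps by (intro sum.cong) (auto simp: y'_def)
      have "(\<Sum>i\<in>insert k I. a j i p * y' i) = 0" if "j \<in> K" for j
      proof -
        have "(\<Sum>i\<in>I. a' j i p * y i) = (\<Sum>i\<in>I. a j i p * y i) - a j k p * c p * (\<Sum>i\<in>I. a l i p * y i)"
          by (simp add: a'_def left_diff_distrib sum_subtractf sum_distrib_left mult.assoc)
        then show ?thesis
          using y[OF that] insert.hyps unfolding sum.insert[OF insert.hyps] eq by (simp add: y'_def)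
      qed
      from insert.prems(3)[OF this] show ?thesis using insert.hyps by (auto simp: y'_def split: if_splits)
    qed
  qed
  moreover have "smooth_near A p (x k)"
  proof (rule smooth_near_cong)
    show "smooth_near A p (\<lambda>q. c q * ((\<Sum>i\<in>insert k I. a l i q * x i q) - (\<Sum>i\<in>I. a l i q * x i q)))"
      using calculation l(1)
      by (intro smooth_near_mult smooth_near_diff smooth_near_sum insert.prems(2) c sm) auto
    show "\<forall>\<^sub>F q in nhds p. c q * ((\<Sum>i\<in>insert k I. a l i q * x i q) - (\<Sum>i\<in>I. a l i q * x i q)) = x k q"
      using nz by (rule eventually_mono) (use insert.hyps in \<open>simp add: c_def\<close>)
  qed
  ultimately show ?case by blast
qed auto

end

locale framed_kaehler_map = framed_map A D A' D' \<iota> U c + amb: kaehler_norden_manifold A' J g' D'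
  for A :: "('h::topological_space, 'f::euclidean_space) atlas"
    and D :: "'h \<Rightarrow> 'h tvec \<Rightarrow> ('h \<Rightarrow> 'h tvec) \<Rightarrow> 'h tvec"
    and A' :: "('m::topological_space, 'e::euclidean_space) atlas"
    and J :: "'m \<Rightarrow> 'm tvec \<Rightarrow> 'm tvec"
    and g' :: "'m \<Rightarrow> 'm tvec \<Rightarrow> 'm tvec \<Rightarrow> real"
    and D' :: "'m \<Rightarrow> 'm tvec \<Rightarrow> ('m \<Rightarrow> 'm tvec) \<Rightarrow> 'm tvec"
    and \<iota> :: "'h \<Rightarrow> 'm" and U :: "'m set" and c :: "'m \<Rightarrow> 'e"
begin

text \<open>Smoothness of the product is bundled with the product rule because the inductive steps
  differentiate sums and multiples of such products.\<close>

definition compat :: "'h \<Rightarrow> ('h \<Rightarrow> 'm tvec) \<Rightarrow> ('h \<Rightarrow> 'm tvec) \<Rightarrow> bool" where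
  "compat p V W \<longleftrightarrow> smooth_near A p (\<lambda>q. g' (\<iota> q) (V q) (W q)) \<and> (\<forall>v\<in>tangent_space A p.
    v (\<lambda>q. g' (\<iota> q) (V q) (W q)) = g' (\<iota> p) (nab p v V) (W p) + g' (\<iota> p) (V p) (nab p v W))"

lemma compat_deriv: "compat p V W \<Longrightarrow> v \<in> tangent_space A p \<Longrightarrow>
    v (\<lambda>q. g' (\<iota> q) (V q) (W q)) = g' (\<iota> p) (nab p v V) (W p) + g' (\<iota> p) (V p) (nab p v W)"
  by (simp add: compat_def)

lemma compat_cong:
  assumes "\<forall>\<^sub>F q in nhds p. V q = V' q" "\<forall>\<^sub>F q in nhds p. W q = W' q" "compat p V W"
  shows "compat p V' W'"
proof -
  have ev: "\<forall>\<^sub>F q in nhds p. g' (\<iota> q) (V q) (W q) = g' (\<iota> q) (V' q) (W' q)"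
    using assms(1,2) by eventually_elim simp
  have "V p = V' p" "W p = W' p" using assms(1,2) eventually_nhds_x_imp_x by blast+
  then show ?thesis
    using assms(3) dom.smooth_near_cong[OF ev] dom.deriv_cong[OF _ ev, symmetric] nab_cong[OF _ assms(1)] nab_cong[OF _ assms(2)]
    by (simp add: compat_def)
qed

lemma compat_sym:
  assumes p: "\<iota> p \<in> U" and V: "sect p V" and W: "sect p W" and "compat p V W" shows "compat p W V"
proof -
  have ev: "\<forall>\<^sub>F q in nhds p. g' (\<iota> q) (V q) (W q) = g' (\<iota> q) (W q) (V q)"
    using section_near_eventually[OF V] section_near_eventually[OF W]
    by eventually_elim (rule amb.g_sym[OF section_near_at(1) section_near_at(1)])
  show ?thesis
    unfolding compat_def
  proof (intro conjI ballI)
    show "smooth_near A p (\<lambda>q. g' (\<iota> q) (W q) (V q))"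
      using assms(4) dom.smooth_near_cong[OF ev] by (simp add: compat_def)
    fix v assume v: "v \<in> tangent_space A p"
    show "v (\<lambda>q. g' (\<iota> q) (W q) (V q)) = g' (\<iota> p) (nab p v W) (V p) + g' (\<iota> p) (W p) (nab p v V)"
      using compat_deriv[OF assms(4) v] dom.deriv_cong[OF v ev] amb.g_sym[OF nab_tangent[OF p v] section_near_at(1)[OF W], of V]
        amb.g_sym[OF section_near_at(1)[OF V] nab_tangent[OF p v], of W]
      by simp
  qed
qed

lemma compat_add_left:
  assumes p: "\<iota> p \<in> U" and V: "sect p V" and V': "sect p V'" and W: "sect p W"
    and "compat p V W" "compat p V' W"
  shows "compat p (\<lambda>q. V q + V' q) W"
proof -
  have ev: "\<forall>\<^sub>F q in nhds p. g' (\<iota> q) (V q) (W q) + g' (\<iota> q) (V' q) (W q) = g' (\<iota> q) (V q + V' q) (W q)"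
    using section_near_eventually[OF V] section_near_eventually[OF V'] section_near_eventually[OF W]
    by eventually_elim (simp add: amb.g_add_left section_near_at(1))
  note t = section_near_at(1)[OF V] section_near_at(1)[OF V'] section_near_at(1)[OF W] nab_tangent[OF p]
  have s: "smooth_near A p (\<lambda>q. g' (\<iota> q) (V q) (W q))" "smooth_near A p (\<lambda>q. g' (\<iota> q) (V' q) (W q))"
    using assms(5,6) by (auto simp: compat_def)
  show ?thesis
    unfolding compat_def
  proof (intro conjI ballI)
    show "smooth_near A p (\<lambda>q. g' (\<iota> q) (V q + V' q) (W q))"
      by (rule dom.smooth_near_cong[OF ev dom.smooth_near_add[OF s]])
    fix v assume v: "v \<in> tangent_space A p"
    have "v (\<lambda>q. g' (\<iota> q) (V q + V' q) (W q)) = v (\<lambda>q. g' (\<iota> q) (V q) (W q)) + v (\<lambda>q. g' (\<iota> q) (V' q) (W q))"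
      using dom.deriv_cong[OF v ev] dom.deriv_add[OF v s] by simp
    then show "v (\<lambda>q. g' (\<iota> q) (V q + V' q) (W q)) =
        g' (\<iota> p) (nab p v (\<lambda>q. V q + V' q)) (W p) + g' (\<iota> p) (V p + V' p) (nab p v W)"
      using compat_deriv[OF assms(5) v] compat_deriv[OF assms(6) v] v t
      by (simp add: nab_add[OF p v V V'] amb.g_add_left)
  qed
qed

lemma compat_mult_left:
  assumes p: "\<iota> p \<in> U" and V: "sect p V" and W: "sect p W" and f: "smooth_near A p f" and "compat p V W"
  shows "compat p (\<lambda>q. f q *\<^sub>R V q) W"
proof -
  have ev: "\<forall>\<^sub>F q in nhds p. f q * g' (\<iota> q) (V q) (W q) = g' (\<iota> q) (f q *\<^sub>R V q) (W q)"
    using section_near_eventually[OF V] section_near_eventually[OF W]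
    by eventually_elim (simp add: amb.g_scale_left section_near_at(1))
  note t = section_near_at(1)[OF V] section_near_at(1)[OF W] nab_tangent[OF p]
  have s: "smooth_near A p (\<lambda>q. g' (\<iota> q) (V q) (W q))"
    using assms(5) by (auto simp: compat_def)
  show ?thesis
    unfolding compat_def
  proof (intro conjI ballI)
    show "smooth_near A p (\<lambda>q. g' (\<iota> q) (f q *\<^sub>R V q) (W q))"
      by (rule dom.smooth_near_cong[OF ev dom.smooth_near_mult[OF f s]])
    fix v assume v: "v \<in> tangent_space A p"
    have "v (\<lambda>q. g' (\<iota> q) (f q *\<^sub>R V q) (W q)) = v f * g' (\<iota> p) (V p) (W p) + f p * v (\<lambda>q. g' (\<iota> q) (V q) (W q))"
      using dom.deriv_cong[OF v ev] dom.deriv_mult[OF v f s] by simp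
    then show "v (\<lambda>q. g' (\<iota> q) (f q *\<^sub>R V q) (W q)) =
        g' (\<iota> p) (nab p v (\<lambda>q. f q *\<^sub>R V q)) (W p) + g' (\<iota> p) (f p *\<^sub>R V p) (nab p v W)"
      using compat_deriv[OF assms(5) v] v t
      by (simp add: nab_mult[OF p v V f] amb.g_add_left amb.g_scale_left cod.tangent_scale distrib_left)
  qed
qed

lemma compat_frame:
  assumes p: "\<iota> p \<in> U" shows "compat p (\<lambda>q. fr b (\<iota> q)) (\<lambda>q. fr b' (\<iota> q))"
proof -
  note f = frame_field[OF p, of b] frame_field[OF p, of b']
  have s: "smooth_near A' (\<iota> p) (\<lambda>m. g' m (fr b m) (fr b' m))" by (rule amb.metric_smooth[OF f])
  show ?thesis
    unfolding compat_def
  proof (intro conjI ballI)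
    show "smooth_near A p (\<lambda>q. g' (\<iota> q) (fr b (\<iota> q)) (fr b' (\<iota> q)))" by (rule smooth_near_map[OF s])
    fix v assume v: "v \<in> tangent_space A p"
    show "v (\<lambda>q. g' (\<iota> q) (fr b (\<iota> q)) (fr b' (\<iota> q))) = g' (\<iota> p) (nab p v (\<lambda>q. fr b (\<iota> q))) (fr b' (\<iota> p))
        + g' (\<iota> p) (fr b (\<iota> p)) (nab p v (\<lambda>q. fr b' (\<iota> q)))"
      using amb.metric_compatible[OF f push_tangent[OF v]] push_apply[OF s] nab_map[OF v p f(1)] nab_map[OF v p f(2)]
      by simp
  qed
qed

text \<open>Section induction in each argument separately, with \<open>compat_sym\<close> exchanging
  them, reduces the claim to two frame fields, where it is ambient metric compatibility.\<close>

lemma nab_compat: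
  assumes p: "\<iota> p \<in> U" and V: "sect p V" and W: "sect p W" shows "compat p V W"
proof -
  have *: "compat p V (\<lambda>q. fr b (\<iota> q))" for b
    using V p
  proof (induction rule: sect_induct)
    case (cong V W)
    then show ?case using compat_cong[OF cong(3) _ cong(4)] by simp
  next
    case (frame f b')
    then show ?case by (intro compat_mult_left p sect_frame compat_frame)
  next
    case (add V W)
    then show ?case by (intro compat_add_left p sect_frame)
  qed
  show ?thesis
    using W p
  proof (induction rule: sect_induct)
    case (cong V' W)
    then show ?case using compat_cong[OF _ cong(3) cong(4)] by simp
  next
    case (frame f b')
    have "compat p (\<lambda>q. f q *\<^sub>R fr b' (\<iota> q)) V"
      by (rule compat_mult_left[OF p sect_frame[OF p] V frame(1) compat_sym[OF p V sect_frame[OF p] *]])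
    then show ?case by (rule compat_sym[OF p sect_mult[OF sect_frame[OF p] frame(1)] V])
  next
    case (add W W')
    have "compat p (\<lambda>q. W q + W' q) V"
      by (rule compat_add_left[OF p add(1,2) V compat_sym[OF p V add(1,3)] compat_sym[OF p V add(2,4)]])
    then show ?case by (rule compat_sym[OF p sect_add[OF add(1,2)] V])
  qed
qed

lemma metric_sect_smooth: "\<iota> p \<in> U \<Longrightarrow> sect p V \<Longrightarrow> sect p W \<Longrightarrow> smooth_near A p (\<lambda>q. g' (\<iota> q) (V q) (W q))"
  and nab_metric: "\<iota> p \<in> U \<Longrightarrow> sect p V \<Longrightarrow> sect p W \<Longrightarrow> v \<in> tangent_space A p \<Longrightarrow>
    v (\<lambda>q. g' (\<iota> q) (V q) (W q)) = g' (\<iota> p) (nab p v V) (W p) + g' (\<iota> p) (V p) (nab p v W)"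
  using nab_compat unfolding compat_def by blast+

text \<open>On frame fields this is the ambient parallelism of \<open>J\<close>; pointwise linearity
  of \<open>J\<close> carries it through multiples and sums.\<close>

lemma nab_J:
  assumes p: "\<iota> p \<in> U" and V: "sect p V"
  shows "sect p (\<lambda>q. J (\<iota> q) (V q)) \<and> (\<forall>v\<in>tangent_space A p. nab p v (\<lambda>q. J (\<iota> q) (V q)) = J (\<iota> p) (nab p v V))"
  using V p
proof (induction rule: sect_induct)
  case (cong V W)
  have ev: "\<forall>\<^sub>F q in nhds p. J (\<iota> q) (V q) = J (\<iota> q) (W q)" using cong(3) by (rule eventually_mono) simp
  show ?case
    using cong sect_cong[OF ev] nab_cong[OF _ ev] nab_cong[OF _ cong(3)] by simp
next
  case (frame f b)
  note fb = frame_field[OF p, of b]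
  have ev: "\<forall>\<^sub>F q in nhds p. f q *\<^sub>R J (\<iota> q) (fr b (\<iota> q)) = J (\<iota> q) (f q *\<^sub>R fr b (\<iota> q))"
    using eventually_chart[OF p] by (rule eventually_mono) (simp add: amb.J_scale cod.coord_vec_tangent[OF chart])
  have s: "sect p (\<lambda>q. J (\<iota> q) (fr b (\<iota> q)))" using sect_map[OF amb.J_field[OF fb]] .
  show ?case
  proof (intro conjI ballI)
    show "sect p (\<lambda>q. J (\<iota> q) (f q *\<^sub>R fr b (\<iota> q)))" by (rule sect_cong[OF ev sect_mult[OF s frame(1)]])
    fix v assume v: "v \<in> tangent_space A p"
    have "nab p v (\<lambda>q. J (\<iota> q) (fr b (\<iota> q))) = J (\<iota> p) (nab p v (\<lambda>q. fr b (\<iota> q)))"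
      using nab_map[OF v p amb.J_field[OF fb]] nab_map[OF v p fb] amb.J_parallel[OF fb push_tangent[OF v]] by simp
    then show "nab p v (\<lambda>q. J (\<iota> q) (f q *\<^sub>R fr b (\<iota> q))) = J (\<iota> p) (nab p v (\<lambda>q. f q *\<^sub>R fr b (\<iota> q)))"
      using nab_cong[OF v ev] nab_mult[OF p v s frame(1)] nab_mult[OF p v sect_frame[OF p] frame(1)]
        nab_tangent[OF p v] cod.coord_vec_tangent[OF chart p]
      by (simp add: amb.J_add amb.J_scale cod.tangent_scale)
  qed
next
  case (add V W)
  have ev: "\<forall>\<^sub>F q in nhds p. J (\<iota> q) (V q) + J (\<iota> q) (W q) = J (\<iota> q) (V q + W q)"
    using section_near_eventually[OF add(1)] section_near_eventually[OF add(2)]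
    by eventually_elim (simp add: amb.J_add section_near_at(1))
  have s: "sect p (\<lambda>q. J (\<iota> q) (V q))" "sect p (\<lambda>q. J (\<iota> q) (W q))" using add by auto
  show ?case
    using sect_cong[OF ev sect_add[OF s]] nab_cong[OF _ ev] nab_add[OF p _ s] nab_add[OF p _ add(1,2)] add(3,4)
      amb.J_add[OF nab_tangent[OF p] nab_tangent[OF p]] by simp
qed

lemmas sect_J = conjunct1[OF nab_J]
  and nab_J_eq = bspec[OF conjunct2[OF nab_J]]

end

section \<open>Tangential and normal parts along the hypersurface\<close>

locale hypersurface = framed_kaehler_map A D A' J g' D' \<iota> U c
  for A :: "('h::topological_space, 'f::euclidean_space) atlas"
    and D :: "'h \<Rightarrow> 'h tvec \<Rightarrow> ('h \<Rightarrow> 'h tvec) \<Rightarrow> 'h tvec"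
    and A' :: "('m::topological_space, 'e::euclidean_space) atlas"
    and J :: "'m \<Rightarrow> 'm tvec \<Rightarrow> 'm tvec"
    and g' :: "'m \<Rightarrow> 'm tvec \<Rightarrow> 'm tvec \<Rightarrow> real"
    and D' :: "'m \<Rightarrow> 'm tvec \<Rightarrow> ('m \<Rightarrow> 'm tvec) \<Rightarrow> 'm tvec"
    and \<iota> :: "'h \<Rightarrow> 'm" and U :: "'m set" and c :: "'m \<Rightarrow> 'e" +
  fixes N :: "'h \<Rightarrow> 'm tvec" and g :: "'h \<Rightarrow> 'h tvec \<Rightarrow> 'h tvec \<Rightarrow> real"
  assumes hyper: "timelike_hypersurface A A' g' \<iota> N"
    and g: "g = induced_metric A' g' \<iota>"
    and lc: "levi_civita A g D"
begin

lemma g_eq: "g p x y = g' (\<iota> p) (push p x) (push p y)"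
  by (simp add: g induced_metric_def)

lemma dims: "DIM('e) = DIM('f) + 1"
  and push_inj: "inj_on (push p) (tangent_space A p)"
  and N_tangent: "N p \<in> tangent_space A' (\<iota> p)"
  and N_N: "g' (\<iota> p) (N p) (N p) = - 1"
  and push_N: "x \<in> tangent_space A p \<Longrightarrow> g' (\<iota> p) (push p x) (N p) = 0"
  and N_smooth: "smooth_near A' (\<iota> p) f \<Longrightarrow> smooth_near A p (\<lambda>q. N q f)"
  using hyper unfolding timelike_hypersurface_def by auto

lemma N_push: "x \<in> tangent_space A p \<Longrightarrow> g' (\<iota> p) (N p) (push p x) = 0"
  using push_N amb.g_sym[OF N_tangent push_tangent] by simp

lemma N_sect: "sect p N"
  unfolding section_near_def using N_tangent N_smooth by simp

lemma linear_push: "linear (push p)"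
  by (intro linearI push_add push_scale)

text \<open>In codimension one the pushed coordinate basis together with \<open>N\<close> is an
  independent set of full cardinality, so it spans. Orthogonality to \<open>N\<close> then kills the
  coefficient of \<open>N\<close>.\<close>

lemma normal_complement:
  assumes w: "w \<in> tangent_space A' (\<iota> p)" and wN: "g' (\<iota> p) w (N p) = 0"
  obtains x where "x \<in> tangent_space A p" "push p x = w"
proof -
  interpret sp: scalar_product "tangent_space A' (\<iota> p)" "g' (\<iota> p)" by (rule amb.scalar_product)
  obtain W d where W: "(W, d) \<in> A" "p \<in> W" by (rule dom.chart_at)
  let ?B = "coord_vec A W d p ` Basis"
  note B = dom.coord_vec_basis[OF W]
  have span: "span (push p ` ?B) = push p ` tangent_space A p"
    unfolding linear_span_image[OF linear_push] B(3) ..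
  have "independent (push p ` ?B)"
    by (rule linear_independent_injective_image[OF linear_push B(1)]) (unfold B(3), rule push_inj)
  moreover have "card (push p ` ?B) = DIM('f)"
    using card_image[of "push p" ?B] inj_on_subset[OF push_inj, of ?B p] dom.coord_vec_tangent[OF W] B(2) by auto
  moreover have N: "N p \<notin> span (push p ` ?B)"
  proof
    assume "N p \<in> span (push p ` ?B)"
    then obtain x where "x \<in> tangent_space A p" "N p = push p x" unfolding span by auto
    then show False using push_N[of x p] N_N[of p] by simp
  qed
  ultimately have ind: "independent (insert (N p) (push p ` ?B))" and "card (insert (N p) (push p ` ?B)) = DIM('e)"
    using dims span_base[of "N p" "push p ` ?B"] by (auto simp: independent_insert card_insert_if)
  have "w \<in> span (insert (N p) (push p ` ?B))"
  proof (rule ccontr)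
    assume *: "w \<notin> span (insert (N p) (push p ` ?B))"
    then have "independent (insert w (insert (N p) (push p ` ?B)))"
      by (subst independent_insert) (use ind in auto)
    moreover have "insert w (insert (N p) (push p ` ?B)) \<subseteq> tangent_space A' (\<iota> p)"
      using w N_tangent push_tangent dom.coord_vec_tangent[OF W] by auto
    ultimately have "card (insert w (insert (N p) (push p ` ?B))) \<le> DIM('e)"
      by (rule conjunct2[OF cod.independent_tangent_card])
    moreover have "w \<notin> insert (N p) (push p ` ?B)" using * by (rule contrapos_nn) (rule span_base)
    ultimately show False using \<open>card (insert (N p) (push p ` ?B)) = DIM('e)\<close> by simp
  qed
  then obtain k where "w - k *\<^sub>R N p \<in> push p ` tangent_space A p"
    unfolding span_insert span by auto
  then obtain x where x: "x \<in> tangent_space A p" "push p x = w - k *\<^sub>R N p" by auto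
  then have "g' (\<iota> p) (w - k *\<^sub>R N p) (N p) = 0" using push_N[OF x(1)] by simp
  then have "k = 0" using w wN N_tangent N_N by simp
  then show ?thesis using that x by simp
qed

abbreviation "pull \<equiv> tangential_preimage A A' \<iota>"

lemma pull:
  assumes "w \<in> tangent_space A' (\<iota> p)" "g' (\<iota> p) w (N p) = 0"
  shows "pull p w \<in> tangent_space A p" "push p (pull p w) = w"
proof -
  obtain x where x: "x \<in> tangent_space A p" "push p x = w" using normal_complement[OF assms] .
  then have "\<exists>!x. x \<in> tangent_space A p \<and> push p x = w"
    using push_inj[of p] by (auto dest: inj_onD)
  from theI'[OF this] show "pull p w \<in> tangent_space A p" "push p (pull p w) = w"
    unfolding tangential_preimage_def by auto
qed

lemma push_eq_zero: "x \<in> tangent_space A p \<Longrightarrow> push p x = 0 \<Longrightarrow> x = 0"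
  using inj_onD[OF push_inj _ _ dom.tangent_zero, of p x] push_scale[of p 0 x] by simp

lemma normal_tangent_eqI:
  assumes v: "v \<in> tangent_space A' (\<iota> p)" and w: "w \<in> tangent_space A' (\<iota> p)"
    and "\<And>x. x \<in> tangent_space A p \<Longrightarrow> g' (\<iota> p) v (push p x) = g' (\<iota> p) w (push p x)"
    and N: "g' (\<iota> p) v (N p) = g' (\<iota> p) w (N p)"
  shows "v = w"
proof (rule amb.g_eqI[OF v w])
  interpret sp: scalar_product "tangent_space A' (\<iota> p)" "g' (\<iota> p)" by (rule amb.scalar_product)
  fix z assume z: "z \<in> tangent_space A' (\<iota> p)"
  \<comment> \<open>The plus sign is due to \<open>g'(N, N) = -1\<close>: this is the tangential
    part of \<open>z\<close>.\<close>
  let ?z = "z + g' (\<iota> p) z (N p) *\<^sub>R N p"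
  have "g' (\<iota> p) ?z (N p) = 0" using z N_tangent N_N by simp
  then obtain x where x: "x \<in> tangent_space A p" "push p x = ?z"
    using normal_complement[of ?z p] z N_tangent by auto
  have "g' (\<iota> p) v ?z = g' (\<iota> p) w ?z" using assms(3)[OF x(1)] x(2) by simp
  then show "g' (\<iota> p) v z = g' (\<iota> p) w z" using N v w z N_tangent by simp
qed

text \<open>\<open>pull\<close> is a pointwise description, so smoothness has to be earned. The
  components of the preimage solve a linear system whose matrix is the Jacobian of
  \<open>\<iota>\<close>, with more equations than unknowns but trivial kernel, and
  \<open>smooth_solution\<close> applies.\<close>

lemma pull_field:
  assumes p: "\<iota> p \<in> U" and V: "sect p V" and perp: "\<forall>\<^sub>F q in nhds p. g' (\<iota> q) (V q) (N q) = 0"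
  shows "field_near A p (\<lambda>q. pull q (V q))"
proof -
  have perp': "\<forall>\<^sub>F q in nhds p. \<forall>\<^sub>F r in nhds q. g' (\<iota> r) (V r) (N r) = 0"
    using perp by (simp add: eventually_eventually)
  show ?thesis
    unfolding field_near_section section_near_def
    using section_near_eventually[OF V] eventually_chart[OF p] perp'
  proof eventually_elim
    case (elim q)
    note V = elim(1) and q = elim(2)
    have ev: "\<forall>\<^sub>F r in nhds q. pull r (V r) \<in> tangent_space A r \<and> push r (pull r (V r)) = V r"
      using section_near_eventually[OF V] elim(3)
      by eventually_elim (simp add: pull section_near_at(1))
    obtain W d where W: "(W, d) \<in> A" "q \<in> W" by (rule dom.chart_at)
    note Wev = eventually_nhds_in_open[OF dom.open_chart[OF W(1)] W(2)]
    let ?e = "\<lambda>b r. coord_vec A W d r b"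
    have coord: "\<forall>i\<in>Basis. smooth_near A q (\<lambda>r. pull r (V r) (\<lambda>s. d s \<bullet> i))"
    \<comment> \<open>Rows are indexed by ambient coordinates, columns by coordinates of the
      hypersurface.\<close>
    proof (rule dom.smooth_solution[where a = "\<lambda>j i r. push r (?e i r) (co j)" and K = Basis])
      show "smooth_near A q (\<lambda>r. push r (?e i r) (co j))" for i j
        by (rule sect_coord_smooth[OF sect_push[OF dom.coord_vec_field[OF W]] q])
      show "smooth_near A q (\<lambda>r. \<Sum>i\<in>Basis. push r (?e i r) (co j) * pull r (V r) (\<lambda>s. d s \<bullet> i))" for j
      proof (rule dom.smooth_near_cong[OF _ sect_coord_smooth[OF V q]])
        show "\<forall>\<^sub>F r in nhds q. V r (co j) = (\<Sum>i\<in>Basis. push r (?e i r) (co j) * pull r (V r) (\<lambda>s. d s \<bullet> i))"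
          using ev Wev
        proof eventually_elim
          case (elim r)
          then have "push r (pull r (V r)) = push r (\<Sum>i\<in>Basis. pull r (V r) (\<lambda>s. d s \<bullet> i) *\<^sub>R ?e i r)"
            using dom.tangent_space_expand[OF W(1), of r "pull r (V r)"] by simp
          also have "\<dots> = (\<Sum>i\<in>Basis. pull r (V r) (\<lambda>s. d s \<bullet> i) *\<^sub>R push r (?e i r))"
            by (simp only: linear_sum[OF linear_push] linear_scale[OF linear_push])
          finally have eq: "V r = (\<Sum>i\<in>Basis. pull r (V r) (\<lambda>s. d s \<bullet> i) *\<^sub>R push r (?e i r))"
            using elim by simp
          show ?case
            using fun_cong[OF eq, of "co j"] by (simp add: sum_fun_apply fun_apply mult.commute)
        qed
      qed
      \<comment> \<open>Trivial kernel: the tangent vector with components \<open>y\<close> is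
        pushed to zero, hence is zero by injectivity of \<open>push\<close>.\<close>
      fix y :: "'f \<Rightarrow> real"
      assume y: "\<And>j. j \<in> Basis \<Longrightarrow> (\<Sum>i\<in>Basis. push q (?e i q) (co j) * y i) = 0"
      let ?v = "\<Sum>i\<in>Basis. y i *\<^sub>R ?e i q"
      have v: "?v \<in> tangent_space A q"
        by (intro dom.tangent_sum dom.tangent_scale dom.coord_vec_tangent[OF W])
      have "push q ?v (co j) = 0" if "j \<in> Basis" for j
        using y[OF that]
        by (simp add: linear_sum[OF linear_push] linear_scale[OF linear_push] sum_fun_apply fun_apply mult.commute)
      then have "push q ?v = 0" using expand[OF q push_tangent[OF v]] by simp
      then have "?v = 0" by (rule push_eq_zero[OF v])
      then have "coord_vec A W d q (\<Sum>i\<in>Basis. y i *\<^sub>R i) = coord_vec A W d q 0"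
        by (simp add: linear_sum[OF dom.coord_vec_linear[OF W]] linear_scale[OF dom.coord_vec_linear[OF W]]
          linear_0[OF dom.coord_vec_linear[OF W]])
      then have "(\<Sum>i\<in>Basis. y i *\<^sub>R i) = 0" using dom.coord_vec_inj[OF W] by (auto dest: injD)
      then show "\<forall>i\<in>Basis. y i = 0" by (metis inner_sum_left_Basis inner_zero_left)
    qed simp
    have "smooth_near A q (\<lambda>r. pull r (V r) f)" if f: "smooth_near A q f" for f
    proof (rule dom.smooth_near_cong)
      show "smooth_near A q (\<lambda>r. \<Sum>i\<in>Basis. pull r (V r) (\<lambda>s. d s \<bullet> i) * ?e i r f)"
        using coord by (intro dom.smooth_near_sum dom.smooth_near_mult dom.smooth_near_coord_vec[OF W f]) auto
      show "\<forall>\<^sub>F r in nhds q. (\<Sum>i\<in>Basis. pull r (V r) (\<lambda>s. d s \<bullet> i) * ?e i r f) = pull r (V r) f"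
        using ev Wev
      proof eventually_elim
        case (elim r)
        then have "pull r (V r) f = (\<Sum>i\<in>Basis. pull r (V r) (\<lambda>s. d s \<bullet> i) *\<^sub>R ?e i r) f"
          using dom.tangent_space_expand[OF W(1), of r "pull r (V r)"] by simp
        then show ?case by (simp add: sum_fun_apply fun_apply)
      qed
    qed
    then show ?case using eventually_nhds_x_imp_x[OF ev] by simp
  qed
qed

text \<open>This is \<open>g(Ax, y)\<close> for the shape operator \<open>A\<close>.\<close>

definition h :: "'h \<Rightarrow> 'h tvec \<Rightarrow> 'h tvec \<Rightarrow> real" where
  "h p x y = - g' (\<iota> p) (nab p x N) (push p y)"

lemma nab_N_N:
  assumes p: "\<iota> p \<in> U" and x: "x \<in> tangent_space A p" shows "g' (\<iota> p) (nab p x N) (N p) = 0"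
  using nab_metric[OF p N_sect N_sect x] dom.deriv_const[OF x, of "-1"]
    amb.g_sym[OF N_tangent nab_tangent[OF p x], of N]
  by (simp add: N_N)

lemma nab_push_N:
  assumes p: "\<iota> p \<in> U" and x: "x \<in> tangent_space A p" and Y: "field_near A p Y"
  shows "g' (\<iota> p) (nab p x (\<lambda>q. push q (Y q))) (N p) = h p x (Y p)"
proof -
  have "\<forall>\<^sub>F q in nhds p. g' (\<iota> q) (push q (Y q)) (N q) = 0"
    using field_near_eventually[OF Y] by (rule eventually_mono) (rule push_N[OF field_near_at(1)])
  then have "x (\<lambda>q. g' (\<iota> q) (push q (Y q)) (N q)) = 0"
    using dom.deriv_cong[OF x, of _ "\<lambda>q. 0"] dom.deriv_const[OF x] by simp
  then show ?thesis
    using nab_metric[OF p sect_push[OF Y] N_sect x]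
      amb.g_sym[OF push_tangent[OF field_near_at(1)[OF Y]] nab_tangent[OF p x], of N]
    by (simp add: h_def)
qed

text \<open>The uniqueness argument for the Levi-Civita connection.\<close>

lemma nab_push_tangential:
  assumes p: "\<iota> p \<in> U" and "field_near A p X" "field_near A p Y" "field_near A p Z"
  shows "g' (\<iota> p) (nab p (X p) (\<lambda>q. push q (Y q))) (push p (Z p)) = g p (D p (X p) Y) (Z p)"
proof -
  define s where "s X Y Z = g' (\<iota> p) (nab p (X p) (\<lambda>q. push q (Y q))) (push p (Z p)) - g p (D p (X p) Y) (Z p)" for X Y Z
  interpret sp: scalar_product "tangent_space A' (\<iota> p)" "g' (\<iota> p)" by (rule amb.scalar_product)
  have sym: "s X Y Z = s Y X Z" if X: "field_near A p X" and Y: "field_near A p Y" and Z: "field_near A p Z" for X Y Z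
  proof -
    note t = field_near_at(1)[OF X] field_near_at(1)[OF Y] field_near_at(1)[OF Z]
    have "push p (D p (X p) Y) - push p (D p (Y p) X) = nab p (X p) (\<lambda>q. push q (Y q)) - nab p (Y p) (\<lambda>q. push q (X q))"
      using dom.torsion_free[OF X Y] nab_torsion[OF p X Y] push_diff by metis
    then have "g' (\<iota> p) (push p (D p (X p) Y) - push p (D p (Y p) X)) (push p (Z p)) =
      g' (\<iota> p) (nab p (X p) (\<lambda>q. push q (Y q)) - nab p (Y p) (\<lambda>q. push q (X q))) (push p (Z p))" by simp
    then show ?thesis
      using t X Y by (simp add: s_def g_eq push_tangent dom.conn_tangent nab_tangent[OF p])
  qed
  have anti: "s X Y Z = - s X Z Y" if X: "field_near A p X" and Y: "field_near A p Y" and Z: "field_near A p Z" for X Y Z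
  proof -
    note t = field_near_at(1)[OF X] field_near_at(1)[OF Y] field_near_at(1)[OF Z]
    have "X p (\<lambda>q. g q (Y q) (Z q)) = g p (D p (X p) Y) (Z p) + g p (Y p) (D p (X p) Z)"
      using lc X Y Z t unfolding levi_civita_def by blast
    moreover have "X p (\<lambda>q. g q (Y q) (Z q)) = g' (\<iota> p) (nab p (X p) (\<lambda>q. push q (Y q))) (push p (Z p))
        + g' (\<iota> p) (push p (Y p)) (nab p (X p) (\<lambda>q. push q (Z q)))"
      unfolding g_eq by (rule nab_metric[OF p sect_push[OF Y] sect_push[OF Z] t(1)])
    ultimately show ?thesis
      using t sp.g_sym[OF push_tangent nab_tangent[OF p], of "Y p" "X p"]
        sp.g_sym[OF push_tangent push_tangent, of "Y p" "D p (X p) Z"] dom.conn_tangent[OF Z]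
      by (simp add: s_def g_eq)
  qed
  \<comment> \<open>A trilinear defect that is symmetric in the first two and skew in the last two
    arguments equals its own negative after six exchanges.\<close>
  have "s X Y Z = - s X Y Z"
    using sym[of X Y Z] anti[of Y X Z] sym[of Y Z X] anti[of Z Y X] sym[of Z X Y] anti[of X Z Y] assms by simp
  then show ?thesis by (simp add: s_def)
qed

lemma gauss_formula:
  assumes p: "\<iota> p \<in> U" and X: "field_near A p X" and Y: "field_near A p Y"
  shows "nab p (X p) (\<lambda>q. push q (Y q)) = push p (D p (X p) Y) - h p (X p) (Y p) *\<^sub>R N p"
proof (rule normal_tangent_eqI)
  interpret sp: scalar_product "tangent_space A' (\<iota> p)" "g' (\<iota> p)" by (rule amb.scalar_product)
  note t = field_near_at(1)[OF X] field_near_at(1)[OF Y]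
  have D: "push p (D p (X p) Y) \<in> tangent_space A' (\<iota> p)" by (rule push_tangent[OF dom.conn_tangent[OF Y t(1)]])
  show "nab p (X p) (\<lambda>q. push q (Y q)) \<in> tangent_space A' (\<iota> p)" by (rule nab_tangent[OF p t(1)])
  show "push p (D p (X p) Y) - h p (X p) (Y p) *\<^sub>R N p \<in> tangent_space A' (\<iota> p)"
    using D N_tangent by simp
  show "g' (\<iota> p) (nab p (X p) (\<lambda>q. push q (Y q))) (N p) =
      g' (\<iota> p) (push p (D p (X p) Y) - h p (X p) (Y p) *\<^sub>R N p) (N p)"
    using nab_push_N[OF p t(1) Y] D N_tangent push_N[OF dom.conn_tangent[OF Y t(1)]] N_N by simp
  fix x assume x: "x \<in> tangent_space A p"
  show "g' (\<iota> p) (nab p (X p) (\<lambda>q. push q (Y q))) (push p x) =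
      g' (\<iota> p) (push p (D p (X p) Y) - h p (X p) (Y p) *\<^sub>R N p) (push p x)"
    using nab_push_tangential[OF p X Y dom.extension_field[of p x]] dom.extension_at[OF x] x D N_tangent push_tangent[OF x]
    by (simp add: N_push g_eq)
qed

text \<open>For commuting extensions the torsion identity makes the two mixed derivatives equal, and
  \<open>h\<close> is their common product with \<open>N\<close>.\<close>

lemma h_sym:
  assumes p: "\<iota> p \<in> U" and x: "x \<in> tangent_space A p" and y: "y \<in> tangent_space A p"
  shows "h p x y = h p y x"
proof -
  let ?X = "dom.extension p x" and ?Y = "dom.extension p y"
  note E = dom.extension_field dom.extension_at[OF x] dom.extension_at[OF y]
  have "nab p x (\<lambda>q. push q (?Y q)) = nab p y (\<lambda>q. push q (?X q))"
    using nab_torsion[OF p E(1) E(1), of x y] E(2,3) dom.extension_bracket[of p x y] push_scale[of p 0 0] by simp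
  then show ?thesis
    using nab_push_N[OF p x E(1), of y] nab_push_N[OF p y E(1), of x] E(2,3) by simp
qed

lemma h_linear:
  assumes p: "\<iota> p \<in> U" and x: "x \<in> tangent_space A p" and y: "y \<in> tangent_space A p" and z: "z \<in> tangent_space A p"
  shows "h p x (y + z) = h p x y + h p x z" "h p x (r *\<^sub>R y) = r * h p x y"
  using nab_tangent[OF p x] push_tangent[OF y] push_tangent[OF z]
  by (simp_all add: h_def push_add push_scale amb.g_add_right amb.g_scale_right)

lemma gauss_equation:
  assumes p: "\<iota> p \<in> U" and x: "x \<in> tangent_space A p" and y: "y \<in> tangent_space A p"
    and z: "z \<in> tangent_space A p" and u: "u \<in> tangent_space A p"
  shows "curvature4 A' g' D' (\<iota> p) (push p x) (push p y) (push p z) (push p u) =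
    curvature4 A g D p x y z u + h p y z * h p x u - h p x z * h p y u"
proof -
  interpret sp: scalar_product "tangent_space A' (\<iota> p)" "g' (\<iota> p)" by (rule amb.scalar_product)
  define X Y Z where "X = dom.extension p x" and "Y = dom.extension p y" and "Z = dom.extension p z"
  have f: "field_near A p X" "field_near A p Y" "field_near A p Z" by (simp_all add: X_def Y_def Z_def dom.extension_field)
  have e: "X p = x" "Y p = y" "Z p = z" using x y z by (simp_all add: X_def Y_def Z_def dom.extension_at)
  have B: "bracket A X Y p = 0" by (simp add: X_def Y_def dom.extension_bracket)
  \<comment> \<open>Differentiating the Gauss formula once more, all multiples of \<open>N\<close>
    are lost in the product with \<open>push p u\<close>; the derivative of \<open>N\<close> itself
    contributes the product of two values of \<open>h\<close>, with a plus sign by the definition of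
    \<open>h\<close>.\<close>
  have 2: "g' (\<iota> p) (nab p v (\<lambda>q. nab q (W q) (\<lambda>r. push r (Z r)))) (push p u) =
      g' (\<iota> p) (push p (D p v (\<lambda>q. D q (W q) Z))) (push p u) + h p (W p) z * h p v u"
    if W: "field_near A p W" and v: "v \<in> tangent_space A p" for W v
  proof -
    let ?h = "\<lambda>q. h q (W q) (Z q)"
    note DW = dom.conn_field[OF f(3) W]
    have hs: "smooth_near A p ?h"
      unfolding h_def
      by (intro dom.smooth_near_minus metric_sect_smooth[OF p] sect_nab[OF p W N_sect] sect_push[OF f(3)])
    have "\<forall>\<^sub>F q in nhds p. nab q (W q) (\<lambda>r. push r (Z r)) = push q (D q (W q) Z) - ?h q *\<^sub>R N q"
      using eventually_chart[OF p] field_near_eventually[OF W] field_near_eventually[OF f(3)]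
      by eventually_elim (rule gauss_formula)
    from nab_cong[OF v this] have "nab p v (\<lambda>q. nab q (W q) (\<lambda>r. push r (Z r))) =
        nab p v (\<lambda>q. push q (D q (W q) Z)) - (v ?h *\<^sub>R N p + ?h p *\<^sub>R nab p v N)"
      using nab_diff[OF p v sect_push[OF DW] sect_mult[OF N_sect hs]] nab_mult[OF p v N_sect hs] by simp
    moreover have "nab p v (\<lambda>q. push q (D q (W q) Z)) =
        push p (D p v (\<lambda>q. D q (W q) Z)) - h p v (D p (W p) Z) *\<^sub>R N p"
      using gauss_formula[OF p dom.extension_field[of p v] DW] dom.extension_at[OF v] by simp
    ultimately show ?thesis
      using push_tangent[OF u] push_tangent[OF dom.conn_tangent[OF DW v]] nab_tangent[OF p v, of N] N_tangent[of p]
        N_push[OF u] e(3) by (simp add: h_def[of p v u])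
  qed
  have zero: "nab p 0 V = 0" for V using nab_scale_vec[OF p dom.tangent_zero, of 0 V] by simp
  note c1 = dom.conn_tangent[OF dom.conn_field[OF f(3,2)] x] and c2 = dom.conn_tangent[OF dom.conn_field[OF f(3,1)] y]
  have conn0: "D p 0 Z = 0" using dom.conn_scale_vec[OF f(3) dom.tangent_zero, of 0] by simp
  have "g' (\<iota> p) (Rop p X Y (\<lambda>q. push q (Z q))) (push p u) =
     g' (\<iota> p) (push p (D p x (\<lambda>q. D q (Y q) Z)) - push p (D p y (\<lambda>q. D q (X q) Z))) (push p u) +
     h p y z * h p x u - h p x z * h p y u"
    using 2[OF f(2) x] 2[OF f(1) y] e B zero nab_tangent[OF p x] nab_tangent[OF p y] push_tangent[OF u]
      push_tangent[OF c1] push_tangent[OF c2] by (simp add: Rop_def)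
  moreover have "push p (D p x (\<lambda>q. D q (Y q) Z)) - push p (D p y (\<lambda>q. D q (X q) Z)) = push p (curvature A D p x y z)"
    using dom.curvature_eq[OF f] e B conn0 by (simp add: push_diff)
  ultimately show ?thesis
    using Rop_curvature[OF p f(1,2) sect_push[OF f(3)]] e by (simp add: curvature4_def g_eq)
qed

end

text \<open>Self-adjointness of \<open>\<phi>\<close> replaces the compatibility of \<open>g\<close>
  with \<open>\<phi>\<close>, which it yields through \<open>\<phi>_\<phi>\<close>, and is the
  better rewrite rule.\<close>

locale contact_norden_space = scalar_product V g for V :: "'v::real_vector set" and g +
  fixes \<phi> :: "'v \<Rightarrow> 'v" and \<xi> :: 'v and \<eta> :: "'v \<Rightarrow> real"
  assumes \<phi>_V [simp]: "x \<in> V \<Longrightarrow> \<phi> x \<in> V"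
    and \<phi>_add [simp]: "x \<in> V \<Longrightarrow> y \<in> V \<Longrightarrow> \<phi> (x + y) = \<phi> x + \<phi> y"
    and \<phi>_scale [simp]: "x \<in> V \<Longrightarrow> \<phi> (r *\<^sub>R x) = r *\<^sub>R \<phi> x"
    and \<xi>_V [simp]: "\<xi> \<in> V"
    and \<eta>_eq: "x \<in> V \<Longrightarrow> \<eta> x = g x \<xi>"
    and \<eta>_\<xi> [simp]: "\<eta> \<xi> = 1"
    and \<phi>_\<xi> [simp]: "\<phi> \<xi> = 0"
    and \<phi>_\<phi> [simp]: "x \<in> V \<Longrightarrow> \<phi> (\<phi> x) = - x + \<eta> x *\<^sub>R \<xi>"
    and g_\<phi>_left [simp]: "x \<in> V \<Longrightarrow> y \<in> V \<Longrightarrow> g (\<phi> x) y = g x (\<phi> y)"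
begin

lemma \<eta>_linear [simp]:
  "x \<in> V \<Longrightarrow> y \<in> V \<Longrightarrow> \<eta> (x + y) = \<eta> x + \<eta> y" "x \<in> V \<Longrightarrow> \<eta> (r *\<^sub>R x) = r * \<eta> x"
  "x \<in> V \<Longrightarrow> \<eta> (- x) = - \<eta> x" "\<eta> 0 = 0" "x \<in> V \<Longrightarrow> \<eta> (\<phi> x) = 0"
  "x \<in> V \<Longrightarrow> y \<in> V \<Longrightarrow> \<eta> (x - y) = \<eta> x - \<eta> y"
  by (simp_all add: \<eta>_eq)

lemma g_\<xi> [simp]: "x \<in> V \<Longrightarrow> g x \<xi> = \<eta> x" "x \<in> V \<Longrightarrow> g \<xi> x = \<eta> x"
  by (simp_all add: \<eta>_eq g_sym[of \<xi>])

lemma \<phi>_minus [simp]: "x \<in> V \<Longrightarrow> \<phi> (- x) = - \<phi> x"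
  using \<phi>_scale[of x "-1"] by simp

end

section \<open>The induced almost contact structure and its second fundamental form\<close>

context hypersurface
begin

abbreviation "tt \<equiv> induced_t J g' \<iota> N"
abbreviation "xi \<equiv> induced_xi A A' J g' \<iota> N"
abbreviation "eta \<equiv> induced_eta A' J g' \<iota> N"
abbreviation "phi \<equiv> induced_phi A A' J g' \<iota> N"
abbreviation "JN p \<equiv> J (\<iota> p) (N p)"

lemma cos_t: "cos (tt p) > 0"
  by (simp add: induced_t_def cos_arctan add_pos_nonneg)

lemma tan_t: "tan (tt p) = g' (\<iota> p) (N p) (JN p)"
  by (simp add: induced_t_def tan_arctan)

lemma sin_t: "cos (tt p) * g' (\<iota> p) (N p) (JN p) = sin (tt p)"
  using cos_t[of p] unfolding tan_t[symmetric] tan_def by simp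

lemma cos_sin_t: "cos (tt p) * (cos (tt p) + sin (tt p) * g' (\<iota> p) (N p) (JN p)) = 1"
proof -
  have "cos (tt p) * (cos (tt p) + sin (tt p) * g' (\<iota> p) (N p) (JN p)) =
      cos (tt p) * cos (tt p) + sin (tt p) * (cos (tt p) * g' (\<iota> p) (N p) (JN p))"
    by (simp add: algebra_simps)
  then show ?thesis by (simp only: sin_t sin_cos_squared_add3)
qed

lemma JN_tangent: "JN p \<in> tangent_space A' (\<iota> p)"
  by (rule amb.J_tangent[OF N_tangent])

lemma JN_products: "g' (\<iota> p) (JN p) (N p) = g' (\<iota> p) (N p) (JN p)" "g' (\<iota> p) (JN p) (JN p) = 1"
  using amb.g_J_left[OF N_tangent N_tangent, of p] amb.g_J_J[OF N_tangent N_tangent, of p] N_N by simp_all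

lemma eta_JN: "eta p x = cos (tt p) * g' (\<iota> p) (push p x) (JN p)"
  by (simp add: induced_eta_def)

lemma push_JN: "g' (\<iota> p) (push p x) (JN p) = eta p x / cos (tt p)"
  using cos_t[of p] by (simp add: eta_JN)

text \<open>\<open>sin_t\<close> says precisely that the defining vector is orthogonal to
  \<open>N\<close>.\<close>

lemma xi: "xi p \<in> tangent_space A p" "push p (xi p) = sin (tt p) *\<^sub>R N p + cos (tt p) *\<^sub>R JN p"
proof -
  interpret sp: scalar_product "tangent_space A' (\<iota> p)" "g' (\<iota> p)" by (rule amb.scalar_product)
  let ?w = "sin (tt p) *\<^sub>R N p + cos (tt p) *\<^sub>R JN p"
  have "?w \<in> tangent_space A' (\<iota> p)" "g' (\<iota> p) ?w (N p) = 0"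
    using N_tangent JN_tangent sin_t[of p] by (simp_all add: N_N JN_products)
  from pull[OF this] show "xi p \<in> tangent_space A p" "push p (xi p) = ?w"
    unfolding induced_xi_def by auto
qed

text \<open>The normal part of \<open>J x\<close> is governed by
  \<open>g'(x, JN) = eta x / cos t\<close>; by \<open>cos_sin_t\<close> the correction term cancels
  it, so a tangential preimage exists.\<close>

lemma phi:
  assumes x: "x \<in> tangent_space A p"
  shows "phi p x \<in> tangent_space A p"
    "push p (phi p x) = J (\<iota> p) (push p x) + eta p x *\<^sub>R (cos (tt p) *\<^sub>R N p - sin (tt p) *\<^sub>R JN p)"
proof -
  interpret sp: scalar_product "tangent_space A' (\<iota> p)" "g' (\<iota> p)" by (rule amb.scalar_product)
  let ?w = "J (\<iota> p) (push p x) + eta p x *\<^sub>R (cos (tt p) *\<^sub>R N p - sin (tt p) *\<^sub>R JN p)"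
  note t = push_tangent[OF x] amb.J_tangent[OF push_tangent[OF x]] N_tangent[of p] JN_tangent[of p]
  have "?w \<in> tangent_space A' (\<iota> p)" using t by simp
  moreover have "g' (\<iota> p) ?w (N p) =
      eta p x / cos (tt p) - eta p x * (cos (tt p) + sin (tt p) * g' (\<iota> p) (N p) (JN p))"
    using t by (simp add: N_N JN_products amb.g_J_left push_JN algebra_simps)
  moreover have "cos (tt p) + sin (tt p) * g' (\<iota> p) (N p) (JN p) = 1 / cos (tt p)"
    using cos_t[of p] cos_sin_t[of p] by (simp add: field_simps)
  ultimately have "?w \<in> tangent_space A' (\<iota> p)" "g' (\<iota> p) ?w (N p) = 0" by simp_all
  from pull[OF this] show "phi p x \<in> tangent_space A p" "push p (phi p x) = ?w"
    unfolding induced_phi_def induced_eta_def by auto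
qed

text \<open>Nondegeneracy: a tangent vector orthogonal to all tangent vectors is also orthogonal to
  \<open>N\<close>, hence to the whole ambient space.\<close>

lemma induced_scalar_product: "scalar_product (tangent_space A p) (g p)"
proof
  interpret sp: scalar_product "tangent_space A' (\<iota> p)" "g' (\<iota> p)" by (rule amb.scalar_product)
  show "subspace (tangent_space A p)" by (rule dom.subspace_tangent_space)
  fix x assume x: "x \<in> tangent_space A p"
  show "x = 0" if "\<And>y. y \<in> tangent_space A p \<Longrightarrow> g p x y = 0"
  proof (rule push_eq_zero[OF x], rule normal_tangent_eqI)
    fix y assume "y \<in> tangent_space A p"
    then show "g' (\<iota> p) (push p x) (push p y) = g' (\<iota> p) 0 (push p y)"
      using that[of y] push_tangent by (simp add: g_eq)
  qed (use push_N[OF x] push_tangent[OF x] N_tangent in simp_all)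
  fix y assume y: "y \<in> tangent_space A p"
  show "g p x y = g p y x" using x y push_tangent by (simp add: g_eq sp.g_sym[of "push p x"])
  show "g p (r *\<^sub>R x) y = r * g p x y" for r using x y push_tangent by (simp add: g_eq push_scale)
  show "g p (x + y) z = g p x z + g p y z" if "z \<in> tangent_space A p" for z
    using x y that push_tangent by (simp add: g_eq push_add)
qed

text \<open>Vector identities are checked after pushing forward, where \<open>J\<close> is
  available, and returned by injectivity of \<open>push\<close>.\<close>

lemma contact: "contact_norden_space (tangent_space A p) (g p) (phi p) (xi p) (eta p)"
proof -
  interpret sp: scalar_product "tangent_space A' (\<iota> p)" "g' (\<iota> p)" by (rule amb.scalar_product)
  interpret dsp: scalar_product "tangent_space A p" "g p" by (rule induced_scalar_product)
  note N[simp] = N_tangent[of p] JN_tangent[of p] N_N[of p] JN_products[of p] and [simp] = xi(1)[of p]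
  have pt[simp]: "push p x \<in> tangent_space A' (\<iota> p)" "J (\<iota> p) (push p x) \<in> tangent_space A' (\<iota> p)"
    if "x \<in> tangent_space A p" for x
    using push_tangent[OF that] amb.J_tangent by auto
  have inj: "x = y" if "x \<in> tangent_space A p" "y \<in> tangent_space A p" "push p x = push p y" for x y
    using inj_onD[OF push_inj that(3) that(1,2)] .
  have eta_g: "eta p x = g p x (xi p)" if "x \<in> tangent_space A p" for x
    using that push_N[OF that] by (simp add: g_eq xi(2) eta_JN)
  have eta_lin: "eta p (x + y) = eta p x + eta p y" "eta p (r *\<^sub>R x) = r * eta p x"
    if "x \<in> tangent_space A p" "y \<in> tangent_space A p" for x y r
    using that by (simp_all add: eta_g)
  have eta_phi: "eta p (phi p x) = 0" if x: "x \<in> tangent_space A p" for x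
  proof -
    have "g' (\<iota> p) (push p (phi p x)) (JN p) =
        - g' (\<iota> p) (push p x) (N p) + eta p x * (cos (tt p) * g' (\<iota> p) (N p) (JN p) - sin (tt p))"
      using x by (simp add: phi(2)[OF x] amb.g_J_J algebra_simps)
    then show ?thesis by (simp add: eta_JN sin_t push_N[OF x])
  qed
  show ?thesis
  proof (intro contact_norden_space.intro induced_scalar_product contact_norden_space_axioms.intro)
    show "xi p \<in> tangent_space A p" by (rule xi(1))
    show "eta p (xi p) = 1"
      using cos_sin_t[of p] by (simp add: eta_JN xi(2) algebra_simps)
    show "phi p (xi p) = 0"
    proof (rule inj)
      show "push p (phi p (xi p)) = push p 0"
        using \<open>eta p (xi p) = 1\<close> linear_0[OF linear_push]
        by (simp add: phi(2) xi(2) amb.J_add amb.J_scale amb.J_J)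
    qed (simp_all add: phi)
    fix x assume x: "x \<in> tangent_space A p"
    show "phi p x \<in> tangent_space A p" by (rule phi(1)[OF x])
    show "eta p x = g p x (xi p)" by (rule eta_g[OF x])
    show "phi p (r *\<^sub>R x) = r *\<^sub>R phi p x" for r
      by (rule inj) (use x eta_lin[OF x x] in \<open>simp_all add: phi push_scale amb.J_scale algebra_simps\<close>)
    show "phi p (phi p x) = - x + eta p x *\<^sub>R xi p"
    proof (rule inj)
      show "push p (phi p (phi p x)) = push p (- x + eta p x *\<^sub>R xi p)"
        using x eta_phi[OF x]
        by (simp add: phi push_add push_diff push_minus push_scale xi amb.J_add amb.J_diff amb.J_scale amb.J_J amb.J_minus algebra_simps)
    qed (use x phi in simp_all)
    fix y assume y: "y \<in> tangent_space A p"
    show "phi p (x + y) = phi p x + phi p y"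
      by (rule inj) (use x y eta_lin[OF x y] in \<open>simp_all add: phi push_add amb.J_add algebra_simps\<close>)
    have "g' (\<iota> p) (push p x) (push p (phi p y)) = g' (\<iota> p) (push p x) (J (\<iota> p) (push p y)) - eta p x * eta p y * tan (tt p)"
      if x: "x \<in> tangent_space A p" and y: "y \<in> tangent_space A p" for x y
      using x y push_N[OF x] by (simp add: phi(2)[OF y] push_JN tan_def)
    from this[OF x y] this[OF y x] show "g p (phi p x) y = g p x (phi p y)"
      using x y phi[OF x] amb.g_J_sym[of "push p x" "\<iota> p" "push p y"] sp.g_sym[of "push p (phi p x)" "push p y"]
      by (simp add: g_eq)
  qed
qed

text \<open>The source of all \<open>tan t\<close> terms in the curvature: replacing
  \<open>J\<close> by \<open>phi\<close> turns the ambient \<open>pi2\<close> and \<open>pi3\<close>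
  into \<open>pi2 + tan t * pi5\<close> and \<open>pi3 - tan t * pi4\<close>.\<close>

lemma g_push_J_push:
  assumes x: "x \<in> tangent_space A p" and y: "y \<in> tangent_space A p"
  shows "g' (\<iota> p) (push p x) (J (\<iota> p) (push p y)) = g p x (phi p y) + tan (tt p) * eta p x * eta p y"
proof -
  interpret sp: scalar_product "tangent_space A' (\<iota> p)" "g' (\<iota> p)" by (rule amb.scalar_product)
  show ?thesis
    using push_N[OF x] push_tangent[OF x] push_tangent[OF y] amb.J_tangent[OF push_tangent[OF y]] N_tangent[of p] JN_tangent[of p]
    by (simp add: g_eq phi(2)[OF y] push_JN tan_def)
qed

text \<open>On the image of \<open>phi\<close> the form \<open>eta\<close> vanishes, and with it the
  correction that distinguishes \<open>phi\<close> from \<open>J\<close>.\<close>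

lemma J_push_phi:
  assumes x: "x \<in> tangent_space A p"
  shows "J (\<iota> p) (push p (phi p x)) = push p (phi p (phi p x))"
proof -
  interpret contact_norden_space "tangent_space A p" "g p" "phi p" "xi p" "eta p" by (rule contact)
  show ?thesis using phi(2)[OF phi(1)[OF x]] x by (simp del: \<phi>_\<phi>)
qed

lemma smooth_t: "\<iota> p \<in> U \<Longrightarrow> smooth_near A p tt"
  unfolding induced_t_def
  by (rule dom.smooth_near_compose[OF metric_sect_smooth open_UNIV _ smooth_on_arctan])
    (simp_all add: N_sect sect_J)

lemma smooth_sin_t: "\<iota> p \<in> U \<Longrightarrow> smooth_near A p (\<lambda>q. sin (tt q))"
  and smooth_cos_t: "\<iota> p \<in> U \<Longrightarrow> smooth_near A p (\<lambda>q. cos (tt q))"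
  using dom.smooth_near_compose[OF smooth_t open_UNIV _ smooth_on_sin]
    dom.smooth_near_compose[OF smooth_t open_UNIV _ smooth_on_cos] by auto

lemma phi_field:
  assumes p: "\<iota> p \<in> U" and Y: "field_near A p Y" shows "field_near A p (\<lambda>q. phi q (Y q))"
proof -
  let ?V = "\<lambda>q. J (\<iota> q) (push q (Y q)) + (cos (tt q) * g' (\<iota> q) (push q (Y q)) (JN q)) *\<^sub>R
       (cos (tt q) *\<^sub>R N q - sin (tt q) *\<^sub>R JN q)"
  have "sect p ?V"
    by (intro sect_add sect_mult sect_diff sect_J p sect_push Y N_sect smooth_sin_t smooth_cos_t
        dom.smooth_near_mult metric_sect_smooth)
  moreover have "\<forall>\<^sub>F q in nhds p. g' (\<iota> q) (?V q) (N q) = 0"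
    using field_near_eventually[OF Y]
    by (rule eventually_mono) (use phi(2)[OF field_near_at(1)] push_N[OF phi(1)[OF field_near_at(1)]] in \<open>simp add: eta_JN\<close>)
  ultimately show ?thesis unfolding induced_phi_def by (rule pull_field[OF p])
qed

text \<open>Since \<open>J\<close> is parallel and self-adjoint, \<open>g'(N, JN)\<close> has
  derivative \<open>2 g'(nab_x N, JN)\<close>, and the arctangent contributes \<open>cos t\<close>
  squared. As \<open>nab_x N\<close> is orthogonal to \<open>N\<close>, only the \<open>JN\<close>
  part of \<open>xi\<close> enters \<open>h(x, xi)\<close>.\<close>

lemma deriv_t:
  assumes p: "\<iota> p \<in> U" and x: "x \<in> tangent_space A p"
  shows "x tt = - 2 * cos (tt p) * h p x (xi p)"
proof -
  interpret sp: scalar_product "tangent_space A' (\<iota> p)" "g' (\<iota> p)" by (rule amb.scalar_product)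
  let ?f = "\<lambda>q. g' (\<iota> q) (N q) (JN q)"
  note JN = sect_J[OF p N_sect]
  note n = nab_tangent[OF p x, of N]
  have "((\<lambda>q. arctan q) has_real_derivative inverse (1 + (?f p)\<^sup>2)) (at (?f p))"
    by (auto intro!: derivative_eq_intros)
  then have "x tt = inverse (1 + (?f p)\<^sup>2) * x ?f"
    unfolding induced_t_def
    by (intro dom.deriv_compose[OF x metric_sect_smooth[OF p N_sect JN] open_UNIV _ smooth_on_arctan]) auto
  moreover have "inverse (1 + (?f p)\<^sup>2) = (cos (tt p))\<^sup>2"
  proof -
    have "(cos (tt p))\<^sup>2 * (1 + (?f p)\<^sup>2) = (cos (tt p))\<^sup>2 + (cos (tt p) * ?f p)\<^sup>2" by algebra
    also have "\<dots> = 1" unfolding sin_t by simp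
    finally show ?thesis by (metis inverse_unique mult.commute)
  qed
  moreover have "x ?f = 2 * g' (\<iota> p) (nab p x N) (JN p)"
    using nab_metric[OF p N_sect JN x] nab_J_eq[OF p N_sect x] n N_tangent[of p]
      amb.g_J_sym[of "N p" "\<iota> p" "nab p x N"] by simp
  moreover have "h p x (xi p) = - cos (tt p) * g' (\<iota> p) (nab p x N) (JN p)"
    using n N_tangent[of p] JN_tangent[of p] nab_N_N[OF p x] by (simp add: h_def xi(2))
  ultimately show ?thesis by (simp add: power2_eq_square)
qed

text \<open>Taking \<open>z = xi\<close> discards \<open>phi (D_x Y)\<close>, because
  \<open>eta\<close> vanishes on the image of \<open>phi\<close>. Moving the derivative onto
  \<open>xi = sin t N + cos t JN\<close> leaves derivatives of \<open>N\<close>, that is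
  \<open>h\<close>; those of \<open>sin t\<close> and \<open>cos t\<close> multiply \<open>N\<close>
  and \<open>JN\<close>, which are orthogonal to \<open>phi y\<close>.\<close>

lemma F_tensor_xi:
  assumes p: "\<iota> p \<in> U" and x: "x \<in> tangent_space A p" and y: "y \<in> tangent_space A p"
  shows "F_tensor A g D phi p x y (xi p) = sin (tt p) * h p x (phi p y) + cos (tt p) * h p x (phi p (phi p y))"
proof -
  interpret sp: scalar_product "tangent_space A' (\<iota> p)" "g' (\<iota> p)" by (rule amb.scalar_product)
  interpret contact_norden_space "tangent_space A p" "g p" "phi p" "xi p" "eta p" by (rule contact)
  define Y where "Y = dom.extension p y"
  have Y: "field_near A p Y" "Y p = y" using dom.extension_field dom.extension_at[OF y] by (auto simp: Y_def)
  note pY = phi_field[OF p Y(1)]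
  let ?xi = "\<lambda>q. sin (tt q) *\<^sub>R N q + cos (tt q) *\<^sub>R JN q"
  note JN = sect_J[OF p N_sect]
  have s1: "sect p (\<lambda>q. sin (tt q) *\<^sub>R N q)" and s2: "sect p (\<lambda>q. cos (tt q) *\<^sub>R JN q)"
    by (intro sect_mult N_sect JN smooth_sin_t smooth_cos_t p)+
  have "covariant_endo A D phi p x (Y p) = D p x (\<lambda>q. phi q (Y q)) - phi p (D p x Y)"
    by (rule dom.covariant_endo_eq[OF phi_field[OF p] _ _ x Y(1)])
      (use contact_norden_space.\<phi>_add[OF contact] contact_norden_space.\<phi>_scale[OF contact] in auto)
  then have "F_tensor A g D phi p x y (xi p) = g p (D p x (\<lambda>q. phi q (Y q))) (xi p)"
    using dom.conn_tangent[OF Y(1) x] dom.conn_tangent[OF pY x] Y(2) by (simp add: F_tensor_def)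
  also have "\<dots> = g' (\<iota> p) (nab p x (\<lambda>q. push q (phi q (Y q)))) (?xi p)"
    using nab_push_tangential[OF p dom.extension_field[of p x] pY dom.extension_field[of p "xi p"]]
      dom.extension_at[OF x] dom.extension_at[OF xi(1)] xi(2)[of p] by simp
  \<comment> \<open>The product of \<open>phi Y\<close> with \<open>xi\<close> is zero on a
    neighbourhood, so its derivative vanishes.\<close>
  also have "\<dots> = - g' (\<iota> p) (push p (phi p y)) (nab p x ?xi)"
  proof -
    have "\<forall>\<^sub>F q in nhds p. g' (\<iota> q) (push q (phi q (Y q))) (?xi q) = 0"
      using field_near_eventually[OF Y(1)]
    proof eventually_elim
      case (elim q)
      interpret q: contact_norden_space "tangent_space A q" "g q" "phi q" "xi q" "eta q" by (rule contact)
      show ?case using q.\<eta>_linear(5)[OF field_near_at(1)[OF elim]] q.g_\<xi>(1)[OF q.\<phi>_V[OF field_near_at(1)[OF elim]]]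
        by (simp add: g_eq xi(2))
    qed
    then have "x (\<lambda>q. g' (\<iota> q) (push q (phi q (Y q))) (?xi q)) = 0"
      using dom.deriv_cong[OF x, of _ "\<lambda>q. 0"] dom.deriv_const[OF x] by simp
    then show ?thesis
      using nab_metric[OF p sect_push[OF pY] sect_add[OF s1 s2] x] Y(2) by simp
  qed
  also have "nab p x ?xi = (x (\<lambda>q. sin (tt q)) *\<^sub>R N p + sin (tt p) *\<^sub>R nab p x N) +
      (x (\<lambda>q. cos (tt q)) *\<^sub>R JN p + cos (tt p) *\<^sub>R J (\<iota> p) (nab p x N))"
    using nab_add[OF p x s1 s2] nab_mult[OF p x N_sect smooth_sin_t[OF p]] nab_mult[OF p x JN smooth_cos_t[OF p]]
      nab_J_eq[OF p N_sect x] by simp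
  also have "- g' (\<iota> p) (push p (phi p y)) \<dots> =
      sin (tt p) * h p x (phi p y) + cos (tt p) * h p x (phi p (phi p y))"
  proof -
    note t = nab_tangent[OF p x, of N] amb.J_tangent[OF nab_tangent[OF p x, of N]] N_tangent[of p] JN_tangent[of p]
      push_tangent[OF phi(1)[OF y]] push_tangent[OF phi(1)[OF phi(1)[OF y]]]
    have "g' (\<iota> p) (push p (phi p y)) (JN p) = 0" using y by (simp add: push_JN)
    moreover have "g' (\<iota> p) (push p (phi p y)) (J (\<iota> p) (nab p x N)) = g' (\<iota> p) (nab p x N) (push p (phi p (phi p y)))"
      using amb.g_J_sym[OF t(5,1)] J_push_phi[OF y] by simp
    moreover have "g' (\<iota> p) (push p (phi p y)) (nab p x N) = g' (\<iota> p) (nab p x N) (push p (phi p y))"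
      using t sp.g_sym by blast
    ultimately show ?thesis
      using t push_N[OF phi(1)[OF y]] by (simp add: h_def)
  qed
  finally show ?thesis .
qed

text \<open>At \<open>z = xi\<close> the F4+F5 identity is one linear equation between
  \<open>h(x, phi y)\<close> and \<open>h(x, phi (phi y))\<close>. Replacing \<open>y\<close> by
  \<open>phi y\<close> gives a second one, and the coefficient matrix is orthogonal. Symmetry of
  \<open>h\<close> finally identifies \<open>h(x, xi)\<close>.\<close>

lemma second_fundamental_form:
  assumes p: "\<iota> p \<in> U" and n: "n \<ge> 1" and F45: "F4_F5_manifold n A g D phi xi eta"
    and x: "x \<in> tangent_space A p" and y: "y \<in> tangent_space A p"
  defines "\<theta> \<equiv> theta A g D phi xi eta p (xi p)" and "\<theta>s \<equiv> theta_star A g D phi xi eta p (xi p)"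
  defines "a \<equiv> (\<theta> * cos (tt p) + \<theta>s * sin (tt p)) / (2 * real n)"
    and "b \<equiv> (\<theta> * sin (tt p) - \<theta>s * cos (tt p)) / (2 * real n)"
  shows "h p x y = h p (xi p) (xi p) * eta p x * eta p y - a * (g p x y - eta p x * eta p y) - b * g p x (phi p y)"
proof -
  interpret contact_norden_space "tangent_space A p" "g p" "phi p" "xi p" "eta p" by (rule contact)
  let ?s = "sin (tt p)" and ?k = "cos (tt p)"
  have sk: "?s * ?s + ?k * ?k = 1" using sin_cos_squared_add3[of "tt p"] by (simp add: add.commute)
  have E: "?s * h p x (phi p y) + ?k * h p x (phi p (phi p y)) =
      - \<theta> / (2 * real n) * g p (phi p x) (phi p y) - \<theta>s / (2 * real n) * g p x (phi p y)"
    if x: "x \<in> tangent_space A p" and y: "y \<in> tangent_space A p" for x y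
  proof -
    have "F_tensor A g D phi p x y (xi p) = - \<theta> / (2 * real n) * (g p (phi p x) (phi p y) * eta p (xi p) +
        g p (phi p x) (phi p (xi p)) * eta p y)
      - \<theta>s / (2 * real n) * (g p x (phi p y) * eta p (xi p) + g p x (phi p (xi p)) * eta p y)"
      using F45 x y xi(1)[of p] unfolding F4_F5_manifold_def \<theta>_def \<theta>s_def by simp
    then show ?thesis using F_tensor_xi[OF p x y] x y by simp
  qed
  have hm: "h p x (- z) = - h p x z" if "x \<in> tangent_space A p" "z \<in> tangent_space A p" for x z
    using h_linear(2)[OF p that(1) that(2) that(2), of "-1"] by simp
  have main: "h p x y = eta p y * h p x (xi p) - a * (g p x y - eta p x * eta p y) - b * g p x (phi p y)"
    if x: "x \<in> tangent_space A p" and y: "y \<in> tangent_space A p" for x y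
  proof -
    define G where "G = g p x y - eta p x * eta p y"
    define P where "P = h p x (phi p y)"
    define Q where "Q = h p x (phi p (phi p y))"
    define C where "C = g p x (phi p y)"
    define r where "r = \<theta> / (2 * real n)"
    define rs where "rs = \<theta>s / (2 * real n)"
    have "?s * P + ?k * Q = r * G - rs * C"
      using E[OF x y] x y by (simp add: P_def Q_def G_def C_def r_def rs_def algebra_simps)
    \<comment> \<open>The equation at \<open>phi y\<close>, where the third power of
      \<open>phi\<close> is \<open>- phi\<close>.\<close>
    moreover have "?s * Q - ?k * P = r * C + rs * G"
    proof -
      have 3: "phi p (phi p (phi p y)) = - phi p y"
        using \<phi>_\<phi>[OF phi(1)[OF y]] y by (simp del: \<phi>_\<phi>)
      have "g p (phi p x) (phi p (phi p y)) = - C"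
        using g_\<phi>_left[OF x phi(1)[OF phi(1)[OF y]]] x y unfolding 3 C_def by (simp del: \<phi>_\<phi>)
      moreover have "g p x (phi p (phi p y)) = - G" using x y by (simp add: G_def)
      ultimately show ?thesis
        using E[OF x phi(1)[OF y], unfolded 3] hm[OF x phi(1)[OF y]]
        by (simp add: P_def Q_def r_def rs_def del: \<phi>_\<phi> g_\<phi>_left)
    qed
    ultimately have "Q * (?s * ?s + ?k * ?k) = ?k * (r * G - rs * C) + ?s * (r * C + rs * G)" by algebra
    then have "Q = a * G + b * C"
      unfolding sk by (simp add: a_def b_def r_def rs_def algebra_simps add_divide_distrib diff_divide_distrib)
    moreover have "Q = - h p x y + eta p y * h p x (xi p)"
      using x y h_linear[OF p x, of "- y" "eta p y *\<^sub>R xi p"] h_linear(2)[OF p x xi(1) xi(1)] hm[OF x y]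
      by (simp add: Q_def)
    ultimately show ?thesis by (simp add: G_def C_def)
  qed
  \<comment> \<open>At first argument \<open>xi\<close> the \<open>a\<close> and \<open>b\<close>
    terms of \<open>main\<close> vanish; symmetry exchanges the arguments.\<close>
  have "h p x (xi p) = eta p x * h p (xi p) (xi p)"
    using main[OF xi(1) x] h_sym[OF p x xi(1)] x g_\<phi>_left[of "xi p" x] by simp
  then show ?thesis using main[OF x y] by simp
qed

end

section \<open>Frames, traces and contractions\<close>

context scalar_product
begin

lemma V_sum: "(\<And>i. i \<in> I \<Longrightarrow> f i \<in> V) \<Longrightarrow> sum f I \<in> V"
  by (rule subspace_sum[OF V])

lemma g_sum_left: "(\<And>i. i \<in> I \<Longrightarrow> f i \<in> V) \<Longrightarrow> y \<in> V \<Longrightarrow> g (sum f I) y = (\<Sum>i\<in>I. g (f i) y)"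
  by (induction I rule: infinite_finite_induct) (simp_all add: V_sum)

text \<open>Pairing a basis representation of \<open>v\<close> with the frame multiplies its
  coefficients by the Gram matrix, which \<open>h\<close> undoes.\<close>

lemma frame_expansion:
  assumes e: "basis_of e V" and h: "inverse_gram g e h" and v: "v \<in> V"
  shows "v = (\<Sum>a<length e. (\<Sum>d<length e. h a d * g (e ! d) v) *\<^sub>R e ! a)"
proof -
  have d: "distinct e" and s: "span (set e) = V" using e by (auto simp: basis_of_def)
  have eV: "e ! i \<in> V" if "i < length e" for i
    using that s span_base[of "e ! i" "set e"] by simp
  obtain r where r: "v = (\<Sum>w\<in>set e. r w *\<^sub>R w)"
    using v unfolding s[symmetric] span_finite[OF finite_set] by blast
  then have r': "v = (\<Sum>i<length e. r (e ! i) *\<^sub>R e ! i)"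
    using sum.reindex_bij_betw[OF bij_betw_nth[OF d refl refl], of "\<lambda>w. r w *\<^sub>R w"] by simp
  have "(\<Sum>d<length e. h a d * g (e ! d) v) = r (e ! a)" if a: "a < length e" for a
  proof -
    have "g (e ! d) v = (\<Sum>i<length e. r (e ! i) * g (e ! d) (e ! i))" if "d < length e" for d
    proof -
      have "g (e ! d) v = g v (e ! d)" using v eV[OF that] by (rule g_sym[rotated])
      also have "\<dots> = (\<Sum>i<length e. r (e ! i) * g (e ! i) (e ! d))"
        using eV that by (subst r', subst g_sum_left) auto
      finally show ?thesis using eV that g_sym[of "e ! d"] by simp
    qed
    then have "(\<Sum>d<length e. h a d * g (e ! d) v) = (\<Sum>d<length e. \<Sum>i<length e. r (e ! i) * (h a d * g (e ! d) (e ! i)))"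
      by (simp add: sum_distrib_left algebra_simps)
    also have "\<dots> = (\<Sum>i<length e. r (e ! i) * (\<Sum>d<length e. h a d * g (e ! d) (e ! i)))"
      by (subst sum.swap) (simp add: sum_distrib_left)
    also have "\<dots> = (\<Sum>i<length e. r (e ! i) * (if a = i then 1 else 0))"
      using h a unfolding inverse_gram_def by (intro sum.cong) auto
    also have "\<dots> = (\<Sum>i<length e. if i = a then r (e ! i) else 0)"
      by (intro sum.cong) auto
    finally show ?thesis using a by simp
  qed
  then show ?thesis by (subst r') simp
qed

end

context contact_norden_space
begin

lemma \<phi>_diff [simp]: "x \<in> V \<Longrightarrow> y \<in> V \<Longrightarrow> \<phi> (x - y) = \<phi> x - \<phi> y"
  using \<phi>_add[of x "- y"] by simp

lemma \<phi>_sum: "(\<And>i. i \<in> I \<Longrightarrow> f i \<in> V) \<Longrightarrow> \<phi> (sum f I) = (\<Sum>i\<in>I. \<phi> (f i))"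
  using \<phi>_scale[of 0 0] by (induction I rule: infinite_finite_induct) (simp_all add: V_sum)

lemma \<eta>_sum: "(\<And>i. i \<in> I \<Longrightarrow> f i \<in> V) \<Longrightarrow> \<eta> (sum f I) = (\<Sum>i\<in>I. \<eta> (f i))"
  by (induction I rule: infinite_finite_induct) (simp_all add: V_sum)

text \<open>A horizontal set \<open>S\<close> of maximal size with \<open>\<xi>\<close>,
  \<open>S\<close>, \<open>\<phi> S\<close> independent already spans: a horizontal vector outside
  could be added together with its image, since \<open>\<phi>\<close> has no real eigenvalue on the
  kernel of \<open>\<eta>\<close>. The basis serves to show that \<open>\<phi>\<close> is trace
  free.\<close>

lemma adapted_basis:
  assumes "finite W" "V \<subseteq> span W"
  obtains S where "S \<subseteq> V" "\<And>s. s \<in> S \<Longrightarrow> \<eta> s = 0"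
    "independent (insert \<xi> (S \<union> \<phi> ` S))" "span (insert \<xi> (S \<union> \<phi> ` S)) = V"
proof -
  define B where "B S = insert \<xi> (S \<union> \<phi> ` S)" for S
  define ad where "ad S \<longleftrightarrow> S \<subseteq> V \<and> (\<forall>s\<in>S. \<eta> s = 0) \<and> independent (B S)" for S
  have BV: "B S \<subseteq> V" if "ad S" for S using that by (auto simp: ad_def B_def)
  have bound: "finite S \<and> card S \<le> card W" if "ad S" for S
  proof -
    have "finite (B S) \<and> card (B S) \<le> card W"
      using independent_span_bound[OF assms(1), of "B S"] that BV[OF that] assms(2) by (auto simp: ad_def)
    moreover have "S \<subseteq> B S" by (auto simp: B_def)
    ultimately show ?thesis using card_mono[of "B S" S] finite_subset[of S "B S"] by auto
  qed
  have "\<xi> \<noteq> 0" using \<eta>_\<xi> \<eta>_linear(4) by (metis zero_neq_one)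
  then have "ad {}" by (simp add: ad_def B_def)
  then have "\<exists>S. ad S \<and> (\<forall>T. ad T \<longrightarrow> card T \<le> card S)"
    \<comment> \<open>The rule asks for a strict upper bound, hence the successor.\<close>
    by (rule ex_has_greatest_nat[of ad _ _ "Suc (card W)"]) (simp add: bound less_Suc_eq_le)
  then obtain S where S: "ad S" and max: "\<And>T. ad T \<Longrightarrow> card T \<le> card S" by auto
  have spV: "span (B S) \<subseteq> V" by (rule span_minimal[OF BV[OF S] V])
  have B\<phi>: "\<phi> b \<in> span (B S)" if "b \<in> B S" for b
  proof -
    have "\<phi> (\<phi> s) \<in> span (B S)" if "s \<in> S" for s
      using that S span_base[of s "B S"] span_neg by (auto simp: ad_def B_def subset_iff)
    then show ?thesis using that span_base[of _ "B S"] span_zero by (auto simp: B_def)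
  qed
  have span\<phi>: "\<phi> v \<in> span (B S)" if v: "v \<in> span (B S)" for v
  proof -
    have "v \<in> V \<and> \<phi> v \<in> span (B S)"
      using v
    proof (induction rule: span_induct_alt)
      case (step r b v)
      then have "b \<in> V" using BV[OF S] by blast
      then show ?case using step B\<phi>[OF step(1)] by (simp add: span_add span_scale)
    qed (use \<phi>_scale[of 0 0] span_zero in simp)
    then show ?thesis ..
  qed
  have "V \<subseteq> span (B S)"
  proof
    fix x0 assume x0: "x0 \<in> V"
    define x where "x = x0 - \<eta> x0 *\<^sub>R \<xi>"
    have x: "x \<in> V" "\<eta> x = 0" using x0 by (simp_all add: x_def \<eta>_linear)
    have \<phi>\<phi>x: "\<phi> (\<phi> x) = - x" using x by simp
    have "x \<in> span (B S)"
    proof (rule ccontr)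
      assume nx: "x \<notin> span (B S)"
      have n\<phi>x: "\<phi> x \<notin> span (insert x (B S))"
      proof
        assume "\<phi> x \<in> span (insert x (B S))"
        then obtain k where k: "\<phi> x - k *\<^sub>R x \<in> span (B S)" unfolding span_insert by auto
        then have "\<phi> (\<phi> x - k *\<^sub>R x) \<in> span (B S)" by (rule span\<phi>)
        moreover have "\<phi> (\<phi> x - k *\<^sub>R x) = - x - k *\<^sub>R \<phi> x"
          using x \<phi>_add[of "\<phi> x" "- (k *\<^sub>R x)"] by simp
        \<comment> \<open>Adding \<open>k\<close> times the known member cancels
          \<open>\<phi> x\<close> and leaves \<open>x\<close> with factor
          \<open>- 1 - k * k\<close>, which is never zero over the reals.\<close>
        ultimately have "(- x - k *\<^sub>R \<phi> x) + k *\<^sub>R (\<phi> x - k *\<^sub>R x) \<in> span (B S)"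
          using k span_add span_scale by metis
        moreover have "(- x - k *\<^sub>R \<phi> x) + k *\<^sub>R (\<phi> x - k *\<^sub>R x) = (- 1 - k * k) *\<^sub>R x"
          by (simp add: algebra_simps)
        ultimately have "(1 / (- 1 - k * k)) *\<^sub>R (- 1 - k * k) *\<^sub>R x \<in> span (B S)"
          using span_scale by metis
        moreover have "- 1 - k * k \<noteq> 0" using zero_le_square[of k] by linarith
        ultimately show False using nx by simp
      qed
      have "B (insert x S) = insert (\<phi> x) (insert x (B S))" by (auto simp: B_def)
      moreover have "independent (insert x (B S))"
        using nx S span_base[of x "B S"] by (simp add: independent_insert ad_def)
      ultimately have "ad (insert x S)"
        using n\<phi>x S x span_base[of "\<phi> x" "insert x (B S)"] by (auto simp: ad_def independent_insert)
      then have "card (insert x S) \<le> card S" by (rule max)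
      moreover have "x \<notin> S" using nx span_base[of x "B S"] by (auto simp: B_def)
      ultimately show False using bound[OF S] by simp
    qed
    moreover have "\<eta> x0 *\<^sub>R \<xi> \<in> span (B S)" by (intro span_scale span_base) (simp add: B_def)
    ultimately have "x + \<eta> x0 *\<^sub>R \<xi> \<in> span (B S)" by (rule span_add)
    then show "x0 \<in> span (B S)" by (simp add: x_def)
  qed
  then show ?thesis
    using that[of S] S spV by (auto simp: ad_def B_def)
qed

end

locale framed_contact_space = contact_norden_space V g \<phi> \<xi> \<eta>
  for V :: "'v::real_vector set" and g and \<phi> and \<xi> and \<eta> +
  fixes e :: "'v list" and h :: "nat \<Rightarrow> nat \<Rightarrow> real"
  assumes basis: "basis_of e V" and gram: "inverse_gram g e h"
begin

abbreviation "m \<equiv> length e"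

lemma e_V [simp]: "a < m \<Longrightarrow> e ! a \<in> V"
  using basis span_base[of "e ! a" "set e"] by (auto simp: basis_of_def)

text \<open>The trace of \<open>L\<close>, as the contraction of \<open>g(x, L y)\<close>, so that
  it can be compared with contractions of curvature in the same frame.\<close>

definition tr :: "('v \<Rightarrow> 'v) \<Rightarrow> real" where
  "tr L = (\<Sum>a<m. \<Sum>d<m. h a d * g (e ! a) (L (e ! d)))"

lemma tr_cong: "(\<And>x. x \<in> V \<Longrightarrow> L x = M x) \<Longrightarrow> tr L = tr M"
  unfolding tr_def by (intro sum.cong refl) simp

lemma tr_id: "tr (\<lambda>x. x) = real m"
proof -
  have "tr (\<lambda>x. x) = (\<Sum>a<m. \<Sum>d<m. h a d * g (e ! d) (e ! a))"
    unfolding tr_def by (intro sum.cong refl arg_cong2[of _ _ _ _ times] g_sym) auto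
  also have "\<dots> = (\<Sum>a<m. 1)"
    using gram unfolding inverse_gram_def by (intro sum.cong) auto
  finally show ?thesis by simp
qed

lemma expansion: "v \<in> V \<Longrightarrow> v = (\<Sum>a<m. (\<Sum>d<m. h a d * g (e ! d) v) *\<^sub>R e ! a)"
  by (rule frame_expansion[OF basis gram])

lemma tr_\<eta>: "tr (\<lambda>x. \<eta> x *\<^sub>R \<xi>) = 1"
proof -
  have "1 = \<eta> (\<Sum>a<m. (\<Sum>d<m. h a d * g (e ! d) \<xi>) *\<^sub>R e ! a)"
    unfolding expansion[OF \<xi>_V, symmetric] by simp
  also have "\<dots> = (\<Sum>a<m. \<Sum>d<m. h a d * (\<eta> (e ! a) * \<eta> (e ! d)))"
    by (subst \<eta>_sum) (simp_all add: sum_distrib_left sum_distrib_right algebra_simps)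
  finally show ?thesis by (simp add: tr_def algebra_simps)
qed

text \<open>In an adapted basis \<open>\<phi>\<close> has zero diagonal. The bulk of the proof
  transfers the trace from the frame \<open>e\<close> to that basis.\<close>

lemma tr_\<phi>: "tr \<phi> = 0"
proof -
  have "V \<subseteq> span (set e)" using basis by (simp add: basis_of_def)
  then obtain S where S: "S \<subseteq> V" "\<And>s. s \<in> S \<Longrightarrow> \<eta> s = 0"
    "independent (insert \<xi> (S \<union> \<phi> ` S))" "span (insert \<xi> (S \<union> \<phi> ` S)) = V"
    using adapted_basis[of "set e"] by auto
  define B where "B = insert \<xi> (S \<union> \<phi> ` S)"
  note B = S(3,4)[folded B_def]
  have BV: "B \<subseteq> V" using S(1) by (auto simp: B_def)
  have fin: "finite B" using independent_span_bound[of "set e" B] B(1) BV basis by (simp add: basis_of_def)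
  let ?r = "representation B"
  have diag: "?r (\<phi> b) b = 0" if b: "b \<in> B" for b
  proof -
    \<comment> \<open>A fixed vector would satisfy \<open>s = - s\<close>, placing zero in an
      independent set.\<close>
    have ne: "\<phi> s \<noteq> s" if "s \<in> S" for s
    proof
      assume "\<phi> s = s"
      then have "s = - s" using S(1,2) that \<phi>_\<phi>[of s] by auto
      then have "(2::real) *\<^sub>R s = 0" unfolding scaleR_2 eq_neg_iff_add_eq_0 .
      then have "0 \<in> B" using that by (simp add: B_def)
      then show False using B(1) dependent_zero by blast
    qed
    consider "b = \<xi>" | "b \<in> S" | s where "s \<in> S" "b = \<phi> s" using b unfolding B_def by blast
    then show ?thesis
    proof cases
      case 1
      then show ?thesis by (simp add: representation_zero)
    next
      case 2
      then have "\<phi> b \<in> B" by (simp add: B_def)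
      then show ?thesis using representation_basis[OF B(1)] ne[OF 2] by simp
    next
      case 3
      then have s: "s \<in> B" "\<phi> b = - s" using S(1,2) by (auto simp: B_def)
      then show ?thesis
        using representation_neg[OF B(1), of s] representation_basis[OF B(1) s(1)] ne[OF 3(1)] 3(2) span_base[of s B] by simp
    qed
  qed
  have \<phi>e: "\<phi> v = (\<Sum>b\<in>B. ?r v b *\<^sub>R \<phi> b)" if "v \<in> V" for v
  proof -
    have "v = (\<Sum>b\<in>B. ?r v b *\<^sub>R b)"
      using sum_representation_eq[OF B(1), of v B] that B(2) fin by simp
    then have "\<phi> v = \<phi> (\<Sum>b\<in>B. ?r v b *\<^sub>R b)" by simp
    then show ?thesis using BV by (subst (asm) \<phi>_sum) (auto simp: subset_iff cong: sum.cong)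
  qed
  \<comment> \<open>Self-adjointness moves \<open>\<phi>\<close> to the first vector, which is
    expanded in \<open>B\<close>. After exchanging sums, the frame expansion of
    \<open>\<phi> b\<close> reappears and leaves its coefficient at \<open>b\<close>.\<close>
  have "g (e ! a) (\<phi> (e ! d)) = (\<Sum>b\<in>B. ?r (e ! a) b * g (e ! d) (\<phi> b))" if ad: "a < m" "d < m" for a d
  proof -
    have "g (e ! a) (\<phi> (e ! d)) = g (\<Sum>b\<in>B. ?r (e ! a) b *\<^sub>R \<phi> b) (e ! d)"
      using ad \<phi>e[of "e ! a", symmetric] by simp
    also have "\<dots> = (\<Sum>b\<in>B. ?r (e ! a) b * g (\<phi> b) (e ! d))"
      using ad BV by (subst g_sum_left) (auto simp: subset_iff cong: sum.cong)
    finally show ?thesis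
      using ad BV g_sym[of "\<phi> b" "e ! d" for b] by (simp add: subset_iff del: g_\<phi>_left cong: sum.cong)
  qed
  then have "tr \<phi> = (\<Sum>a<m. \<Sum>d<m. \<Sum>b\<in>B. h a d * (?r (e ! a) b * g (e ! d) (\<phi> b)))"
    by (simp add: tr_def sum_distrib_left)
  also have "\<dots> = (\<Sum>a<m. \<Sum>b\<in>B. \<Sum>d<m. h a d * (?r (e ! a) b * g (e ! d) (\<phi> b)))"
    by (intro sum.cong refl sum.swap)
  also have "\<dots> = (\<Sum>b\<in>B. \<Sum>a<m. \<Sum>d<m. h a d * (?r (e ! a) b * g (e ! d) (\<phi> b)))"
    by (rule sum.swap)
  also have "\<dots> = (\<Sum>b\<in>B. ?r (\<phi> b) b)"
  proof (rule sum.cong[OF refl])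
    fix b assume b: "b \<in> B"
    then have "\<phi> b \<in> V" using BV by auto
    have "?r (\<phi> b) b = ?r (\<Sum>a<m. (\<Sum>d<m. h a d * g (e ! d) (\<phi> b)) *\<^sub>R e ! a) b"
      unfolding expansion[OF \<open>\<phi> b \<in> V\<close>, symmetric] ..
    also have "\<dots> = (\<Sum>a<m. ?r ((\<Sum>d<m. h a d * g (e ! d) (\<phi> b)) *\<^sub>R e ! a) b)"
      using B(1) by (subst representation_sum) (auto simp: B(2))
    also have "\<dots> = (\<Sum>a<m. (\<Sum>d<m. h a d * g (e ! d) (\<phi> b)) * ?r (e ! a) b)"
      using B(1) by (intro sum.cong refl) (simp add: representation_scale B(2))
    finally show "(\<Sum>a<m. \<Sum>d<m. h a d * (?r (e ! a) b * g (e ! d) (\<phi> b))) = ?r (\<phi> b) b"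
      by (simp add: sum_distrib_left sum_distrib_right algebra_simps)
  qed
  finally show ?thesis using diag by simp
qed

lemma tr_minus: "(\<And>x. x \<in> V \<Longrightarrow> L x \<in> V) \<Longrightarrow> tr (\<lambda>x. - L x) = - tr L"
  by (simp add: tr_def sum_negf)

lemma tr_add: "(\<And>x. x \<in> V \<Longrightarrow> L x \<in> V) \<Longrightarrow> (\<And>x. x \<in> V \<Longrightarrow> M x \<in> V) \<Longrightarrow> tr (\<lambda>x. L x + M x) = tr L + tr M"
  by (simp add: tr_def sum.distrib distrib_left)

lemma tr_zero: "tr (\<lambda>x. 0) = 0"
  by (simp add: tr_def)

lemma tr_\<phi>\<phi>: "tr (\<lambda>x. \<eta> x *\<^sub>R \<xi> - x) = 1 - real m"
  using tr_add[of "\<lambda>x. \<eta> x *\<^sub>R \<xi>" "\<lambda>x. - x"] tr_minus[of "\<lambda>x. x"] by (simp add: tr_id tr_\<eta>)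

definition dtr :: "('v \<Rightarrow> 'v \<Rightarrow> 'v \<Rightarrow> 'v \<Rightarrow> real) \<Rightarrow> real" where
  "dtr T = (\<Sum>a<m. \<Sum>b<m. \<Sum>c<m. \<Sum>d<m. h a d * h b c * T (e ! a) (e ! b) (e ! c) (e ! d))"

text \<open>The common building block of \<open>pi1\<close> to \<open>pi5\<close>, with
  \<open>L\<close> and \<open>M\<close> chosen among the identity, \<open>\<phi>\<close> and the
  projection to \<open>\<xi>\<close>. Inserting \<open>\<phi>\<close> in the last argument replaces
  \<open>M\<close> by its composition with \<open>\<phi>\<close>.\<close>

definition W :: "('v \<Rightarrow> 'v) \<Rightarrow> ('v \<Rightarrow> 'v) \<Rightarrow> 'v \<Rightarrow> 'v \<Rightarrow> 'v \<Rightarrow> 'v \<Rightarrow> real" where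
  "W L M x y z u = g y (L z) * g x (M u) - g x (L z) * g y (M u)"

lemma dtr_cong: "(\<And>x y z u. x \<in> V \<Longrightarrow> y \<in> V \<Longrightarrow> z \<in> V \<Longrightarrow> u \<in> V \<Longrightarrow> T x y z u = T' x y z u) \<Longrightarrow> dtr T = dtr T'"
  unfolding dtr_def by (intro sum.cong refl) simp

lemma dtr_add: "dtr (\<lambda>x y z u. T x y z u + T' x y z u) = dtr T + dtr T'"
  by (simp add: dtr_def sum.distrib distrib_left)

lemma dtr_scale: "dtr (\<lambda>x y z u. r * T x y z u) = r * dtr T"
  by (simp add: dtr_def sum_distrib_left algebra_simps)

text \<open>The first product separates into two traces. In the second the indices form a chain, and
  self-adjointness of \<open>L\<close> with the frame expansion collapses it to the trace of the
  composition.\<close>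

lemma dtr_W:
  assumes L: "\<And>x. x \<in> V \<Longrightarrow> L x \<in> V" "\<And>x y. x \<in> V \<Longrightarrow> y \<in> V \<Longrightarrow> g x (L y) = g (L x) y"
    and M: "\<And>x. x \<in> V \<Longrightarrow> M x \<in> V"
  shows "dtr (W L M) = tr L * tr M - tr (\<lambda>x. L (M x))"
proof -
  have 1: "(\<Sum>a<m. \<Sum>b<m. \<Sum>c<m. \<Sum>d<m. h a d * h b c * (g (e ! b) (L (e ! c)) * g (e ! a) (M (e ! d)))) = tr L * tr M"
    by (simp add: tr_def sum_distrib_left sum_distrib_right algebra_simps)
  have 2: "(\<Sum>b<m. \<Sum>c<m. h b c * (g (e ! a) (L (e ! c)) * g (e ! b) (M (e ! d)))) = g (e ! a) (L (M (e ! d)))"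
    if ad: "a < m" "d < m" for a d
  proof -
    have "g (e ! a) (L (M (e ! d))) = g (L (e ! a)) (M (e ! d))" using ad L M by simp
    also have "\<dots> = g (\<Sum>b<m. (\<Sum>c<m. h b c * g (e ! c) (L (e ! a))) *\<^sub>R e ! b) (M (e ! d))"
      using ad L by (subst expansion[of "L (e ! a)"]) auto
    also have "\<dots> = (\<Sum>b<m. (\<Sum>c<m. h b c * g (e ! c) (L (e ! a))) * g (e ! b) (M (e ! d)))"
      using ad L M by (subst g_sum_left) auto
    also have "\<dots> = (\<Sum>b<m. \<Sum>c<m. h b c * (g (e ! a) (L (e ! c)) * g (e ! b) (M (e ! d))))"
      unfolding sum_distrib_right
    proof (intro sum.cong refl)
      fix b c assume "c \<in> {..<m}"
      then have "g (e ! c) (L (e ! a)) = g (e ! a) (L (e ! c))"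
        using L(2)[of "e ! c" "e ! a"] g_sym[of "L (e ! c)" "e ! a"] L(1) ad by simp
      then show "h b c * g (e ! c) (L (e ! a)) * g (e ! b) (M (e ! d)) =
          h b c * (g (e ! a) (L (e ! c)) * g (e ! b) (M (e ! d)))" by simp
    qed
    finally show ?thesis ..
  qed
  have "(\<Sum>a<m. \<Sum>b<m. \<Sum>c<m. \<Sum>d<m. h a d * h b c * (g (e ! a) (L (e ! c)) * g (e ! b) (M (e ! d)))) =
    (\<Sum>a<m. \<Sum>b<m. \<Sum>d<m. \<Sum>c<m. h a d * (h b c * (g (e ! a) (L (e ! c)) * g (e ! b) (M (e ! d)))))"
    by (subst (2) sum.swap) (simp add: mult.assoc)
  also have "\<dots> = (\<Sum>a<m. \<Sum>d<m. \<Sum>b<m. \<Sum>c<m. h a d * (h b c * (g (e ! a) (L (e ! c)) * g (e ! b) (M (e ! d)))))"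
    by (intro sum.cong refl sum.swap)
  also have "\<dots> = (\<Sum>a<m. \<Sum>d<m. h a d * g (e ! a) (L (M (e ! d))))"
    unfolding sum_distrib_left[symmetric] using 2 by simp
  finally show ?thesis
    using 1 by (simp add: dtr_def W_def right_diff_distrib sum_subtractf tr_def)
qed

lemma dtr_pi:
  "dtr (pi1 g) = real m * (real m - 1)" "dtr (pi2 g \<phi>) = real m - 1" "dtr (pi3 g \<phi>) = 0"
  "dtr (pi4 g \<eta>) = 2 * (real m - 1)" "dtr (pi5 g \<phi> \<eta>) = 0"
  and dtr_pi_\<phi>: "dtr (\<lambda>x y z u. pi1 g x y z (\<phi> u)) = 0" "dtr (\<lambda>x y z u. pi2 g \<phi> x y z (\<phi> u)) = 0"
  "dtr (\<lambda>x y z u. pi3 g \<phi> x y z (\<phi> u)) = (real m - 1) * (real m - 2)"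
  "dtr (\<lambda>x y z u. pi4 g \<eta> x y z (\<phi> u)) = 0" "dtr (\<lambda>x y z u. pi5 g \<phi> \<eta> x y z (\<phi> u)) = 1 - real m"
proof -
  \<comment> \<open>\<open>?P\<close> is the square of \<open>\<phi>\<close>, which arises when the
    last argument is \<open>\<phi> u\<close>.\<close>
  let ?I = "\<lambda>x::'v. x" and ?E = "\<lambda>x. \<eta> x *\<^sub>R \<xi>" and ?P = "\<lambda>x. \<eta> x *\<^sub>R \<xi> - x" and ?Z = "\<lambda>x::'v. 0::'v"
  have I: "dtr (W ?I M) = real m * tr M - tr M" if "\<And>x. x \<in> V \<Longrightarrow> M x \<in> V" for M
    using dtr_W[of ?I M] that by (simp add: tr_id)
  have \<phi>: "dtr (W \<phi> M) = - tr (\<lambda>x. \<phi> (M x))" if "\<And>x. x \<in> V \<Longrightarrow> M x \<in> V" for M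
    using dtr_W[of \<phi> M] that by (simp add: tr_\<phi>)
  have E: "dtr (W ?E M) = tr M - tr (\<lambda>x. \<eta> (M x) *\<^sub>R \<xi>)" if "\<And>x. x \<in> V \<Longrightarrow> M x \<in> V" for M
    using dtr_W[of ?E M] that by (simp add: tr_\<eta> mult.commute)
  have t: "tr (\<lambda>x. \<phi> (\<phi> x)) = 1 - real m" "tr (\<lambda>x. \<phi> (?E x)) = 0" "tr (\<lambda>x. \<eta> (\<phi> x) *\<^sub>R \<xi>) = 0"
    "tr (\<lambda>x. \<eta> (?E x) *\<^sub>R \<xi>) = 1" "tr (\<lambda>x. \<phi> (?P x)) = 0" "tr (\<lambda>x. \<eta> (?P x) *\<^sub>R \<xi>) = 0"
    using tr_cong[of "\<lambda>x. \<phi> (\<phi> x)" ?P] tr_cong[of "\<lambda>x. \<phi> (?E x)" ?Z] tr_cong[of "\<lambda>x. \<eta> (\<phi> x) *\<^sub>R \<xi>" ?Z]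
      tr_cong[of "\<lambda>x. \<eta> (?E x) *\<^sub>R \<xi>" ?E] tr_cong[of "\<lambda>x. \<phi> (?P x)" "\<lambda>x. - \<phi> x"]
      tr_cong[of "\<lambda>x. \<eta> (?P x) *\<^sub>R \<xi>" ?Z] tr_minus[of \<phi>] tr_\<phi>\<phi>
    by (simp_all add: tr_zero tr_\<eta> tr_\<phi>)
  note s = I \<phi> E tr_zero tr_id tr_\<phi> tr_\<eta> tr_\<phi>\<phi> t
  note lin = dtr_add dtr_scale[of "-1", simplified]
  have "dtr (pi1 g) = dtr (W ?I ?I)"
    by (rule dtr_cong) (simp add: pi1_def W_def)
  then show "dtr (pi1 g) = real m * (real m - 1)" by (simp add: s algebra_simps)
  have "dtr (pi2 g \<phi>) = dtr (W \<phi> \<phi>)"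
    by (rule dtr_cong) (simp add: pi2_def W_def)
  then show "dtr (pi2 g \<phi>) = real m - 1" by (simp add: s)
  have "dtr (pi3 g \<phi>) = dtr (\<lambda>x y z u. - W ?I \<phi> x y z u + - W \<phi> ?I x y z u)"
    by (rule dtr_cong) (simp add: pi3_def W_def)
  then show "dtr (pi3 g \<phi>) = 0" by (simp only: lin) (simp add: s)
  have "dtr (pi4 g \<eta>) = dtr (\<lambda>x y z u. W ?E ?I x y z u + W ?I ?E x y z u)"
    by (rule dtr_cong) (simp add: pi4_def W_def algebra_simps)
  then show "dtr (pi4 g \<eta>) = 2 * (real m - 1)" by (simp only: lin) (simp add: s)
  have "dtr (pi5 g \<phi> \<eta>) = dtr (\<lambda>x y z u. W ?E \<phi> x y z u + W \<phi> ?E x y z u)"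
    by (rule dtr_cong) (simp add: pi5_def W_def algebra_simps)
  then show "dtr (pi5 g \<phi> \<eta>) = 0" by (simp only: lin) (simp add: s)
  have "dtr (\<lambda>x y z u. pi1 g x y z (\<phi> u)) = dtr (W ?I \<phi>)"
    by (rule dtr_cong) (simp add: pi1_def W_def)
  then show "dtr (\<lambda>x y z u. pi1 g x y z (\<phi> u)) = 0" by (simp add: s)
  have "dtr (\<lambda>x y z u. pi2 g \<phi> x y z (\<phi> u)) = dtr (W \<phi> ?P)"
    by (rule dtr_cong) (simp add: pi2_def W_def)
  then show "dtr (\<lambda>x y z u. pi2 g \<phi> x y z (\<phi> u)) = 0" by (simp add: s del: \<phi>_add)
  have "dtr (\<lambda>x y z u. pi3 g \<phi> x y z (\<phi> u)) = dtr (\<lambda>x y z u. - W ?I ?P x y z u + - W \<phi> \<phi> x y z u)"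
    by (rule dtr_cong) (simp add: pi3_def W_def)
  then show "dtr (\<lambda>x y z u. pi3 g \<phi> x y z (\<phi> u)) = (real m - 1) * (real m - 2)"
    by (simp only: lin) (simp add: s algebra_simps)
  have "dtr (\<lambda>x y z u. pi4 g \<eta> x y z (\<phi> u)) = dtr (W ?E \<phi>)"
    by (rule dtr_cong) (simp add: pi4_def W_def algebra_simps)
  then show "dtr (\<lambda>x y z u. pi4 g \<eta> x y z (\<phi> u)) = 0" by (simp add: s)
  have "dtr (\<lambda>x y z u. pi5 g \<phi> \<eta> x y z (\<phi> u)) = dtr (W ?E ?P)"
    by (rule dtr_cong) (simp add: pi5_def W_def algebra_simps)
  then show "dtr (\<lambda>x y z u. pi5 g \<phi> \<eta> x y z (\<phi> u)) = 1 - real m" by (simp add: s)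
qed

lemma double_traces:
  assumes T: "\<And>x y z u. x \<in> V \<Longrightarrow> y \<in> V \<Longrightarrow> z \<in> V \<Longrightarrow> u \<in> V \<Longrightarrow> T x y z u =
    c1 * pi1 g x y z u + c2 * pi2 g \<phi> x y z u + c3 * pi3 g \<phi> x y z u + c4 * pi4 g \<eta> x y z u + c5 * pi5 g \<phi> \<eta> x y z u"
  shows "dtr T = c1 * (real m * (real m - 1)) + c2 * (real m - 1) + c4 * (2 * (real m - 1))"
    and "dtr (\<lambda>x y z u. T x y z (\<phi> u)) = c3 * ((real m - 1) * (real m - 2)) - c5 * (real m - 1)"
proof -
  have "dtr T = dtr (\<lambda>x y z u. c1 * pi1 g x y z u + c2 * pi2 g \<phi> x y z u + c3 * pi3 g \<phi> x y z u
      + c4 * pi4 g \<eta> x y z u + c5 * pi5 g \<phi> \<eta> x y z u)"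
    by (rule dtr_cong[OF T])
  also have "\<dots> = c1 * dtr (pi1 g) + c2 * dtr (pi2 g \<phi>) + c3 * dtr (pi3 g \<phi>) + c4 * dtr (pi4 g \<eta>) + c5 * dtr (pi5 g \<phi> \<eta>)"
    by (simp only: dtr_add dtr_scale)
  finally show "dtr T = c1 * (real m * (real m - 1)) + c2 * (real m - 1) + c4 * (2 * (real m - 1))"
    by (simp add: dtr_pi)
  have "dtr (\<lambda>x y z u. T x y z (\<phi> u)) = dtr (\<lambda>x y z u. c1 * pi1 g x y z (\<phi> u) + c2 * pi2 g \<phi> x y z (\<phi> u)
      + c3 * pi3 g \<phi> x y z (\<phi> u) + c4 * pi4 g \<eta> x y z (\<phi> u) + c5 * pi5 g \<phi> \<eta> x y z (\<phi> u))"
    by (rule dtr_cong) (simp only: T \<phi>_V)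
  also have "\<dots> = c1 * dtr (\<lambda>x y z u. pi1 g x y z (\<phi> u)) + c2 * dtr (\<lambda>x y z u. pi2 g \<phi> x y z (\<phi> u))
      + c3 * dtr (\<lambda>x y z u. pi3 g \<phi> x y z (\<phi> u)) + c4 * dtr (\<lambda>x y z u. pi4 g \<eta> x y z (\<phi> u))
      + c5 * dtr (\<lambda>x y z u. pi5 g \<phi> \<eta> x y z (\<phi> u))"
    by (simp only: dtr_add dtr_scale)
  finally show "dtr (\<lambda>x y z u. T x y z (\<phi> u)) = c3 * ((real m - 1) * (real m - 2)) - c5 * (real m - 1)"
    by (simp add: dtr_pi_\<phi> algebra_simps)
qed

end

text \<open>Guards the definite descriptions of the scalar curvatures: without a frame and inverse
  Gram matrix every number would satisfy them. The inverse comes from inverting the linear map given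
  by the Gram matrix.\<close>

lemma (in smooth_manifold) frame_exists:
  assumes "scalar_product (tangent_space A p) G"
  obtains e h where "basis_of e (tangent_space A p)" "inverse_gram G e h"
proof -
  interpret scalar_product "tangent_space A p" G by (rule assms)
  obtain U c where U: "(U, c) \<in> A" "p \<in> U" by (rule chart_at)
  let ?v = "coord_vec A U c p"
  note lin = coord_vec_linear[OF U]
  have v[simp]: "?v a \<in> tangent_space A p" for a by (rule coord_vec_tangent[OF U])
  obtain bs :: "'e list" where bs: "set bs = Basis" "distinct bs"
    using finite_distinct_list[OF finite_Basis] by blast
  have gv: "G (?v a) w = (\<Sum>b\<in>Basis. (a \<bullet> b) * G (?v b) w)" if "w \<in> tangent_space A p" for a w
  proof -
    have "?v a = (\<Sum>b\<in>Basis. (a \<bullet> b) *\<^sub>R ?v b)"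
      using tangent_space_expand[OF U v, of a] by (simp only: coord_vec_coordinate[OF U])
    then have "G (?v a) w = G (\<Sum>b\<in>Basis. (a \<bullet> b) *\<^sub>R ?v b) w" by simp
    also have "\<dots> = (\<Sum>b\<in>Basis. (a \<bullet> b) * G (?v b) w)"
      using that by (subst g_sum_left) auto
    finally show ?thesis .
  qed
  \<comment> \<open>The Gram matrix of the coordinate basis as an endomorphism of the model space,
    where injective implies surjective.\<close>
  define L where "L a = (\<Sum>b\<in>Basis. G (?v a) (?v b) *\<^sub>R b)" for a
  have L: "linear L"
    by (intro linearI) (simp_all add: L_def linear_add[OF lin] linear_scale[OF lin] scaleR_add_left
      sum.distrib scaleR_sum_right)
  have "inj L"
    unfolding linear_injective_0[OF L]
  proof (intro allI impI)
    fix a assume "L a = 0"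
    then have 0: "G (?v a) (?v b) = 0" if "b \<in> Basis" for b
      using that unfolding L_def by (metis inner_sum_left_Basis inner_zero_left)
    have "?v a = 0"
    proof (rule g_nondeg[OF v])
      fix y assume "y \<in> tangent_space A p"
      then obtain d where d: "y = ?v d" using tangent_space_chart[OF U] by auto
      have "G (?v d) (?v a) = 0"
        by (subst gv[OF v]) (simp add: g_sym[of "?v b" "?v a" for b] 0)
      then show "G (?v a) y = 0" unfolding d by (simp add: g_sym[of "?v a"])
    qed
    then show "a = 0" using coord_vec_inj[OF U] linear_0[OF lin] by (metis injD)
  qed
  then have "surj L" using linear_injective_imp_surjective[OF L] by blast
  then obtain M where M: "\<And>b. L (M b) = b" by (metis surjD)
  have LM: "G (?v (M b)) (?v b') = b \<bullet> b'" if "b' \<in> Basis" for b b'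
    using arg_cong[OF M[of b], of "\<lambda>x. x \<bullet> b'"] that by (simp add: L_def)
  let ?e = "map ?v bs"
  have "basis_of ?e (tangent_space A p)"
    using coord_vec_basis[OF U] bs inj_on_subset[OF coord_vec_inj[OF U]]
    by (simp add: basis_of_def distinct_map)
  moreover have "inverse_gram G ?e (\<lambda>i l. M (bs ! i) \<bullet> bs ! l)"
    unfolding inverse_gram_def
  proof (intro allI impI)
    fix i j assume ij: "i < length ?e" "j < length ?e"
    have B: "bs ! k \<in> Basis" if "k < length bs" for k using bs(1) that nth_mem by blast
    have "(\<Sum>l<length ?e. M (bs ! i) \<bullet> bs ! l * G (?e ! l) (?e ! j)) =
        (\<Sum>b\<in>Basis. M (bs ! i) \<bullet> b * G (?v b) (?v (bs ! j)))"
      using ij sum.reindex_bij_betw[OF bij_betw_nth[OF bs(2) refl bs(1)[symmetric]],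
        of "\<lambda>b. M (bs ! i) \<bullet> b * G (?v b) (?v (bs ! j))"] by simp
    also have "\<dots> = bs ! i \<bullet> bs ! j"
      using gv[OF v, of "M (bs ! i)" "bs ! j"] LM[OF B, of j "bs ! i"] ij by simp
    also have "\<dots> = (if i = j then 1 else 0)"
      using B ij bs(2) by (simp add: inner_Basis nth_eq_iff_index_eq)
    finally show "(\<Sum>l<length ?e. M (bs ! i) \<bullet> bs ! l * G (?e ! l) (?e ! j)) = (if i = j then 1 else 0)" .
  qed
  ultimately show ?thesis by (rule that)
qed


section \<open>Assembly of the curvature formulas\<close>

context hypersurface
begin

text \<open>With \<open>h = (a + r) eta eta - a g - b g(., phi .)\<close>, the quadratic expression
  in the Gauss equation equals
  \<open>a a pi1 + b b pi2 - a b pi3 - a (a + r) pi4 - b (a + r) pi5\<close>; the square of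
  \<open>eta eta\<close> drops by antisymmetry.\<close>

lemma curvature_formula:
  fixes n :: nat and x y z u
  assumes p: "\<iota> p \<in> U" and n: "n \<ge> 1" and dim: "DIM('e) \<ge> 3"
    and const: "constant_totally_real_curvatures A' J g' D' \<nu>' \<nu>t'"
    and F45: "F4_F5_manifold n A g D phi xi eta"
    and x: "x \<in> tangent_space A p" and y: "y \<in> tangent_space A p"
    and z: "z \<in> tangent_space A p" and u: "u \<in> tangent_space A p"
  defines "\<theta> \<equiv> theta A g D phi xi eta p (xi p)" and "\<theta>s \<equiv> theta_star A g D phi xi eta p (xi p)"
  defines "a \<equiv> (\<theta> * cos (tt p) + \<theta>s * sin (tt p)) / (2 * real n)"
    and "b \<equiv> (\<theta> * sin (tt p) - \<theta>s * cos (tt p)) / (2 * real n)"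
    and "r \<equiv> - xi p tt / (2 * cos (tt p))"
  shows "curvature4 A g D p x y z u =
    (\<nu>' (\<iota> p) - a * a) * pi1 (g p) x y z u + (- \<nu>' (\<iota> p) - b * b) * pi2 (g p) (phi p) x y z u
    + (\<nu>t' (\<iota> p) + a * b) * pi3 (g p) (phi p) x y z u
    + (a * (a + r) - \<nu>t' (\<iota> p) * tan (tt p)) * pi4 (g p) (eta p) x y z u
    + (b * (a + r) - \<nu>' (\<iota> p) * tan (tt p)) * pi5 (g p) (phi p) (eta p) x y z u"
proof -
  have r: "h p (xi p) (xi p) = r"
    using deriv_t[OF p xi(1)] cos_t[of p] by (simp add: r_def)
  note h = second_fundamental_form[OF p n F45, folded \<theta>_def \<theta>s_def, folded a_def b_def, unfolded r]
  note R = amb.constant_curvature_tensor[OF const dim push_tangent[OF x] push_tangent[OF y] push_tangent[OF z] push_tangent[OF u]]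
  show ?thesis
    using gauss_equation[OF p x y z u]
    unfolding R h[OF y z] h[OF x u] h[OF x z] h[OF y u] pi1_def pi2_def pi3_def pi4_def pi5_def
      g_push_J_push[OF x u] g_push_J_push[OF y z] g_push_J_push[OF x z] g_push_J_push[OF y u] g_eq[symmetric]
    by algebra
qed

end

theorem corollary3p1:
  fixes A' :: "('m::{t2_space, second_countable_topology}, 'e::euclidean_space) atlas"
    and A :: "('h::{t2_space, second_countable_topology}, 'f::euclidean_space) atlas"
    and J :: "'m \<Rightarrow> 'm tvec \<Rightarrow> 'm tvec"
    and g' :: "'m \<Rightarrow> 'm tvec \<Rightarrow> 'm tvec \<Rightarrow> real"
    and D' :: "'m \<Rightarrow> 'm tvec \<Rightarrow> ('m \<Rightarrow> 'm tvec) \<Rightarrow> 'm tvec"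
    and \<nu>' \<nu>t' :: "'m \<Rightarrow> real"
    and \<iota> :: "'h \<Rightarrow> 'm"
    and N :: "'h \<Rightarrow> 'm tvec"
    and t :: "'h \<Rightarrow> real"
    and \<phi> :: "'h \<Rightarrow> 'h tvec \<Rightarrow> 'h tvec"
    and \<xi> :: "'h \<Rightarrow> 'h tvec"
    and \<eta> :: "'h \<Rightarrow> 'h tvec \<Rightarrow> real"
    and g :: "'h \<Rightarrow> 'h tvec \<Rightarrow> 'h tvec \<Rightarrow> real"
    and D :: "'h \<Rightarrow> 'h tvec \<Rightarrow> ('h \<Rightarrow> 'h tvec) \<Rightarrow> 'h tvec"
    and \<theta> \<theta>s :: "'h \<Rightarrow> real"
    and n :: nat
    and p :: 'h
  assumes dims: "n \<ge> 1" "DIM('e) = 2 * n + 2" "DIM('f) = 2 * n + 1"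
    and ambient: "kaehler_norden A' J g' D'"
    and constant_curvatures: "constant_totally_real_curvatures A' J g' D' \<nu>' \<nu>t'"
    and hypersurface: "timelike_hypersurface A A' g' \<iota> N"
    and t: "t = induced_t J g' \<iota> N"
    and phi: "\<phi> = induced_phi A A' J g' \<iota> N"
    and xi: "\<xi> = induced_xi A A' J g' \<iota> N"
    and eta: "\<eta> = induced_eta A' J g' \<iota> N"
    and g: "g = induced_metric A' g' \<iota>"
    and D: "levi_civita A g D"
    and F4_F5: "F4_F5_manifold n A g D \<phi> \<xi> \<eta>"
    and theta_xi: "\<theta> = (\<lambda>q. theta A g D \<phi> \<xi> \<eta> q (\<xi> q))"
    and theta_star_xi: "\<theta>s = (\<lambda>q. theta_star A g D \<phi> \<xi> \<eta> q (\<xi> q))"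
  shows "(\<forall>x\<in>tangent_space A p. \<forall>y\<in>tangent_space A p.
         \<forall>z\<in>tangent_space A p. \<forall>u\<in>tangent_space A p.
      curvature4 A g D p x y z u =
        \<nu>' (\<iota> p) * (pi1 (g p) x y z u - pi2 (g p) (\<phi> p) x y z u
                      - tan (t p) * pi5 (g p) (\<phi> p) (\<eta> p) x y z u)
        + \<nu>t' (\<iota> p) * (pi3 (g p) (\<phi> p) x y z u - tan (t p) * pi4 (g p) (\<eta> p) x y z u)
        - \<xi> p t / (4 * real n * cos (t p)) *
            (\<theta> p * (sin (t p) * pi5 (g p) (\<phi> p) (\<eta> p) x y z u
                     + cos (t p) * pi4 (g p) (\<eta> p) x y z u)
             + \<theta>s p * (sin (t p) * pi4 (g p) (\<eta> p) x y z u
                        - cos (t p) * pi5 (g p) (\<phi> p) (\<eta> p) x y z u))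
        - ((\<theta> p)\<^sup>2 + (\<theta>s p)\<^sup>2) / (4 * (real n)\<^sup>2) * pi2 (g p) (\<phi> p) x y z u
        - (\<theta> p * cos (t p) + \<theta>s p * sin (t p))\<^sup>2 / (4 * (real n)\<^sup>2) *
            (pi1 (g p) x y z u - pi2 (g p) (\<phi> p) x y z u - pi4 (g p) (\<eta> p) x y z u)
        + (\<theta> p * cos (t p) + \<theta>s p * sin (t p)) * (\<theta> p * sin (t p) - \<theta>s p * cos (t p))
            / (4 * (real n)\<^sup>2) *
            (pi3 (g p) (\<phi> p) x y z u + pi5 (g p) (\<phi> p) (\<eta> p) x y z u))
    \<and> (scalar_curvature A g D p =
        4 * real n * (real n * \<nu>' (\<iota> p) - \<nu>t' (\<iota> p) * tan (t p))
        - \<xi> p t * \<theta> p - \<xi> p t * \<theta>s p * tan (t p)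
        - (real n - 1) / real n * (\<theta> p * cos (t p) + \<theta>s p * sin (t p))\<^sup>2
        - ((\<theta> p)\<^sup>2 + (\<theta>s p)\<^sup>2) / (2 * real n))
    \<and> (associated_scalar_curvature A g D \<phi> p =
        2 * real n * (2 * real n - 1) * \<nu>t' (\<iota> p) + 2 * real n * \<nu>' (\<iota> p) * tan (t p)
        + \<xi> p t * \<theta> p / 2 * tan (t p) - \<xi> p t * \<theta>s p / 2
        + (real n - 1) / real n * (\<theta> p * sin (t p) - \<theta>s p * cos (t p))
            * (\<theta> p * cos (t p) + \<theta>s p * sin (t p)))
    \<and> (\<forall>\<alpha>. \<forall>x\<in>tangent_space A p.
        \<alpha> \<subseteq> tangent_space A p \<and> basis_of [\<phi> p x, \<phi> p (\<phi> p x)] \<alpha> \<and> \<phi> p ` \<alpha> = \<alpha> \<and>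
        pi1 (g p) (\<phi> p x) (\<phi> p (\<phi> p x)) (\<phi> p (\<phi> p x)) (\<phi> p x) \<noteq> 0 \<longrightarrow>
        sectional_curvature A g D p (\<phi> p x) (\<phi> p (\<phi> p x))
          = - ((\<theta> p)\<^sup>2 + (\<theta>s p)\<^sup>2) / (4 * (real n)\<^sup>2))
    \<and> (\<forall>\<alpha> x y. \<alpha> \<subseteq> tangent_space A p \<and> basis_of [x, y] \<alpha> \<and>
        orthogonal_sets (g p) \<alpha> (\<phi> p ` \<alpha>) \<and> orthogonal_sets (g p) \<alpha> {\<xi> p} \<and>
        pi1 (g p) x y y x \<noteq> 0 \<longrightarrow>
        sectional_curvature A g D p x y
          = \<nu>' (\<iota> p) - (\<theta> p * cos (t p) + \<theta>s p * sin (t p))\<^sup>2 / (4 * (real n)\<^sup>2))"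
proof -
  note dim = dims and eqs = t phi xi eta and th_eqs = theta_xi theta_star_xi
  interpret amb0: kaehler_norden_manifold A' J g' D' by unfold_locales (rule ambient)
  obtain U c where U: "(U, c) \<in> A'" "\<iota> p \<in> U" by (rule amb0.chart_at)
  have gD: "connection A D" "\<And>p X Y. field_near A p X \<Longrightarrow> field_near A p Y \<Longrightarrow> D p (X p) Y - D p (Y p) X = bracket A X Y p"
    using D unfolding levi_civita_def by auto
  interpret hypersurface A D A' J g' D' \<iota> U c N g
    by unfold_locales
      (use hypersurface U(1) g D gD in \<open>auto simp: timelike_hypersurface_def\<close>)
  interpret contact_norden_space "tangent_space A p" "g p" "\<phi> p" "\<xi> p" "\<eta> p"
    unfolding eqs by (rule contact)
  define a where "a = (\<theta> p * cos (t p) + \<theta>s p * sin (t p)) / (2 * real n)"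
  define b where "b = (\<theta> p * sin (t p) - \<theta>s p * cos (t p)) / (2 * real n)"
  define r where "r = - \<xi> p t / (2 * cos (t p))"
  have k: "cos (t p) \<noteq> 0" using cos_t[of p] by (simp add: eqs)
  have n0: "real n \<noteq> 0" using dim by simp
  have R: "curvature4 A g D p x y z u =
    (\<nu>' (\<iota> p) - a * a) * pi1 (g p) x y z u + (- \<nu>' (\<iota> p) - b * b) * pi2 (g p) (\<phi> p) x y z u
    + (\<nu>t' (\<iota> p) + a * b) * pi3 (g p) (\<phi> p) x y z u
    + (a * (a + r) - \<nu>t' (\<iota> p) * tan (t p)) * pi4 (g p) (\<eta> p) x y z u
    + (b * (a + r) - \<nu>' (\<iota> p) * tan (t p)) * pi5 (g p) (\<phi> p) (\<eta> p) x y z u"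
    if "x \<in> tangent_space A p" "y \<in> tangent_space A p" "z \<in> tangent_space A p" "u \<in> tangent_space A p" for x y z u
    using curvature_formula[OF U(2) dim(1) _ constant_curvatures F4_F5[unfolded eqs] that] dim
    by (simp add: a_def b_def r_def th_eqs eqs)
  have sk: "(sin (t p))\<^sup>2 + (cos (t p))\<^sup>2 = 1" by simp
  have aa: "(\<theta> p * cos (t p) + \<theta>s p * sin (t p))\<^sup>2 / (4 * (real n)\<^sup>2) = a * a"
    and bb: "(\<theta> p * sin (t p) - \<theta>s p * cos (t p))\<^sup>2 / (4 * (real n)\<^sup>2) = b * b"
    and abm: "(\<theta> p * cos (t p) + \<theta>s p * sin (t p)) * (\<theta> p * sin (t p) - \<theta>s p * cos (t p)) / (4 * (real n)\<^sup>2) = a * b"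
    by (simp_all add: a_def b_def power2_eq_square)
  \<comment> \<open>Up to the factor \<open>1 / 2n\<close>, the pair \<open>(a, b)\<close> is an
    orthogonal image of \<open>(\<theta>, \<theta>s)\<close>, so the sum of squares is
    preserved.\<close>
  have ab: "((\<theta> p)\<^sup>2 + (\<theta>s p)\<^sup>2) / (4 * (real n)\<^sup>2) = a * a + b * b"
  proof -
    have "(\<theta> p * cos (t p) + \<theta>s p * sin (t p))\<^sup>2 + (\<theta> p * sin (t p) - \<theta>s p * cos (t p))\<^sup>2 =
      ((\<theta> p)\<^sup>2 + (\<theta>s p)\<^sup>2) * ((sin (t p))\<^sup>2 + (cos (t p))\<^sup>2)" by algebra
    from arg_cong[OF this, of "\<lambda>x. x / (4 * (real n)\<^sup>2)"] show ?thesis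
      unfolding sk add_divide_distrib aa bb by (simp add: add_divide_distrib)
  qed
  \<comment> \<open>Substitutes \<open>\<xi> p t = - 2 * r * cos t\<close> and collects the
    coefficients of \<open>pi4\<close> and \<open>pi5\<close> into \<open>a\<close> and
    \<open>b\<close>.\<close>
  have dt: "\<xi> p t / (4 * real n * cos (t p)) * (\<theta> p * (sin (t p) * P5 + cos (t p) * P4) + \<theta>s p * (sin (t p) * P4 - cos (t p) * P5)) =
    - r * (a * P4 + b * P5)" for P4 P5
    using k n0 by (simp add: a_def b_def r_def field_simps)
  \<comment> \<open>One concrete frame yields the uniqueness half of both \<open>THE\<close> terms
    below.\<close>
  obtain e h where e: "basis_of e (tangent_space A p)" and h: "inverse_gram (g p) e h"
    using dom.frame_exists[OF scalar_product_axioms] .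
  have tr: "(\<Sum>a<length e. \<Sum>b<length e. \<Sum>c<length e. \<Sum>d<length e.
       h a d * h b c * curvature4 A g D p (e ! a) (e ! b) (e ! c) (e ! d)) =
       (\<nu>' (\<iota> p) - a * a) * ((2 * real n + 1) * (2 * real n)) - (\<nu>' (\<iota> p) + b * b) * (2 * real n)
       + (a * (a + r) - \<nu>t' (\<iota> p) * tan (t p)) * (4 * real n)" (is "?tr e h = ?\<tau>")
    and tr\<phi>: "(\<Sum>a<length e. \<Sum>b<length e. \<Sum>c<length e. \<Sum>d<length e.
       h a d * h b c * curvature4 A g D p (e ! a) (e ! b) (e ! c) (\<phi> p (e ! d))) =
       (\<nu>t' (\<iota> p) + a * b) * (2 * real n * (2 * real n - 1)) - (b * (a + r) - \<nu>' (\<iota> p) * tan (t p)) * (2 * real n)"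
       (is "?tr\<phi> e h = ?\<tau>\<phi>")
    if "basis_of e (tangent_space A p)" "inverse_gram (g p) e h" for e h
  proof -
    interpret framed_contact_space "tangent_space A p" "g p" "\<phi> p" "\<xi> p" "\<eta> p" e h
      by unfold_locales (rule that)+
    have m: "real (length e) = 2 * real n + 1"
      using dom.basis_of_length[OF that(1)] dim by simp
    show "?tr e h = ?\<tau>" "?tr\<phi> e h = ?\<tau>\<phi>"
      using double_traces[OF R] by (simp_all add: dtr_def m algebra_simps)
  qed
  have scal: "scalar_curvature A g D p = ?\<tau>"
    unfolding scalar_curvature_def double_contraction_def
  proof (rule the_equality)
    show "\<forall>e h. basis_of e (tangent_space A p) \<and> inverse_gram (g p) e h \<longrightarrow> ?\<tau> = ?tr e h"
      using tr by simp
    fix s assume "\<forall>e h. basis_of e (tangent_space A p) \<and> inverse_gram (g p) e h \<longrightarrow> s = ?tr e h"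
    then have "s = ?tr e h" using e h by blast
    then show "s = ?\<tau>" using tr[OF e h] by simp
  qed
  have scal\<phi>: "associated_scalar_curvature A g D \<phi> p = ?\<tau>\<phi>"
    unfolding associated_scalar_curvature_def double_contraction_def
  proof (rule the_equality)
    show "\<forall>e h. basis_of e (tangent_space A p) \<and> inverse_gram (g p) e h \<longrightarrow> ?\<tau>\<phi> = ?tr\<phi> e h"
      using tr\<phi> by simp
    fix s assume "\<forall>e h. basis_of e (tangent_space A p) \<and> inverse_gram (g p) e h \<longrightarrow> s = ?tr\<phi> e h"
    then have "s = ?tr\<phi> e h" using e h by blast
    then show "s = ?\<tau>\<phi>" using tr\<phi>[OF e h] by simp
  qed
  have th: "\<xi> p t * \<theta> p + \<xi> p t * \<theta>s p * tan (t p) = - 4 * real n * r * a"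
    "\<xi> p t * \<theta> p / 2 * tan (t p) - \<xi> p t * \<theta>s p / 2 = - 2 * real n * r * b"
    using k n0 by (simp_all add: a_def b_def r_def tan_def field_simps)
  have sc: "(real n - 1) / real n * w = 4 * real n * (real n - 1) * (w / (4 * (real n)\<^sup>2))"
    "w / (2 * real n) = 2 * real n * (w / (4 * (real n)\<^sup>2))" for w
    using n0 by (simp_all add: field_simps power2_eq_square)
  have a2: "(real n - 1) / real n * (\<theta> p * cos (t p) + \<theta>s p * sin (t p))\<^sup>2 = 4 * real n * (real n - 1) * (a * a)"
    "(real n - 1) / real n * (\<theta> p * sin (t p) - \<theta>s p * cos (t p)) * (\<theta> p * cos (t p) + \<theta>s p * sin (t p))
      = 4 * real n * (real n - 1) * (a * b)"
    "((\<theta> p)\<^sup>2 + (\<theta>s p)\<^sup>2) / (2 * real n) = 2 * real n * (a * a + b * b)"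
    unfolding sc(1)[of "(\<theta> p * cos (t p) + \<theta>s p * sin (t p))\<^sup>2"] sc(2) ab aa abm[symmetric]
    using sc(1)[of "(\<theta> p * cos (t p) + \<theta>s p * sin (t p)) * (\<theta> p * sin (t p) - \<theta>s p * cos (t p))"]
    by (simp_all add: mult_ac)
  show ?thesis
  proof (intro conjI ballI allI impI, goal_cases)
    case mem: (1 x y z u)
    show ?case unfolding R[OF mem] dt ab aa abm by algebra
  next
    case 2
    show ?case unfolding scal a2 using th(1) by algebra
  next
    case 3
    show ?case unfolding scal\<phi> a2 using th(2) by algebra
  next
    case \<alpha>: (4 \<alpha> x)
    define X where "X = \<phi> p x"
    have X: "X \<in> tangent_space A p" "\<eta> p X = 0" "\<phi> p (\<phi> p X) = - X" using \<alpha>(1) by (simp_all add: X_def)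
    let ?P = "pi1 (g p) X (\<phi> p X) (\<phi> p X) X"
    \<comment> \<open>On a holomorphic plane \<open>pi2\<close> coincides with \<open>pi1\<close>,
      so the ambient curvature cancels between their coefficients.\<close>
    have "pi2 (g p) (\<phi> p) X (\<phi> p X) (\<phi> p X) X = ?P" "pi3 (g p) (\<phi> p) X (\<phi> p X) (\<phi> p X) X = 0"
      "pi4 (g p) (\<eta> p) X (\<phi> p X) (\<phi> p X) X = 0" "pi5 (g p) (\<phi> p) (\<eta> p) X (\<phi> p X) (\<phi> p X) X = 0"
      using X(1,2) by (simp_all add: pi1_def pi2_def pi3_def pi4_def pi5_def)
    then have "curvature4 A g D p X (\<phi> p X) (\<phi> p X) X = - (a * a + b * b) * ?P"
      using X(1) by (simp add: R algebra_simps)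
    then show ?case
      unfolding minus_divide_left[symmetric] ab using \<alpha>(2)
      unfolding sectional_curvature_def X_def[symmetric] by simp
  next
    case \<alpha>: (5 \<alpha> x y)
    then have "x \<in> \<alpha>" "y \<in> \<alpha>"
      using span_base[of x "{x, y}"] span_base[of y "{x, y}"] by (auto simp: basis_of_def)
    then have mem: "x \<in> tangent_space A p" "y \<in> tangent_space A p"
      and o: "g p x (\<phi> p x) = 0" "g p y (\<phi> p y) = 0" "g p x (\<phi> p y) = 0" "g p y (\<phi> p x) = 0" "g p x (\<xi> p) = 0" "g p y (\<xi> p) = 0"
      using \<alpha> by (auto simp: orthogonal_sets_def)
    \<comment> \<open>Total reality and orthogonality to \<open>\<xi>\<close> annihilate
      \<open>pi2\<close> to \<open>pi5\<close>, leaving only the \<open>pi1\<close> term.\<close>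
    then have "\<eta> p x = 0" "\<eta> p y = 0" by simp_all
    then have "curvature4 A g D p x y y x = (\<nu>' (\<iota> p) - a * a) * pi1 (g p) x y y x"
      using mem o by (simp add: R pi2_def pi3_def pi4_def pi5_def)
    then show ?case
      using \<alpha> unfolding aa sectional_curvature_def by simp
  qed
qed

end
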